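(* Let $W\in\mathbb{Z}^{m\times(n_2+\bar n_2)}$, let $\Xi^q\subseteq\mathbb{R}^{n_2+\bar n_2}$, and assume that $-\infty<v^q(s)<+\infty$ for all $q\in\Xi^q$ and $s\in\mathbb{R}^m$. Let $T$ be a random $m\times n_1$ matrix and let $\alpha\in\mathbb{R}^m$. Then there exist finite constants $C_1,C_2>0$, not depending on $q$, such that for every fixed (deterministic) $q\in\Xi^q$ and for all $f\in\mathcal{H}^m$ the following holds. If $h$ is a random vector in $\mathbb{R}^m$ with joint probability density function $f$, independent of $T$, with $\mathbb{E}[\|h\|_1]<+\infty$, then $$\|Q-\hat Q\|_\infty\le C_1\cdot\|q\|_1\cdot\sum_{i=1}^m\mathbb{E}\big[|\Delta|f_i(\cdot|h_{-i})\big]$$ and $$\|Q-\tilde Q_\alpha\|_\infty\le C_2\cdot\|q\|_1\cdot\sum_{i=1}^m\mathbb{E}\big[|\Delta|f_i(\cdot|h_{-i})\big].$$ Here $Q(x)=\mathbb{E}[v^q(h-Tx)]$, $\hat Q(x)=\mathbb{E}[\hat v^q(h-Tx)]$, $\tilde Q_\alpha(x)=\mathbb{E}[\tilde v^q_\alpha(h,Tx)]$ for $x\in\mathbb{R}^{n_1}$ (expectation over $(T,h)$, taken to be finite), and $\|Q-\tilde Q\|_\infty:=\sup_{x\in\mathbb{R}^{n_1}}|Q(x)-\tilde Q(x)|$ for $\tilde Q\in\{\hat Q,\tilde Q_\alpha\}$.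
   Context: Value function: $Y:=\mathbb{Z}_+^{n_2}\times\mathbb{R}_+^{\bar n_2}$ and $v^q(s):=\min_{y\in Y}\{q^\top y\mid Wy=s\}$, $s\in\mathbb{R}^m$. Bases: enumerate by $k$ the finitely many invertible $m\times m$ submatrices $B^k$ of $W$ formed by $m$ columns of $W$ (basis matrices); $N^k$ is the matrix of the remaining columns of $W$, and $q_{B^k},q_{N^k}$ (resp. $y_{B^k},y_{N^k}$) are the corresponding subvectors of $q$ (resp. $y$). Let $(\lambda^q_k)^\top:=q_{B^k}^\top(B^k)^{-1}$. $K^q$ is the set of indices $k$ for which $B^k$ is dual feasible for $q$, i.e. $(\lambda^q_k)^\top W\le q^\top$. Periodic functions: for $k\in K^q$, the Gomory relaxation $v^q_{B^k}(s)$ is the optimal value of the problem defining $v^q(s)$ after dropping the nonnegativity constraints on the basic variables $y_{B^k}$ only (integrality of the first $n_2$ variables, including basic ones, and nonnegativity of $y_{N^k}$ are kept). Define $\psi^q_k(s):=v^q_{B^k}(s)-(\lambda^q_k)^\top s$. It is $B^k$-periodic, i.e. $\psi^q_k(s)=\psi^q_k(s+B^k\ell)$ for all $s\in\mathbb{R}^m$, $\ell\in\mathbb{Z}^m$; hence it is also $p_kI_m$-periodic with $p_k:=|\det B^k|$. Its mean value is $\Gamma^q_k:=p_k^{-m}\int_0^{p_k}\cdots\int_0^{p_k}\psi^q_k(s)\,ds_1\cdots ds_m$. Shifted LP-relaxation approximation: $\hat v^q(s):=\max_{k\in K^q}\{(\lambda^q_k)^\top s+\Gamma^q_k\}$, $s\in\mathbb{R}^m$.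 $\alpha$-approximation: $\tilde v^q_\alpha(h,Tx):=\max_{k\in K^q}\{(\lambda^q_k)^\top(h-Tx)+\psi^q_k(h-\alpha)\}$. Total variation: for $g:\mathbb{R}\to\mathbb{R}$, $|\Delta|g:=\sup\sum_{i=1}^N|g(z_{i+1})-g(z_i)|$, the supremum over all finite ordered sets $z_1<\dots<z_{N+1}$ in $\mathbb{R}$; $g$ is of bounded variation if $|\Delta|g<+\infty$. Densities: for a joint pdf $f$ on $\mathbb{R}^m$ and $t_{-i}\in\mathbb{R}^{m-1}$ (the vector $t$ without its $i$th component), $f_i(\cdot|t_{-i})$ is the one-dimensional conditional density of the $i$th component given the other components, $f_i(t_i|t_{-i})=f(t)/f_{-i}(t_{-i})$ with $f_{-i}$ the marginal density (set to the zero function where $f_{-i}(t_{-i})\in\{0,\infty\}$). $\mathcal{H}^m$ is the set of all $m$-dimensional joint pdfs $f$ such that $f_i(\cdot|t_{-i})$ is of bounded variation for all $t_{-i}\in\mathbb{R}^{m-1}$, $i=1,\dots,m$. The expectation $\mathbb{E}[|\Delta|f_i(\cdot|h_{-i})]$ is over $h_{-i}$ and takes values in $[0,+\infty]$. *)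

theory Defs
  imports "HOL-Probability.Probability"
begin

text \<open>
  The type \<^typ>\<open>'m\<close> indexes the rows of the recourse matrix \<open>W\<close>, the type \<^typ>\<open>'n\<close> its columns.
  The set \<open>I\<close> consists of the columns belonging to the integer variables (so \<open>n\<^sub>2 = card I\<close>); its
  complement belongs to the continuous ones. Either set may be empty.

  \<open>milp_value W I P q s\<close> is the optimal value of minimising \<open>q \<bullet> y\<close> subject to \<open>W y = s\<close>,
  integrality of the variables in \<open>I\<close> and nonnegativity of the variables in \<open>P\<close>. It is \<open>\<infinity>\<close> if the
  problem is infeasible and \<open>- \<infinity>\<close> if it is unbounded. For integral \<open>W\<close> a finite infimum is
  attained, also for real \<open>q\<close>, so it is the minimum.
\<close>

definition milp_value ::
  "real^'n^'m \<Rightarrow> 'n set \<Rightarrow> 'n set \<Rightarrow> real^'n \<Rightarrow> real^'m \<Rightarrow> ereal" where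
  "milp_value W I P q s =
     (INF y \<in> {y. W *v y = s \<and> (\<forall>j\<in>I. y $ j \<in> \<int>) \<and> (\<forall>j\<in>P. 0 \<le> y $ j)}. ereal (q \<bullet> y))"

definition value_fun :: "real^'n^'m \<Rightarrow> 'n set \<Rightarrow> real^'n \<Rightarrow> real^'m \<Rightarrow> ereal" where
  "value_fun W I q s = milp_value W I UNIV q s"

text \<open>
  A choice of \<open>m\<close> columns is a function \<open>b\<close> from row to column indices; \<open>basis_mat W b\<close> consists of
  the columns \<open>b i\<close>. Invertibility forces \<open>b\<close> to be injective. Each basis of \<open>W\<close> is listed once for
  every ordering of its columns, but the quantities \<open>dual_mult\<close>, \<open>psi\<close>, \<open>period\<close> and \<open>Gamma_mean\<close>
  below do not depend on this ordering.
\<close>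

definition basis_mat :: "real^'n^'m \<Rightarrow> ('m \<Rightarrow> 'n) \<Rightarrow> real^'m^'m" where
  "basis_mat W b = (\<chi> i j. W $ i $ b j)"

definition dual_mult :: "real^'n^'m \<Rightarrow> real^'n \<Rightarrow> ('m \<Rightarrow> 'n) \<Rightarrow> real^'m" where
  "dual_mult W q b = (\<chi> j. q $ b j) v* matrix_inv (basis_mat W b)"

definition dual_feasible :: "real^'n^'m \<Rightarrow> real^'n \<Rightarrow> ('m \<Rightarrow> 'n) set" where
  "dual_feasible W q =
     {b. invertible (basis_mat W b) \<and> (\<forall>j. (dual_mult W q b v* W) $ j \<le> q $ j)}"

text \<open>Only the nonbasic variables keep their sign constraint; all integrality constraints stay.\<close>

definition gomory_value ::
  "real^'n^'m \<Rightarrow> 'n set \<Rightarrow> real^'n \<Rightarrow> ('m \<Rightarrow> 'n) \<Rightarrow> real^'m \<Rightarrow> ereal" where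
  "gomory_value W I q b s = milp_value W I (- range b) q s"

definition psi ::
  "real^'n^'m \<Rightarrow> 'n set \<Rightarrow> real^'n \<Rightarrow> ('m \<Rightarrow> 'n) \<Rightarrow> real^'m \<Rightarrow> real" where
  "psi W I q b s = real_of_ereal (gomory_value W I q b s) - dual_mult W q b \<bullet> s"

definition period :: "real^'n^'m \<Rightarrow> ('m \<Rightarrow> 'n) \<Rightarrow> real" where
  "period W b = \<bar>det (basis_mat W b)\<bar>"

definition Gamma_mean :: "real^'n^'m \<Rightarrow> 'n set \<Rightarrow> real^'n \<Rightarrow> ('m \<Rightarrow> 'n) \<Rightarrow> real" where
  "Gamma_mean W I q b =
     (LINT s : cbox 0 (\<chi> i. period W b) | lborel. psi W I q b s) / period W b ^ CARD('m)"
  for W :: "real^'n^'m"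

text \<open>
  The set \<^term>\<open>dual_feasible W q\<close> is finite, and it is nonempty whenever \<^term>\<open>value_fun W I q\<close> is
  finite everywhere, by linear programming duality; only then are the following maxima meaningful.
\<close>

definition value_hat :: "real^'n^'m \<Rightarrow> 'n set \<Rightarrow> real^'n \<Rightarrow> real^'m \<Rightarrow> real" where
  "value_hat W I q s =
     Max ((\<lambda>b. dual_mult W q b \<bullet> s + Gamma_mean W I q b) ` dual_feasible W q)"

definition value_alpha ::
  "real^'n^'m \<Rightarrow> 'n set \<Rightarrow> real^'n \<Rightarrow> real^'m \<Rightarrow> real^'m \<Rightarrow> real^'m \<Rightarrow> real" where
  "value_alpha W I q \<alpha> h z =
     Max ((\<lambda>b. dual_mult W q b \<bullet> (h - z) + psi W I q b (h - \<alpha>)) ` dual_feasible W q)"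

definition total_variation :: "(real \<Rightarrow> real) \<Rightarrow> ennreal" where
  "total_variation g =
     (SUP (N, z) \<in> {(N :: nat, z :: nat \<Rightarrow> real). strict_mono_on {..N} z}.
        \<Sum>i<N. ennreal \<bar>g (z (Suc i)) - g (z i)\<bar>)"

text \<open>
  The argument \<open>t\<^sub>-\<^sub>i\<close> is represented by a full vector \<open>t\<close> whose \<open>i\<close>th component is ignored:
  \<open>subst_comp t i u\<close> is \<open>t\<close> with \<open>i\<close>th component replaced by \<open>u\<close>.
\<close>

definition subst_comp :: "real^'m \<Rightarrow> 'm \<Rightarrow> real \<Rightarrow> real^'m" where
  "subst_comp t i u = (\<chi> j. if j = i then u else t $ j)"

definition marginal_density :: "(real^'m \<Rightarrow> real) \<Rightarrow> 'm \<Rightarrow> real^'m \<Rightarrow> ennreal" where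
  "marginal_density f i t = (\<integral>\<^sup>+ u. ennreal (f (subst_comp t i u)) \<partial>lborel)"

definition cond_density :: "(real^'m \<Rightarrow> real) \<Rightarrow> 'm \<Rightarrow> real^'m \<Rightarrow> real \<Rightarrow> real" where
  "cond_density f i t u =
     (if marginal_density f i t \<in> {0, \<infinity>} then 0
      else f (subst_comp t i u) / enn2real (marginal_density f i t))"

definition bv_densities :: "(real^'m \<Rightarrow> real) set" where
  "bv_densities =
     {f \<in> borel_measurable borel. (\<forall>t. 0 \<le> f t) \<and> (\<integral>\<^sup>+ t. ennreal (f t) \<partial>lborel) = 1 \<and>
        (\<forall>i t. total_variation (cond_density f i t) < \<infinity>)}"

definition norm_1 :: "real^'n \<Rightarrow> real" where
  "norm_1 x = (\<Sum>i\<in>UNIV. \<bar>x $ i\<bar>)"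

text \<open>
  Independence of two random vectors of possibly different types; \<^const>\<open>prob_space.indep_var\<close>
  requires both to take values in the same type.
\<close>

definition indep_rvs ::
  "'w measure \<Rightarrow> ('w \<Rightarrow> 'a::topological_space) \<Rightarrow> ('w \<Rightarrow> 'b::topological_space) \<Rightarrow> bool" where
  "indep_rvs M X Y \<longleftrightarrow>
     prob_space.indep_set M
       {X -` A \<inter> space M | A. A \<in> sets borel} {Y -` A \<inter> space M | A. A \<in> sets borel}"

text \<open>
  Expected recourse cost as a function of the first-stage decision \<open>x\<close>, for a recourse cost \<open>u h z\<close>
  depending on \<open>h\<close> and on the tender \<open>z = T x\<close>.
\<close>

definition expected_cost ::
  "'w measure \<Rightarrow> ('w \<Rightarrow> real^'k^'m) \<Rightarrow> ('w \<Rightarrow> real^'m) \<Rightarrow>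
   (real^'m \<Rightarrow> real^'m \<Rightarrow> real) \<Rightarrow> real^'k \<Rightarrow> real" where
  "expected_cost M T h u x = (LINT \<omega>|M. u (h \<omega>) (T \<omega> *v x))"

definition finite_expected_cost ::
  "'w measure \<Rightarrow> ('w \<Rightarrow> real^'k^'m) \<Rightarrow> ('w \<Rightarrow> real^'m) \<Rightarrow>
   (real^'m \<Rightarrow> real^'m \<Rightarrow> real) \<Rightarrow> bool" where
  "finite_expected_cost M T h u \<longleftrightarrow> (\<forall>x. integrable M (\<lambda>\<omega>. u (h \<omega>) (T \<omega> *v x)))"

definition sup_dist :: "('a \<Rightarrow> real) \<Rightarrow> ('a \<Rightarrow> real) \<Rightarrow> ennreal" where
  "sup_dist F G = (SUP x. ennreal \<bar>F x - G x\<bar>)"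

definition recourse :: "real^'n^'m \<Rightarrow> 'n set \<Rightarrow> real^'n \<Rightarrow> real^'m \<Rightarrow> real^'m \<Rightarrow> real" where
  "recourse W I q h z = real_of_ereal (value_fun W I q (h - z))"

definition recourse_hat :: "real^'n^'m \<Rightarrow> 'n set \<Rightarrow> real^'n \<Rightarrow> real^'m \<Rightarrow> real^'m \<Rightarrow> real" where
  "recourse_hat W I q h z = value_hat W I q (h - z)"

end

theory Submission
  imports Defs
begin

text \<open>
  Write \<open>B\<close> for the basis matrix of a basis \<open>b\<close>, \<open>\<lambda>\<^sub>b\<close> for its dual multiplier and \<open>P\<close> for a common
  multiple of all \<open>|det B|\<close>. For every \<open>s\<close> some dual feasible basis has \<open>B\<^sup>-\<^sup>1 s \<ge> 0\<close>. Rounding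
  \<open>B\<^sup>-\<^sup>1 s\<close> down bounds the distance of \<open>v s\<close> from \<open>\<lambda>\<^sub>b \<bullet> s\<close>, and \<open>psi\<close>, by a multiple of
  \<open>norm_1 q\<close>. If \<open>B\<^sup>-\<^sup>1 s\<close> is large in every component, reducing the nonbasic variables modulo
  \<open>|det B|\<close> shows that the Gomory relaxation is exact, and a periodicity argument shows that the same
  \<open>b\<close> attains the maximum in both approximations. So off finitely many slabs, which depend on \<open>W\<close>
  only, the error \<open>g\<close> is locally a difference of two \<open>P\<close>-periodic functions with equal means, and
  its average over the cube \<open>s + [0, P)\<^sup>m\<close> vanishes.

  Averaging over the cube turns \<open>\<integral> g f\<close> into integrals of \<open>g (t) (f (t) - f (t - u))\<close> with
  \<open>u \<in> [0, P)\<^sup>m\<close> and an integral of \<open>f\<close> over the slabs. Both are bounded by total variations of \<open>f\<close>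
  along the coordinate axes.
\<close>

section \<open>Bases and linear programming duality\<close>

text \<open>Both approximations replace \<open>psi\<close> by a function of the same period and
  mean: by the constant \<open>Gamma_mean\<close>, or by \<open>psi\<close> with its argument moved
  by \<open>z - \<alpha>\<close>, because \<open>h - \<alpha>\<close> is
  \<open>(h - z) + (z - \<alpha>)\<close>. One estimate therefore serves both. Uniformity in
  \<open>q\<close> shapes the constants. The dual feasible bases vary with \<open>q\<close>, so
  periods, slabs and bounds are taken over all invertible basis matrices of \<open>W\<close>, a
  finite family. The cost enters only when an inner product with a vector of bounded norm is
  estimated by \<open>norm_1 q\<close>. The error does not decay; it is merely bounded and
  oscillating. Cancellation can only come from a density that changes little over one period, which
  is what the variation measures. On the slabs nothing cancels, and their probability has to be
  small instead: a nonnegative integrable function of one variable is pointwise at most its total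
  variation, so a density that puts much mass on a slab has large variation as well.\<close>

lemma matrix_inv_invertible:
  fixes A :: "real^'m^'m"
  assumes "invertible A"
  shows "A ** matrix_inv A = mat 1" "matrix_inv A ** A = mat 1"
  using someI_ex[of "\<lambda>A'. A ** A' = mat 1 \<and> A' ** A = mat 1"] assms
  unfolding invertible_def matrix_inv_def by blast+

definition basic_coords :: "real^'n^'m \<Rightarrow> ('m \<Rightarrow> 'n) \<Rightarrow> real^'m \<Rightarrow> real^'m" where
  "basic_coords W b s = matrix_inv (basis_mat W b) *v s"

text \<open>The sum makes this linear in \<open>x\<close> and meaningful for every \<open>b\<close>.
  For injective \<open>b\<close> it places \<open>x $ i\<close> at column \<open>b i\<close> and
  zeros elsewhere, which turns basic coordinates into a vector of decision variables.\<close>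

definition embed_basic :: "('m \<Rightarrow> 'n) \<Rightarrow> real^'m \<Rightarrow> real^'n" where
  "embed_basic b x = (\<chi> j. \<Sum>i\<in>UNIV. if b i = j then x $ i else 0)"

definition int_vec :: "real^'n \<Rightarrow> bool" where
  "int_vec x \<longleftrightarrow> (\<forall>j. x $ j \<in> \<int>)"

lemma basic_coords_linear [simp]: "linear (basic_coords W b)"
  unfolding basic_coords_def by simp

lemmas basic_coords_add = linear_add[OF basic_coords_linear]
  and basic_coords_diff = linear_diff[OF basic_coords_linear]
  and basic_coords_scale = linear_scale[OF basic_coords_linear]

lemma basis_mult_coords:
  "invertible (basis_mat W b) \<Longrightarrow> basis_mat W b *v basic_coords W b s = s"
  by (simp add: basic_coords_def matrix_vector_mul_assoc matrix_inv_invertible)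

lemma coords_basis_mult:
  "invertible (basis_mat W b) \<Longrightarrow> basic_coords W b (basis_mat W b *v x) = x"
  by (simp add: basic_coords_def matrix_vector_mul_assoc matrix_inv_invertible)

lemma mult_embed_basic: "W *v embed_basic b x = basis_mat W b *v x"
proof (rule vec_eq_iff[THEN iffD2], rule allI)
  fix k
  have "(W *v embed_basic b x) $ k
      = (\<Sum>j\<in>UNIV. \<Sum>i\<in>UNIV. if b i = j then W $ k $ j * x $ i else 0)"
    by (simp add: matrix_vector_mult_def embed_basic_def sum_distrib_left if_distrib cong: if_cong)
  also have "\<dots> = (\<Sum>i\<in>UNIV. \<Sum>j\<in>UNIV. if b i = j then W $ k $ j * x $ i else 0)"
    by (rule sum.swap)
  also have "\<dots> = (basis_mat W b *v x) $ k"
    by (simp add: matrix_vector_mult_def basis_mat_def)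
  finally show "(W *v embed_basic b x) $ k = (basis_mat W b *v x) $ k" .
qed

lemma inner_embed_basic: "q \<bullet> embed_basic b x = (\<chi> i. q $ b i) \<bullet> x"
proof -
  have "q \<bullet> embed_basic b x = (\<Sum>j\<in>UNIV. \<Sum>i\<in>UNIV. if b i = j then q $ j * x $ i else 0)"
    by (simp add: inner_vec_def embed_basic_def sum_distrib_left if_distrib cong: if_cong)
  also have "\<dots> = (\<Sum>i\<in>UNIV. \<Sum>j\<in>UNIV. if b i = j then q $ j * x $ i else 0)"
    by (rule sum.swap)
  finally show ?thesis by (simp add: inner_vec_def)
qed

lemma embed_basic_nonneg: "(\<And>i. 0 \<le> x $ i) \<Longrightarrow> 0 \<le> embed_basic b x $ j"
  by (auto simp: embed_basic_def intro!: sum_nonneg)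

lemma embed_basic_notin: "j \<notin> range b \<Longrightarrow> embed_basic b x $ j = 0"
  by (auto simp: embed_basic_def intro!: sum.neutral)

lemma embed_basic_Ints:
  "(\<And>i. b i = j \<Longrightarrow> x $ i \<in> \<int>) \<Longrightarrow> embed_basic b x $ j \<in> \<int>"
  by (auto simp: embed_basic_def intro!: Ints_sum)

lemma inj_basis:
  assumes "invertible (basis_mat W b)"
  shows "inj b"
proof (rule injI, rule ccontr)
  fix i j assume "b i = b j" "i \<noteq> j"
  then have "det (basis_mat W b) = 0"
    by (intro det_identical_columns[of i j]) (auto simp: column_def basis_mat_def vec_eq_iff)
  with assms show False by (simp add: invertible_det_nz)
qed

lemma embed_basic_restrict:
  assumes "inj b" "\<And>j. j \<notin> range b \<Longrightarrow> y $ j = 0"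
  shows "embed_basic b (\<chi> i. y $ b i) = y"
proof (rule vec_eq_iff[THEN iffD2], rule allI)
  fix j
  show "embed_basic b (\<chi> i. y $ b i) $ j = y $ j"
  proof (cases "j \<in> range b")
    case True
    then obtain k where k: "j = b k" by auto
    have "embed_basic b (\<chi> i. y $ b i) $ j = (\<Sum>i\<in>UNIV. if i = k then y $ b i else 0)"
      unfolding embed_basic_def k using assms(1) by (auto simp: inj_eq intro!: sum.cong)
    then show ?thesis by (simp add: k)
  next
    case False
    then show ?thesis by (simp add: embed_basic_notin assms(2))
  qed
qed

lemma embed_basic_apply:
  assumes "inj b" shows "embed_basic b x $ b k = x $ k"
proof -
  have "embed_basic b x $ b k = (\<Sum>i\<in>UNIV. if i = k then x $ i else 0)"
    unfolding embed_basic_def using assms by (auto simp: inj_eq intro!: sum.cong)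
  then show ?thesis by simp
qed

lemma det_Ints:
  fixes A :: "real^'m^'m"
  assumes "\<And>i j. A $ i $ j \<in> \<int>"
  shows "det A \<in> \<int>"
  unfolding det_def using assms by (intro Ints_sum Ints_mult Ints_prod) auto

text \<open>By Cramer's rule the product is the determinant of the basis matrix with one column
  replaced by \<open>w\<close>, an integer matrix. This is the source of the period
  \<open>\<bar>det B\<bar>\<close>.\<close>

lemma det_coords_Ints:
  assumes "\<forall>i j. W $ i $ j \<in> \<int>" and b: "invertible (basis_mat W b)" and "int_vec w"
  shows "det (basis_mat W b) * basic_coords W b w $ k \<in> \<int>"
proof -
  let ?B = "basis_mat W b"
  have nz: "det ?B \<noteq> 0" using b invertible_det_nz by blast
  have "basic_coords W b w = (\<chi> k. det(\<chi> i j. if j=k then w$i else ?B$i$j) / det ?B)"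
    using cramer[OF nz, of "basic_coords W b w" w] basis_mult_coords[OF b, of w] by blast
  then have "det ?B * basic_coords W b w $ k = det(\<chi> i j. if j=k then w$i else ?B$i$j)"
    using nz by simp
  also have "\<dots> \<in> \<int>"
    using assms by (intro det_Ints) (auto simp: basis_mat_def int_vec_def)
  finally show ?thesis .
qed

lemma int_vec_mult: "\<forall>i j. W $ i $ j \<in> \<int> \<Longrightarrow> int_vec y \<Longrightarrow> int_vec (W *v y)"
  unfolding int_vec_def matrix_vector_mult_def by (auto intro!: Ints_sum Ints_mult)

definition reduced_cost :: "real^'n^'m \<Rightarrow> real^'n \<Rightarrow> ('m \<Rightarrow> 'n) \<Rightarrow> real^'n" where
  "reduced_cost W q b = q - dual_mult W q b v* W"

text \<open>The part of the cost fixed by the right-hand side is separated from the part priced by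
  reduced costs. Comparing two solutions of the same system then means comparing reduced costs
  only.\<close>

lemma cost_split: "q \<bullet> y = dual_mult W q b \<bullet> (W *v y) + reduced_cost W q b \<bullet> y"
  by (simp add: reduced_cost_def inner_diff_left dot_lmul_matrix)

lemma dual_mult_inner: "dual_mult W q b \<bullet> s = (\<chi> i. q $ b i) \<bullet> basic_coords W b s"
  by (simp add: dual_mult_def basic_coords_def dot_lmul_matrix)

lemma vector_matrix_mult_basis: "(l v* W) $ b i = (l v* basis_mat W b) $ i"
  by (simp add: vector_matrix_mult_def basis_mat_def)

lemma dual_mult_basis:
  "invertible (basis_mat W b) \<Longrightarrow> dual_mult W q b v* basis_mat W b = (\<chi> i. q $ b i)"
  by (simp add: dual_mult_def vector_matrix_mul_assoc matrix_inv_invertible)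

lemma reduced_cost_basic:
  "invertible (basis_mat W b) \<Longrightarrow> reduced_cost W q b $ b i = 0"
  by (simp add: reduced_cost_def vector_matrix_mult_basis dual_mult_basis)

lemma dual_feasible_iff:
  "b \<in> dual_feasible W q \<longleftrightarrow> invertible (basis_mat W b) \<and> (\<forall>j. 0 \<le> reduced_cost W q b $ j)"
  by (simp add: dual_feasible_def reduced_cost_def)

lemma finite_dual_feasible: "finite (dual_feasible (W :: real^'n^'m) q)"
  by (rule finite_subset[OF subset_UNIV]) simp

lemma milp_value_le:
  "W *v y = s \<Longrightarrow> (\<forall>j\<in>I. y $ j \<in> \<int>) \<Longrightarrow> (\<forall>j\<in>P. 0 \<le> y $ j) \<Longrightarrow>
    milp_value W I P q s \<le> ereal (q \<bullet> y)"
  unfolding milp_value_def by (rule INF_lower) auto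

lemma milp_value_ge:
  "(\<And>y. W *v y = s \<Longrightarrow> (\<forall>j\<in>I. y $ j \<in> \<int>) \<Longrightarrow> (\<forall>j\<in>P. 0 \<le> y $ j) \<Longrightarrow> c \<le> ereal (q \<bullet> y)) \<Longrightarrow>
    c \<le> milp_value W I P q s"
  unfolding milp_value_def by (rule INF_greatest) auto

lemma milp_value_antimono: "P \<subseteq> P' \<Longrightarrow> milp_value W I P q s \<le> milp_value W I P' q s"
  unfolding milp_value_def by (rule INF_superset_mono) auto

lemma inner_le_norm_1: "q \<bullet> y \<le> norm_1 q * norm y"
proof -
  have "q \<bullet> y \<le> (\<Sum>i\<in>UNIV. \<bar>q $ i\<bar> * norm y)"
    unfolding inner_vec_def
  proof (rule sum_mono)
    fix i
    have "q $ i \<bullet> y $ i \<le> \<bar>q $ i\<bar> * \<bar>y $ i\<bar>" by (simp add: abs_mult[symmetric])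
    also have "\<dots> \<le> \<bar>q $ i\<bar> * norm y" by (intro mult_left_mono component_le_norm_cart) auto
    finally show "q $ i \<bullet> y $ i \<le> \<bar>q $ i\<bar> * norm y" .
  qed
  then show ?thesis by (simp add: norm_1_def sum_distrib_right)
qed

lemma norm_1_nonneg [simp]: "0 \<le> norm_1 q"
  by (simp add: norm_1_def sum_nonneg)

section \<open>Existence of optimal bases\<close>

lemma caratheodory_support:
  fixes W :: "real^'n^'m"
  assumes ray: "\<And>d. W *v d = 0 \<Longrightarrow> (\<forall>j. 0 \<le> d $ j) \<Longrightarrow> 0 \<le> q \<bullet> d"
    and "\<forall>j. 0 \<le> y $ j"
  shows "\<exists>y'. (\<forall>j. 0 \<le> y' $ j) \<and> W *v y' = W *v y \<and> q \<bullet> y' \<le> q \<bullet> y \<and>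
    (\<forall>d. W *v d = 0 \<longrightarrow> (\<forall>j. y' $ j = 0 \<longrightarrow> d $ j = 0) \<longrightarrow> d = 0)"
  using assms(2)
proof (induction "card {j. y $ j \<noteq> 0}" arbitrary: y rule: less_induct)
  case less
  show ?case
  proof (cases "\<forall>d. W *v d = 0 \<longrightarrow> (\<forall>j. y $ j = 0 \<longrightarrow> d $ j = 0) \<longrightarrow> d = 0")
    case True
    then show ?thesis using less.prems by blast
  next
    case False
    then obtain d0 where d0: "W *v d0 = 0" "\<And>j. y $ j = 0 \<Longrightarrow> d0 $ j = 0" "d0 \<noteq> 0" by blast
    \<comment> \<open>If the columns in the support of \<open>y\<close> are dependent,
      \<open>y\<close> can be moved along a kernel direction inside its support. The sign of the
      direction is chosen so that the cost does not rise. A negative component must exist, since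
      otherwise \<open>ray\<close> is violated; for cost zero either sign is allowed and the one
      producing a negative component is taken.\<close>
    have "\<exists>d. W *v d = 0 \<and> (\<forall>j. y $ j = 0 \<longrightarrow> d $ j = 0) \<and> q \<bullet> d \<le> 0 \<and> (\<exists>j. d $ j < 0)"
    proof -
      have n: "W *v (- d0) = 0" using d0(1) by (metis matrix_vector_mult_diff_distrib
        diff_0 matrix_vector_mult_0_right diff_self)
      consider "q \<bullet> d0 < 0" | "q \<bullet> d0 > 0" | "q \<bullet> d0 = 0" by linarith
      then show ?thesis
      proof cases
        case 1
        then show ?thesis using ray[OF d0(1)] d0 by (intro exI[of _ d0]) (auto simp: not_le[symmetric])
      next
        case 2
        then have "\<not> (\<forall>j. 0 \<le> (- d0) $ j)" using ray[OF n] by auto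
        then show ?thesis using n d0 2 by (intro exI[of _ "- d0"]) (auto simp: not_le)
      next
        case 3
        obtain j where j: "d0 $ j \<noteq> 0" using d0(3) by (auto simp: vec_eq_iff)
        show ?thesis
        proof (cases "d0 $ j < 0")
          case True
          then show ?thesis using d0 3 by (intro exI[of _ d0]) auto
        next
          case False
          then have "(- d0) $ j < 0" using j by simp
          then show ?thesis using n d0 3 by (intro exI[of _ "- d0"]) auto
        qed
      qed
    qed
    then obtain d k where d: "W *v d = 0" "\<And>j. y $ j = 0 \<Longrightarrow> d $ j = 0" "q \<bullet> d \<le> 0" "d $ k < 0"
      by blast
    define N where "N = {j. d $ j < 0}"
    \<comment> \<open>This is the ratio test: the largest step that keeps \<open>y\<close>
      nonnegative. A component attaining the minimum becomes zero, so the support shrinks and the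
      induction applies.\<close>
    define t where "t = Min ((\<lambda>j. y $ j / (- d $ j)) ` N)"
    have N: "finite N" "N \<noteq> {}" using d(4) by (auto simp: N_def)
    have "t \<in> (\<lambda>j. y $ j / (- d $ j)) ` N" unfolding t_def using N by (intro Min_in) auto
    then obtain l where l: "l \<in> N" "t = y $ l / (- d $ l)" by auto
    have tle: "t \<le> y $ j / (- d $ j)" if "j \<in> N" for j
      unfolding t_def using N that by (intro Min_le) auto
    have t0: "0 \<le> t" using l less.prems by (auto simp: N_def divide_nonneg_neg)
    define y' where "y' = y + t *\<^sub>R d"
    have nn: "\<forall>j. 0 \<le> y' $ j"
    proof
      fix j
      show "0 \<le> y' $ j"
      proof (cases "j \<in> N")
        case True
        then have "t * (- d $ j) \<le> y $ j"
          using tle[OF True] True pos_le_divide_eq[of "- d $ j" t "y $ j"] by (simp add: N_def)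
        then show ?thesis by (simp add: y'_def)
      next
        case False
        then show ?thesis using less.prems t0 by (auto simp: y'_def N_def not_less)
      qed
    qed
    have yl: "y $ l \<noteq> 0" using d(2)[of l] l by (auto simp: N_def)
    have yl': "y' $ l = 0" using l by (auto simp: y'_def N_def)
    have "card {j. y' $ j \<noteq> 0} < card {j. y $ j \<noteq> 0}"
      using yl yl' d(2) by (intro psubset_card_mono) (auto simp: y'_def)
    from less.hyps[OF this nn] obtain y'' where y'': "\<forall>j. 0 \<le> y'' $ j" "W *v y'' = W *v y'"
      "q \<bullet> y'' \<le> q \<bullet> y'" "\<forall>d. W *v d = 0 \<longrightarrow> (\<forall>j. y'' $ j = 0 \<longrightarrow> d $ j = 0) \<longrightarrow> d = 0" by blast
    have "W *v y' = W *v y"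
      by (simp add: y'_def matrix_vector_right_distrib matrix_vector_mult_scaleR d(1))
    moreover have "q \<bullet> y' \<le> q \<bullet> y"
      using t0 d(3) by (simp add: y'_def inner_right_distrib mult_nonneg_nonpos)
    ultimately show ?thesis using y'' by (intro exI[of _ y'']) auto
  qed
qed

text \<open>The columns of \<open>W\<close> span the whole space, so the independent family indexed
  by \<open>S\<close> extends to a basis made of columns. The remaining work passes from a set of
  vectors back to column indices.\<close>

lemma independent_columns_extend:
  fixes W :: "real^'n^'m"
  assumes surj: "\<And>s. \<exists>y. W *v y = s"
    and ind: "\<And>d. W *v d = 0 \<Longrightarrow> (\<And>j. j \<notin> S \<Longrightarrow> d $ j = 0) \<Longrightarrow> d = 0"
  shows "\<exists>b :: 'm \<Rightarrow> 'n. invertible (basis_mat W b) \<and> S \<subseteq> range b"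
proof -
  define c where "c j = column j W" for j
  have mult: "W *v y = (\<Sum>j\<in>UNIV. y $ j *\<^sub>R c j)" for y
    by (simp add: matrix_mult_sum c_def scalar_mult_eq_scaleR)
  have inj: "inj_on c S"
  proof (rule inj_onI, rule ccontr)
    fix i j assume ij: "i \<in> S" "j \<in> S" "c i = c j" "i \<noteq> j"
    have "W *v (axis i 1 - axis j 1) = 0"
      using ij by (simp add: matrix_vector_mult_diff_distrib c_def matrix_vector_mult_basis)
    then have "axis i 1 - axis j (1::real) = 0"
      using ij by (intro ind) (auto simp: axis_def)
    then have "axis i (1::real) $ i = axis j 1 $ i" by simp
    then show False using ij by (simp add: axis_def)
  qed
  have indep: "independent (c ` S)"
  proof (rule independent_if_scalars_zero)
    fix f x assume f: "(\<Sum>x\<in>c ` S. f x *\<^sub>R x) = 0" and x: "x \<in> c ` S"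
    define d :: "real^'n" where "d = (\<chi> j. if j \<in> S then f (c j) else 0)"
    have "W *v d = (\<Sum>j\<in>S. f (c j) *\<^sub>R c j)"
      unfolding mult d_def by (rule sum.mono_neutral_cong_right) auto
    also have "\<dots> = 0" using f inj by (simp add: sum.reindex)
    finally have "d = 0" by (intro ind) (auto simp: d_def)
    moreover obtain j where "j \<in> S" "x = c j" using x by auto
    moreover from this have "d $ j = f x" by (simp add: d_def)
    ultimately show "f x = 0" by simp
  qed simp
  obtain V where V: "c ` S \<subseteq> V" "V \<subseteq> range c" "independent V" "range c \<subseteq> span V"
    using maximal_independent_subset_extend[OF _ indep, of "range c"] by blast
  have "span V = UNIV"
  proof -
    have "s \<in> span V" for s
    proof -
      obtain y where "W *v y = s" using surj by blast
      then show ?thesis using V(4)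
        by (auto simp: mult intro!: span_sum span_scale)
    qed
    then show ?thesis by auto
  qed
  then have "card V = CARD('m)" using V(3)
    by (metis dim_eq_card_independent dim_span dim_UNIV DIM_cart DIM_real mult.right_neutral)
  moreover have "finite V" using V(2) finite_surj[of UNIV V c] by simp
  ultimately obtain e where e: "bij_betw e (UNIV :: 'm set) V"
    by (metis finite_class.finite_UNIV finite_same_card_bij)
  \<comment> \<open>Different indices may carry equal columns. For a vector that comes from
    \<open>S\<close> the index inside \<open>S\<close> has to be returned, or \<open>S\<close> would
    not be contained in the range of \<open>b\<close>.\<close>
  define g where "g v = (if v \<in> c ` S then inv_into S c v else (SOME j. c j = v))" for v
  have cg: "c (g v) = v" if "v \<in> V" for v
    using that V(2) unfolding g_def
    by (auto simp: f_inv_into_f intro: someI)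
  have gS: "g (c j) = j" if "j \<in> S" for j
    using that inj by (simp add: g_def inv_into_f_f)
  define b where "b i = g (e i)" for i
  have ev: "e i \<in> V" for i using e by (auto simp: bij_betw_def)
  have cb: "c (b i) = e i" for i by (simp add: b_def cg ev)
  have mb: "basis_mat W b *v x = (\<Sum>i\<in>UNIV. x $ i *\<^sub>R e i)" for x
    by (simp add: matrix_mult_sum scalar_mult_eq_scaleR cb[symmetric])
       (simp add: c_def basis_mat_def column_def)
  have "S \<subseteq> range b"
  proof
    fix j assume j: "j \<in> S"
    then have "c j \<in> V" using V(1) by auto
    then obtain i where "e i = c j" using e by (metis bij_betw_imp_surj_on imageE)
    then have "b i = j" by (simp add: b_def gS j)
    then show "j \<in> range b" by auto
  qed
  moreover have "x = 0" if "basis_mat W b *v x = 0" for x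
  proof -
    have inje: "inj e" using e by (simp add: bij_betw_def)
    have "(\<Sum>v\<in>V. x $ (inv e v) *\<^sub>R v) = (\<Sum>i\<in>UNIV. x $ i *\<^sub>R e i)"
      using e by (subst sum.reindex_bij_betw[OF e, symmetric]) (simp add: inv_f_f[OF inje])
    also have "\<dots> = 0" using that by (simp add: mb)
    finally have "x $ (inv e v) = 0" if "v \<in> V" for v
      using independentD[OF V(3) \<open>finite V\<close> subset_refl, of "\<lambda>v. x $ inv e v"] that by blast
    from this[OF ev] have "x $ i = 0" for i by (simp add: inv_f_f[OF inje])
    then show ?thesis by (simp add: vec_eq_iff)
  qed
  then have "invertible (basis_mat W b)"
    by (simp add: invertible_left_inverse matrix_left_invertible_ker)
  ultimately show ?thesis by blast
qed

text \<open>A solution with independent support columns is the basic solution of any basis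
  containing that support. The basis found is primal feasible at no larger cost; nothing is claimed
  yet about its dual feasibility.\<close>

lemma conic_caratheodory:
  fixes W :: "real^'n^'m"
  assumes surj: "\<And>s. \<exists>y. W *v y = s"
    and ray: "\<And>d. W *v d = 0 \<Longrightarrow> (\<forall>j. 0 \<le> d $ j) \<Longrightarrow> 0 \<le> q \<bullet> d"
    and y: "\<forall>j. 0 \<le> y $ j"
  shows "\<exists>b. invertible (basis_mat W b) \<and> (\<forall>i. 0 \<le> basic_coords W b (W *v y) $ i) \<and>
    dual_mult W q b \<bullet> (W *v y) \<le> q \<bullet> y"
proof -
  obtain y' where y': "\<forall>j. 0 \<le> y' $ j" "W *v y' = W *v y" "q \<bullet> y' \<le> q \<bullet> y"
    "\<And>d. W *v d = 0 \<Longrightarrow> (\<forall>j. y' $ j = 0 \<longrightarrow> d $ j = 0) \<Longrightarrow> d = 0"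
    using caratheodory_support[OF ray y] by blast
  obtain b :: "'m \<Rightarrow> 'n" where b: "invertible (basis_mat W b)" "{j. y' $ j \<noteq> 0} \<subseteq> range b"
    using independent_columns_extend[OF surj, where S="{j. y' $ j \<noteq> 0}"] y'(4) by auto
  have "y' = embed_basic b (\<chi> i. y' $ b i)"
    using b by (intro embed_basic_restrict[symmetric] inj_basis) auto
  then have "W *v y = basis_mat W b *v (\<chi> i. y' $ b i)"
    and q: "q \<bullet> y' = (\<chi> i. q $ b i) \<bullet> (\<chi> i. y' $ b i)"
    by (metis y'(2) mult_embed_basic, metis inner_embed_basic)
  then have "basic_coords W b (W *v y) = (\<chi> i. y' $ b i)"
    by (simp add: coords_basis_mult b(1))
  then show ?thesis
    using y' b q by (intro exI[of _ b]) (auto simp: dual_mult_inner)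
qed

text \<open>Among the finitely many primal feasible bases one of least cost is taken. A negative
  reduced cost would allow a step into the corresponding column, of positive length because no basic
  coordinate is zero. The strictly cheaper point yields, by \<open>conic_caratheodory\<close>, a
  primal feasible basis of smaller cost, a contradiction.\<close>

lemma optimal_basis_generic:
  fixes W :: "real^'n^'m"
  assumes surj: "\<And>s. \<exists>y. W *v y = s \<and> (\<forall>j. 0 \<le> y $ j)"
    and ray: "\<And>d. W *v d = 0 \<Longrightarrow> (\<forall>j. 0 \<le> d $ j) \<Longrightarrow> 0 \<le> q \<bullet> d"
    and generic: "\<And>b i. invertible (basis_mat W b) \<Longrightarrow> basic_coords W b s $ i \<noteq> 0"
  shows "\<exists>b\<in>dual_feasible W q. \<forall>i. 0 \<le> basic_coords W b s $ i"
proof -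
  have surj': "\<And>s. \<exists>y. W *v y = s" using surj by blast
  define F where "F = {b. invertible (basis_mat W b) \<and> (\<forall>i. 0 \<le> basic_coords W b s $ i)}"
  have fin: "finite F" by (rule finite_subset[OF subset_UNIV]) simp
  obtain y0 where "W *v y0 = s" "\<forall>j. 0 \<le> y0 $ j" using surj by blast
  then have "F \<noteq> {}" using conic_caratheodory[OF surj' ray, where y=y0] by (auto simp: F_def)
  then obtain b where b: "b \<in> F" and min: "\<And>b'. b' \<in> F \<Longrightarrow> dual_mult W q b \<bullet> s \<le> dual_mult W q b' \<bullet> s"
    using ex_is_arg_min_if_finite[OF fin, of "\<lambda>b. dual_mult W q b \<bullet> s"]
    by (auto simp: is_arg_min_linorder)
  let ?x = "basic_coords W b s"
  have inv: "invertible (basis_mat W b)" and x: "\<And>i. 0 < ?x $ i"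
    using b generic unfolding F_def by (auto simp: less_le)
  have "0 \<le> reduced_cost W q b $ j" for j
  proof (rule ccontr)
    assume neg: "\<not> 0 \<le> reduced_cost W q b $ j"
    define w where "w = basic_coords W b (W *v axis j 1)"
    \<comment> \<open>The denominator \<open>1 + \<bar>w $ i\<bar>\<close> gives a positive step
      that works for every sign of \<open>w $ i\<close>, without division by zero.\<close>
    define t where "t = Min (range (\<lambda>i. ?x $ i / (1 + \<bar>w $ i\<bar>)))"
    have "t \<in> range (\<lambda>i. ?x $ i / (1 + \<bar>w $ i\<bar>))" unfolding t_def by (intro Min_in) auto
    then have t: "0 < t" using x by (auto intro!: divide_pos_pos)
    have tw: "t * w $ i \<le> ?x $ i" for i
    proof -
      have "t \<le> ?x $ i / (1 + \<bar>w $ i\<bar>)" unfolding t_def by (intro Min_le) auto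
      then have "t * (1 + \<bar>w $ i\<bar>) \<le> ?x $ i" by (simp add: pos_le_divide_eq)
      moreover have "t * w $ i \<le> t * (1 + \<bar>w $ i\<bar>)" using t by (intro mult_left_mono) auto
      ultimately show ?thesis by linarith
    qed
    define y where "y = embed_basic b (?x - t *\<^sub>R w) + t *\<^sub>R axis j 1"
    have y0: "\<forall>j. 0 \<le> y $ j"
      using tw t by (auto simp: y_def axis_def intro!: add_nonneg_nonneg embed_basic_nonneg)
    have Wy: "W *v y = s"
      unfolding y_def w_def
      by (simp add: matrix_vector_right_distrib mult_embed_basic matrix_vector_mult_diff_distrib
            matrix_vector_mult_scaleR basis_mult_coords inv)
    have "reduced_cost W q b \<bullet> embed_basic b z = 0" for z
      by (simp add: inner_embed_basic reduced_cost_basic inv) (simp add: inner_vec_def)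
    then have "q \<bullet> y = dual_mult W q b \<bullet> s + t * reduced_cost W q b $ j"
      unfolding cost_split[of q y W b] Wy by (simp add: y_def inner_right_distrib inner_axis)
    then have less: "q \<bullet> y < dual_mult W q b \<bullet> s" using t neg by (simp add: mult_pos_neg)
    obtain b' where "b' \<in> F" "dual_mult W q b' \<bullet> s \<le> q \<bullet> y"
      using conic_caratheodory[OF surj' ray y0] unfolding Wy F_def by blast
    with min[of b'] less show False by linarith
  qed
  then show ?thesis using inv x by (intro bexI[of _ b]) (auto simp: dual_feasible_iff less_imp_le)
qed

lemma closed_coords_nonneg: "closed {s. \<forall>i. 0 \<le> basic_coords W b s $ i}"
proof -
  have "continuous_on UNIV (\<lambda>s. basic_coords W b s $ i)" for i
    unfolding basic_coords_def by (intro continuous_intros)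
  then show ?thesis
    by (intro closed_Collect_all closed_Collect_le continuous_on_const)
qed

lemma basic_coords_component:
  "basic_coords W b s $ i = row i (matrix_inv (basis_mat W b)) \<bullet> s"
  by (simp add: basic_coords_def matrix_vector_mul_component row_def)

lemma row_inverse_nonzero:
  assumes "invertible (basis_mat W b)"
  shows "row i (matrix_inv (basis_mat W b)) \<noteq> 0"
proof
  assume "row i (matrix_inv (basis_mat W b)) = 0"
  then have "basic_coords W b (basis_mat W b *v axis i 1) $ i = 0"
    unfolding basic_coords_component by simp
  then show False by (simp add: coords_basis_mult assms)
qed

text \<open>Degenerate right-hand sides are reached topologically instead of by an anti-cycling
  rule. The right-hand sides served by some dual feasible basis form a finite union of closed cones.
  The complement is open, and by the generic case it lies in finitely many hyperplanes; being
  negligible, it is empty.\<close>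

lemma optimal_basis:
  fixes W :: "real^'n^'m"
  assumes surj: "\<And>s. \<exists>y. W *v y = s \<and> (\<forall>j. 0 \<le> y $ j)"
    and ray: "\<And>d. W *v d = 0 \<Longrightarrow> (\<forall>j. 0 \<le> d $ j) \<Longrightarrow> 0 \<le> q \<bullet> d"
  shows "\<exists>b\<in>dual_feasible W q. \<forall>i. 0 \<le> basic_coords W b s $ i"
proof -
  define C where "C = (\<Union>b\<in>dual_feasible W q. {s. \<forall>i. 0 \<le> basic_coords W b s $ i})"
  define H where "H = (\<Union>(b, i) \<in> {b. invertible (basis_mat W b)} \<times> UNIV.
      {s. basic_coords W b s $ i = 0})"
  have "closed C"
    unfolding C_def by (intro closed_UN finite_dual_feasible ballI closed_coords_nonneg)
  then have "open (- C)" by (simp add: open_Compl)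
  moreover have "- C \<subseteq> H"
  proof
    fix s assume s: "s \<in> - C"
    show "s \<in> H"
    proof (rule ccontr)
      assume "s \<notin> H"
      then have "\<And>b i. invertible (basis_mat W b) \<Longrightarrow> basic_coords W b s $ i \<noteq> 0"
        by (auto simp: H_def)
      from optimal_basis_generic[OF surj ray this] s show False by (auto simp: C_def)
    qed
  qed
  moreover have "negligible H"
    unfolding H_def
  proof (intro negligible_Union finite_imageI)
    show "finite ({b :: 'm \<Rightarrow> 'n. invertible (basis_mat W b)} \<times> (UNIV :: 'm set))"
      by (rule finite_subset[OF subset_UNIV]) simp
  next
    fix A assume "A \<in> (\<lambda>(b, i). {s. basic_coords W b s $ i = 0}) `
      ({b. invertible (basis_mat W b)} \<times> UNIV)"
    then obtain b i where "invertible (basis_mat W b)" "A = {s. basic_coords W b s $ i = 0}"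
      by auto
    then show "negligible A"
      using negligible_hyperplane[of "row i (matrix_inv (basis_mat W b))" 0] row_inverse_nonzero[of W b i]
      by (simp add: basic_coords_component)
  qed
  ultimately have "- C = {}" by (meson negligible_subset open_not_negligible)
  then show ?thesis by (auto simp: C_def)
qed

section \<open>Gomory relaxations\<close>

lemma norm_le_card_mult:
  fixes y :: "real^'n"
  assumes "\<And>j. \<bar>y $ j\<bar> \<le> c"
  shows "norm y \<le> real CARD('n) * c"
proof -
  have "norm y \<le> (\<Sum>j\<in>UNIV. \<bar>y $ j\<bar>)" by (rule norm_le_l1_cart)
  also have "\<dots> \<le> (\<Sum>j\<in>(UNIV :: 'n set). c)" using assms by (intro sum_mono) auto
  finally show ?thesis by simp
qed

lemma closed_mixed_integer:
  "closed {y :: real^'n. (\<forall>j\<in>I. y $ j \<in> \<int>) \<and> (\<forall>j\<in>P. 0 \<le> y $ j)}"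
proof -
  have "closed {y :: real^'n. y $ j \<in> \<int>}" for j
    using continuous_closed_vimage[OF closed_Ints, of "\<lambda>y :: real^'n. y $ j"]
    by (simp add: vimage_def continuous_at_imp_continuous_on)
  then have "closed ((\<Inter>j\<in>I. {y :: real^'n. y $ j \<in> \<int>}) \<inter> (\<Inter>j\<in>P. {y. 0 \<le> y $ j}))"
    by (intro closed_Int closed_INT ballI closed_Collect_le continuous_intros)
  also have "(\<Inter>j\<in>I. {y :: real^'n. y $ j \<in> \<int>}) \<inter> (\<Inter>j\<in>P. {y. 0 \<le> y $ j}) =
      {y. (\<forall>j\<in>I. y $ j \<in> \<int>) \<and> (\<forall>j\<in>P. 0 \<le> y $ j)}" by auto
  finally show ?thesis .
qed

text \<open>No cost vector occurs among the parameters: finiteness of the value function is used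
  through feasibility for every right-hand side. Every constant defined in this locale therefore
  depends on \<open>W\<close> and \<open>I\<close> alone.\<close>

locale integral_recourse =
  fixes W :: "real^'n^'m" and I :: "'n set"
  assumes W_Ints: "\<forall>i j. W $ i $ j \<in> \<int>"
    and feasible: "\<exists>y. W *v y = s \<and> (\<forall>j\<in>I. y $ j \<in> \<int>) \<and> (\<forall>j. 0 \<le> y $ j)"
begin

lemma W_onto: "\<exists>y. W *v y = s \<and> (\<forall>j. 0 \<le> y $ j)"
  using feasible by blast

text \<open>By Baire's theorem some ball consists of right-hand sides with uniformly bounded solutions.
  Solutions can be added, so it can be moved to the origin and scaled by integers.\<close>

lemma feasible_bounded:
  "\<exists>R>0. \<forall>s. norm s \<le> r \<longrightarrow>
    (\<exists>y. W *v y = s \<and> (\<forall>j\<in>I. y $ j \<in> \<int>) \<and> (\<forall>j. 0 \<le> y $ j) \<and> norm y \<le> R)"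
proof -
  define K :: "nat \<Rightarrow> (real^'n) set"
    where "K n = cball 0 (real n) \<inter> {y. (\<forall>j\<in>I. y $ j \<in> \<int>) \<and> (\<forall>j. 0 \<le> y $ j)}" for n
  define F where "F n = (*v) W ` K n" for n
  have "compact (K n)" for n
    unfolding K_def using closed_mixed_integer[of I UNIV]
    by (intro compact_Int_closed compact_cball) simp
  then have "compact (F n)" for n
    unfolding F_def by (intro compact_continuous_image continuous_intros) auto
  then have F_closed: "closed (F n)" for n by (rule compact_imp_closed)
  have cover: "\<exists>n. s \<in> F n" for s
  proof -
    obtain y where y: "W *v y = s" "\<forall>j\<in>I. y $ j \<in> \<int>" "\<forall>j. 0 \<le> y $ j" using feasible by blast
    then have "s \<in> F (nat \<lceil>norm y\<rceil>)"
      unfolding F_def K_def by (intro image_eqI[of _ _ y]) (auto simp: of_nat_ceiling)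
    then show ?thesis by blast
  qed
  have "\<exists>n. interior (F n) \<noteq> {}"
  proof (rule ccontr)
    assume "\<not> ?thesis"
    then have "UNIV \<subseteq> closure (\<Inter>(range (\<lambda>n. - F n)))"
      by (intro Baire) (auto simp: F_closed open_Compl closure_complement)
    moreover have "\<Inter>(range (\<lambda>n. - F n)) = {}" using cover by auto
    ultimately show False by auto
  qed
  then obtain n s0 e where e: "0 < e" "ball s0 e \<subseteq> F n"
    by (metis all_not_in_conv mem_interior)
  obtain y2 where y2: "W *v y2 = - s0" "\<forall>j\<in>I. y2 $ j \<in> \<int>" "\<forall>j. 0 \<le> y2 $ j"
    using feasible by blast
  obtain k :: nat where k: "r / e < real k" using reals_Archimedean2 by blast
  \<comment> \<open>The summand 1 keeps \<open>R\<close> positive when the other summand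
    vanishes.\<close>
  define R where "R = 1 + real k * (real n + norm y2)"
  show ?thesis
  proof (intro exI[of _ R] conjI allI impI)
    show "0 < R" unfolding R_def by (intro add_pos_nonneg mult_nonneg_nonneg) auto
  next
    fix s :: "real^'m" assume s: "norm s \<le> r"
    have rk: "r < real k * e" using k e by (simp add: divide_less_eq)
    then have kpos: "0 < real k"
      using s e norm_ge_zero[of s] by (cases "k = 0") auto
    have "norm (s /\<^sub>R real k) < e"
      using s rk kpos by (simp add: divide_simps mult.commute)
    then have "s0 + s /\<^sub>R real k \<in> F n" using e(2) by (auto simp: dist_norm subset_iff)
    then obtain y1 where y1: "W *v y1 = s0 + s /\<^sub>R real k" "y1 \<in> K n" by (auto simp: F_def)
    let ?y = "real k *\<^sub>R (y1 + y2)"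
    have "W *v ?y = s"
      using y1(1) y2(1) kpos by (simp add: matrix_vector_mult_scaleR matrix_vector_right_distrib)
    moreover have "\<forall>j\<in>I. ?y $ j \<in> \<int>" "\<forall>j. 0 \<le> ?y $ j"
      using y1(2) y2 by (auto simp: K_def intro!: Ints_mult Ints_add)
    moreover have "norm ?y \<le> R"
    proof -
      have "norm (y1 + y2) \<le> real n + norm y2"
        using y1(2) norm_triangle_ineq[of y1 y2] by (simp add: K_def)
      then have "real k * norm (y1 + y2) \<le> real k * (real n + norm y2)"
        by (intro mult_left_mono) auto
      then show ?thesis by (simp add: R_def)
    qed
    ultimately show "\<exists>y. W *v y = s \<and> (\<forall>j\<in>I. y $ j \<in> \<int>) \<and> (\<forall>j. 0 \<le> y $ j) \<and> norm y \<le> R"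
      by blast
  qed
qed

definition W_bound :: real where
  "W_bound = onorm ((*v) W)"

text \<open>The radius \<open>W_bound * real CARD('n)\<close> covers all right-hand sides
  \<open>W *v z\<close> whose \<open>z\<close> has components of modulus at most 1. Such
  \<open>z\<close> arise as fractional parts.\<close>

definition feas_bound :: real where
  "feas_bound = (SOME R. R > 0 \<and> (\<forall>s. norm s \<le> W_bound * real CARD('n) \<longrightarrow>
    (\<exists>y. W *v y = s \<and> (\<forall>j\<in>I. y $ j \<in> \<int>) \<and> (\<forall>j. 0 \<le> y $ j) \<and> norm y \<le> R)))"

lemma W_bound: "norm (W *v y) \<le> W_bound * norm y" and W_bound_nonneg: "0 \<le> W_bound"
  unfolding W_bound_def by (auto intro!: onorm onorm_pos_le)

lemma feas_bound_pos: "0 < feas_bound"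
  and feas_bound: "norm s \<le> W_bound * real CARD('n) \<Longrightarrow>
    \<exists>y. W *v y = s \<and> (\<forall>j\<in>I. y $ j \<in> \<int>) \<and> (\<forall>j. 0 \<le> y $ j) \<and> norm y \<le> feas_bound"
  using someI_ex[OF feasible_bounded[of "W_bound * real CARD('n)"]]
  unfolding feas_bound_def by auto

text \<open>This repairs rounding: the fractional part of a solution is exchanged for a
  mixed-integer nonnegative vector with the same image under \<open>W\<close>, at a cost bounded
  independently of the solution.\<close>

lemma unit_box_feasible:
  assumes "\<And>j. \<bar>z $ j\<bar> \<le> 1"
  shows "\<exists>y. W *v y = W *v z \<and> (\<forall>j\<in>I. y $ j \<in> \<int>) \<and> (\<forall>j. 0 \<le> y $ j) \<and> norm y \<le> feas_bound"
proof (rule feas_bound)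
  have "norm z \<le> real CARD('n) * 1" using assms by (rule norm_le_card_mult)
  then show "norm (W *v z) \<le> W_bound * real CARD('n)"
    using W_bound[of z] mult_left_mono[OF _ W_bound_nonneg, of "norm z" "real CARD('n)"] by simp
qed

text \<open>A real ray \<open>d\<close> need not be integral, so a multiple
  \<open>t *\<^sub>R d\<close> is rounded down and its fractional part is replaced by means of
  \<open>unit_box_feasible\<close>. The result solves the homogeneous system at cost at most
  \<open>t\<close> times the cost of \<open>d\<close> plus a constant. With a negative cost of
  \<open>d\<close>, large \<open>t\<close> would make the value at 0 equal to minus
  infinity.\<close>

lemma no_improving_ray:
  assumes bnd: "\<And>s. - \<infinity> < value_fun W I q s" and d: "W *v d = 0" "\<forall>j. 0 \<le> d $ j"
  shows "0 \<le> q \<bullet> d"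
proof (rule ccontr)
  assume neg: "\<not> 0 \<le> q \<bullet> d"
  define c where "c = norm_1 q * (real CARD('n) + feas_bound)"
  have le: "value_fun W I q 0 \<le> ereal (t * (q \<bullet> d) + c)" if t: "0 \<le> t" for t
  proof -
    define z :: "real^'n" where "z = (\<chi> j. frac (t * d $ j))"
    have z1: "\<bar>z $ j\<bar> \<le> 1" for j by (simp add: z_def frac_lt_1 less_imp_le)
    obtain y where y: "W *v y = W *v z" "\<forall>j\<in>I. y $ j \<in> \<int>" "\<forall>j. 0 \<le> y $ j" "norm y \<le> feas_bound"
      using unit_box_feasible[OF z1] by blast
    have fl: "(t *\<^sub>R d - z) $ j = of_int \<lfloor>t * d $ j\<rfloor>" for j by (simp add: z_def frac_def)
    let ?y = "(t *\<^sub>R d - z) + y"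
    have "value_fun W I q 0 \<le> ereal (q \<bullet> ?y)"
      unfolding value_fun_def
    proof (rule milp_value_le)
      show "W *v ?y = 0"
        using y(1) d(1) by (simp add: matrix_vector_right_distrib matrix_vector_mult_diff_distrib
            matrix_vector_mult_scaleR)
      show "\<forall>j\<in>I. ?y $ j \<in> \<int>" using y(2) fl by (auto simp: vector_add_component simp del: vector_minus_component)
      show "\<forall>j\<in>UNIV. 0 \<le> ?y $ j"
        using y(3) d(2) t fl by (auto simp: vector_add_component simp del: vector_minus_component)
    qed
    also have "q \<bullet> ?y \<le> t * (q \<bullet> d) + c"
    proof -
      have "norm (y - z) \<le> feas_bound + real CARD('n)"
        using norm_triangle_ineq4[of y z] y(4) norm_le_card_mult[of z, OF z1] by simp
      then have "norm_1 q * norm (y - z) \<le> c"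
        unfolding c_def by (intro mult_left_mono) auto
      then show ?thesis using inner_le_norm_1[of q "y - z"] by (simp add: inner_simps)
    qed
    finally show ?thesis by simp
  qed
  have "value_fun W I q 0 \<le> ereal B" for B
  proof -
    define t where "t = max 0 ((B - c) / (q \<bullet> d))"
    have "(B - c) / (q \<bullet> d) \<le> t" by (simp add: t_def)
    then have "t * (q \<bullet> d) \<le> B - c" using neg by (simp add: neg_divide_le_eq)
    then show ?thesis using le[of t] by (auto simp: t_def intro: order_trans)
  qed
  then have "value_fun W I q 0 = - \<infinity>" by (rule ereal_bot)
  then show False using bnd[of 0] by simp
qed

end

section \<open>Constants of the recourse matrix, periodicity and exactness of the Gomory
  relaxations\<close>

context integral_recourse
begin

definition bases :: "('m \<Rightarrow> 'n) set" where
  "bases = {b. invertible (basis_mat W b)}"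

text \<open>Each period is a positive integer, so the product is an integral multiple of every
  factor.\<close>

definition common_period :: real where
  "common_period = (\<Prod>b\<in>bases. period W b)"

text \<open>A finite sum of nonnegative operator norms dominates each of them, which gives a single
  Lipschitz constant for the basic coordinates with respect to every \<open>b\<close>.\<close>

definition coord_bound :: real where
  "coord_bound = (\<Sum>b\<in>UNIV. onorm (basic_coords W (b :: 'm \<Rightarrow> 'n)))"

text \<open>It bounds the basic coordinates of \<open>W *v z\<close> for every \<open>z\<close> with
  components of modulus at most \<open>common_period\<close>: the amount by which nonbasic variables
  reduced modulo a period can lower the basic ones.\<close>

definition depth :: real where
  "depth = coord_bound * (W_bound * (real CARD('n) * common_period))"

text \<open>It bounds the norm of \<open>y - z\<close>, where \<open>z\<close> is a fractional part
  in the unit box and \<open>y\<close> is its mixed-integer replacement.\<close>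

definition gap_bound :: real where
  "gap_bound = feas_bound + real CARD('n)"

lemma finite_bases [simp]: "finite bases"
  by (rule finite_subset[OF subset_UNIV]) simp

lemma period_Nat:
  assumes "b \<in> bases"
  shows "\<exists>n>0. period W b = real n"
proof -
  have "period W b \<in> \<int>"
    unfolding period_def using W_Ints by (intro Ints_abs det_Ints) (simp add: basis_mat_def)
  moreover have "period W b > 0"
    using assms by (simp add: period_def bases_def invertible_det_nz)
  ultimately show ?thesis
    by (metis Ints_cases of_int_0_less_iff of_int_of_nat_eq of_nat_0_less_iff zero_less_imp_eq_int)
qed

lemma common_period_Nat:
  assumes "S \<subseteq> bases" shows "\<exists>n>0. (\<Prod>b\<in>S. period W b) = real n"
  using finite_subset[OF assms finite_bases] assms
proof (induction S rule: finite_induct)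
  case empty
  then show ?case by (intro exI[of _ 1]) auto
next
  case (insert b S)
  then obtain n k where "n > 0" "(\<Prod>b\<in>S. period W b) = real n" "k > 0" "period W b = real k"
    using period_Nat[of b] by auto
  then show ?case using insert by (intro exI[of _ "k * n"]) auto
qed

lemma period_pos: "b \<in> bases \<Longrightarrow> 0 < period W b"
  using period_Nat by fastforce

lemma common_period_multiple:
  assumes "b \<in> bases"
  shows "\<exists>n>0. common_period = real n * period W b"
proof -
  obtain n where "n > 0" "(\<Prod>b\<in>bases - {b}. period W b) = real n"
    using common_period_Nat[of "bases - {b}"] by auto
  then show ?thesis
    unfolding common_period_def prod.remove[OF finite_bases assms]
    by (intro exI[of _ n]) auto
qed

lemma common_period_ge:
  assumes "b \<in> bases" shows "period W b \<le> common_period"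
proof -
  obtain n :: nat where "n > 0" "common_period = real n * period W b"
    using common_period_multiple[OF assms] by blast
  then show ?thesis
    using mult_right_mono[of 1 "real n" "period W b"] period_pos[OF assms] by simp
qed

lemma common_period_pos: "0 < common_period"
  unfolding common_period_def using common_period_Nat[of bases] by auto

lemma bounded_linear_coords: "bounded_linear (basic_coords W b)"
  using linear_conv_bounded_linear basic_coords_linear by blast

lemma coord_bound_nonneg: "0 \<le> coord_bound"
  unfolding coord_bound_def by (intro sum_nonneg onorm_pos_le bounded_linear_coords)

lemma coord_bound: "\<bar>basic_coords W b s $ i\<bar> \<le> coord_bound * norm s"
proof -
  have "\<bar>basic_coords W b s $ i\<bar> \<le> norm (basic_coords W b s)" by (rule component_le_norm_cart)
  also have "\<dots> \<le> onorm (basic_coords W b) * norm s" by (rule onorm[OF bounded_linear_coords])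
  also have "\<dots> \<le> coord_bound * norm s"
    unfolding coord_bound_def
    by (intro mult_right_mono member_le_sum onorm_pos_le bounded_linear_coords) auto
  finally show ?thesis .
qed

lemma depth_nonneg: "0 \<le> depth"
  unfolding depth_def
  using coord_bound_nonneg W_bound_nonneg common_period_pos by simp

lemma gap_bound_pos: "0 < gap_bound"
  unfolding gap_bound_def using feas_bound_pos by simp

lemma period_coords_Ints:
  assumes b: "b \<in> bases" and w: "int_vec w"
  shows "period W b * basic_coords W b w $ i \<in> \<int>"
proof -
  have "det (basis_mat W b) * basic_coords W b w $ i \<in> \<int>"
    using b det_coords_Ints[OF W_Ints _ w] by (simp add: bases_def)
  then show ?thesis by (auto simp: period_def abs_if)
qed

text \<open>Reduced costs of basic columns vanish, so basic variables of either sign contribute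
  nothing. Weak duality thus survives in the Gomory relaxation.\<close>

lemma dual_bound:
  assumes b: "b \<in> dual_feasible W q" and y: "\<forall>j\<in>- range b. 0 \<le> y $ j"
  shows "dual_mult W q b \<bullet> (W *v y) \<le> q \<bullet> y"
proof -
  have "0 \<le> reduced_cost W q b $ j * y $ j" for j
    using b y reduced_cost_basic[of W b q] by (cases "j \<in> range b") (auto simp: dual_feasible_iff)
  then have "0 \<le> reduced_cost W q b \<bullet> y" by (auto simp: inner_vec_def intro!: sum_nonneg)
  then show ?thesis using cost_split[of q y W b] by linarith
qed

lemma gomory_ge:
  assumes "b \<in> dual_feasible W q"
  shows "ereal (dual_mult W q b \<bullet> s) \<le> gomory_value W I q b s"
  unfolding gomory_value_def using dual_bound[OF assms] by (intro milp_value_ge) auto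

lemma gomory_le_value: "gomory_value W I q b s \<le> value_fun W I q s"
  unfolding gomory_value_def value_fun_def by (rule milp_value_antimono) auto

text \<open>Round the basic coordinates of the right-hand side down and solve for the remainder, which
  lies in a fixed compact set.\<close>

lemma rounded_solution:
  assumes b: "b \<in> bases"
  shows "\<exists>y. W *v y = s \<and> (\<forall>j\<in>I. y $ j \<in> \<int>) \<and> (\<forall>j\<in>- range b. 0 \<le> y $ j) \<and>
    ((\<forall>i. 0 \<le> basic_coords W b s $ i) \<longrightarrow> (\<forall>j. 0 \<le> y $ j)) \<and>
    q \<bullet> y \<le> dual_mult W q b \<bullet> s + gap_bound * norm_1 q"
proof -
  have inv: "invertible (basis_mat W b)" using b by (simp add: bases_def)
  define x where "x = basic_coords W b s"
  define n :: "real^'m" where "n = (\<chi> i. of_int \<lfloor>x $ i\<rfloor>)"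
  define z :: "real^'n" where "z = embed_basic b (x - n)"
  have s: "s = basis_mat W b *v x" by (simp add: x_def basis_mult_coords inv)
  have z1: "\<bar>z $ j\<bar> \<le> 1" for j
  proof (cases "j \<in> range b")
    case True
    then obtain i where "j = b i" by auto
    then have "z $ j = frac (x $ i)"
      by (simp add: z_def embed_basic_apply inj_basis[OF inv] n_def frac_def)
    then show ?thesis by (simp add: frac_lt_1 less_imp_le)
  next
    case False
    then show ?thesis by (simp add: z_def embed_basic_notin)
  qed
  obtain y where y: "W *v y = W *v z" "\<forall>j\<in>I. y $ j \<in> \<int>" "\<forall>j. 0 \<le> y $ j" "norm y \<le> feas_bound"
    using unit_box_feasible[OF z1] by blast
  let ?y = "embed_basic b n + y"
  show ?thesis
  proof (intro exI[of _ ?y] conjI ballI impI allI)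
    show "W *v ?y = s"
      using y(1) by (simp add: z_def matrix_vector_right_distrib mult_embed_basic
          matrix_vector_mult_diff_distrib s)
    show "?y $ j \<in> \<int>" if "j \<in> I" for j
      using y(2) that by (auto simp: n_def intro!: Ints_add embed_basic_Ints)
    show "0 \<le> ?y $ j" if "j \<in> - range b" for j
      using y(3) that by (simp add: embed_basic_notin)
    show "0 \<le> ?y $ j" if "\<forall>i. 0 \<le> basic_coords W b s $ i" for j
      using y(3) that by (auto simp: n_def x_def intro!: add_nonneg_nonneg embed_basic_nonneg)
    \<comment> \<open>The dual price of \<open>s\<close> is exactly the cost of the rounded basic
      part plus that of the fractional part \<open>z\<close>. Exchanging \<open>z\<close> for
      \<open>y\<close> is the only source of a gap.\<close>
    have "dual_mult W q b \<bullet> s = q \<bullet> embed_basic b n + q \<bullet> z"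
      by (simp add: dual_mult_inner x_def[symmetric] inner_embed_basic z_def inner_diff_right)
    then have "q \<bullet> ?y = dual_mult W q b \<bullet> s + q \<bullet> (y - z)"
      by (simp add: inner_simps)
    also have "q \<bullet> (y - z) \<le> norm_1 q * norm (y - z)" by (rule inner_le_norm_1)
    also have "\<dots> \<le> norm_1 q * gap_bound"
      using norm_triangle_ineq4[of y z] y(4) norm_le_card_mult[of z, OF z1]
      by (intro mult_left_mono) (auto simp: gap_bound_def)
    finally show "q \<bullet> ?y \<le> dual_mult W q b \<bullet> s + gap_bound * norm_1 q" by (simp add: mult.commute)
  qed
qed

lemma dual_feasible_bases: "b \<in> dual_feasible W q \<Longrightarrow> b \<in> bases"
  by (simp add: dual_feasible_iff bases_def)

lemma gomory_le:
  assumes "b \<in> bases"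
  shows "gomory_value W I q b s \<le> ereal (dual_mult W q b \<bullet> s + gap_bound * norm_1 q)"
proof -
  obtain y where y: "W *v y = s" "\<forall>j\<in>I. y $ j \<in> \<int>" "\<forall>j\<in>- range b. 0 \<le> y $ j"
    "q \<bullet> y \<le> dual_mult W q b \<bullet> s + gap_bound * norm_1 q"
    using rounded_solution[OF assms] by blast
  have "gomory_value W I q b s \<le> ereal (q \<bullet> y)"
    unfolding gomory_value_def using y by (intro milp_value_le) auto
  then show ?thesis using y(4) by (meson ereal_less_eq(3) order_trans)
qed

text \<open>The relaxation lies between two real bounds, so the conversion to a real number inside
  \<open>psi\<close> loses nothing.\<close>

lemma gomory_eq:
  assumes "b \<in> dual_feasible W q"
  shows "gomory_value W I q b s = ereal (dual_mult W q b \<bullet> s + psi W I q b s)"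
  using gomory_ge[OF assms, of s] gomory_le[OF dual_feasible_bases[OF assms], of q s]
  by (cases "gomory_value W I q b s") (auto simp: psi_def)

lemma psi_bounds:
  assumes "b \<in> dual_feasible W q"
  shows "0 \<le> psi W I q b s" "psi W I q b s \<le> gap_bound * norm_1 q"
  using gomory_ge[OF assms, of s] gomory_le[OF dual_feasible_bases[OF assms], of q s]
  unfolding gomory_eq[OF assms] by auto

text \<open>Adding \<open>l\<close> to the basic variables keeps them integral where required and
  leaves the nonbasic ones alone, so it maps solutions for \<open>s\<close> to solutions for the
  shifted right-hand side. The cost changes by the dual price of the shift, which \<open>psi\<close>
  subtracts. Applied to \<open>- l\<close> the inequality becomes an equation.\<close>

lemma psi_shift_le:
  assumes b: "b \<in> dual_feasible W q" and l: "int_vec l"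
  shows "psi W I q b (s + basis_mat W b *v l) \<le> psi W I q b s"
proof -
  have inv: "invertible (basis_mat W b)" using b by (simp add: dual_feasible_iff)
  let ?s = "s + basis_mat W b *v l"
  have l': "dual_mult W q b \<bullet> (basis_mat W b *v l) = q \<bullet> embed_basic b l"
    by (simp add: dual_mult_inner coords_basis_mult inv inner_embed_basic)
  have "ereal (dual_mult W q b \<bullet> s + psi W I q b ?s) \<le> gomory_value W I q b s"
    unfolding gomory_value_def
  proof (rule milp_value_ge)
    fix y assume y: "W *v y = s" "\<forall>j\<in>I. y $ j \<in> \<int>" "\<forall>j\<in>- range b. 0 \<le> y $ j"
    have "gomory_value W I q b ?s \<le> ereal (q \<bullet> (y + embed_basic b l))"
      unfolding gomory_value_def
    proof (rule milp_value_le)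
      show "W *v (y + embed_basic b l) = ?s"
        by (simp add: matrix_vector_right_distrib y(1) mult_embed_basic)
      show "\<forall>j\<in>I. (y + embed_basic b l) $ j \<in> \<int>"
        using y(2) l by (auto simp: int_vec_def intro!: Ints_add embed_basic_Ints)
      show "\<forall>j\<in>- range b. 0 \<le> (y + embed_basic b l) $ j"
        using y(3) by (simp add: embed_basic_notin)
    qed
    then show "ereal (dual_mult W q b \<bullet> s + psi W I q b ?s) \<le> ereal (q \<bullet> y)"
      unfolding gomory_eq[OF b] by (simp add: inner_add_right l')
  qed
  then show ?thesis unfolding gomory_eq[OF b] by simp
qed

lemma psi_shift:
  assumes b: "b \<in> dual_feasible W q" and l: "int_vec l"
  shows "psi W I q b (s + basis_mat W b *v l) = psi W I q b s"
proof (rule antisym)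
  have "int_vec (- l)" using l by (simp add: int_vec_def)
  from psi_shift_le[OF b this, of "s + basis_mat W b *v l"]
  have "psi W I q b (s + basis_mat W b *v (l + (- l))) \<le> psi W I q b (s + basis_mat W b *v l)"
    unfolding matrix_vector_right_distrib by (simp add: add.assoc)
  then show "psi W I q b s \<le> psi W I q b (s + basis_mat W b *v l)" by simp
qed (rule psi_shift_le[OF b l])

text \<open>An integer vector scaled by \<open>\<bar>det B\<bar>\<close> is the image under
  \<open>B\<close> of an integer vector, by Cramer's rule, so periodicity with respect to the
  columns of \<open>B\<close> applies.\<close>

lemma psi_period:
  assumes b: "b \<in> dual_feasible W q" and w: "int_vec w"
  shows "psi W I q b (s + period W b *\<^sub>R w) = psi W I q b s"
proof -
  have inv: "invertible (basis_mat W b)" using b by (simp add: dual_feasible_iff)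
  have "int_vec (period W b *\<^sub>R basic_coords W b w)"
    using period_coords_Ints[OF dual_feasible_bases[OF b] w] by (simp add: int_vec_def)
  from psi_shift[OF b this, of s] show ?thesis
    by (simp add: matrix_vector_mult_scaleR basis_mult_coords[OF inv])
qed

lemma int_vec_scale: "c \<in> \<int> \<Longrightarrow> int_vec w \<Longrightarrow> int_vec (c *\<^sub>R w)"
  by (simp add: int_vec_def)

lemma psi_common_period:
  assumes b: "b \<in> dual_feasible W q" and w: "int_vec w"
  shows "psi W I q b (s + common_period *\<^sub>R w) = psi W I q b s"
proof -
  obtain n where n: "common_period = real n * period W b"
    using common_period_multiple[OF dual_feasible_bases[OF b]] by blast
  show ?thesis using psi_period[OF b int_vec_scale[OF _ w, of "real n"], of s]
    by (simp add: n mult.commute)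
qed

text \<open>Reduce every nonbasic variable modulo \<^term>\<open>period W b\<close>: this changes the basic
  variables by integers, does not raise the cost, and leaves bounded nonbasic variables.\<close>

lemma gomory_reduce:
  assumes b: "b \<in> dual_feasible W q"
    and y: "\<forall>j\<in>I. y $ j \<in> \<int>" "\<forall>j\<in>- range b. 0 \<le> y $ j"
    and deep: "\<And>i. depth \<le> basic_coords W b (W *v y) $ i"
  shows "\<exists>y'. W *v y' = W *v y \<and> (\<forall>j\<in>I. y' $ j \<in> \<int>) \<and> (\<forall>j. 0 \<le> y' $ j) \<and> q \<bullet> y' \<le> q \<bullet> y"
proof -
  have inv: "invertible (basis_mat W b)" using b by (simp add: dual_feasible_iff)
  note bb = dual_feasible_bases[OF b]
  let ?p = "period W b"
  define n :: "real^'n" where "n = (\<chi> j. if j \<in> range b then 0 else of_int \<lfloor>y $ j / ?p\<rfloor>)"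
  define yB :: "real^'m" where "yB = (\<chi> i. y $ b i)"
  define z where "z = y - embed_basic b yB - ?p *\<^sub>R n"
  define x where "x = basic_coords W b (W *v y - W *v z)"
  let ?y = "embed_basic b x + z"
  have z_in: "z $ j = 0" if "j \<in> range b" for j
    using that by (auto simp: z_def n_def yB_def embed_basic_apply[OF inj_basis[OF inv]])
  have z_out: "0 \<le> z $ j \<and> z $ j \<le> ?p \<and> z $ j \<le> y $ j \<and> (j \<in> I \<longrightarrow> z $ j \<in> \<int>)"
    if j: "j \<notin> range b" for j
  proof -
    have p: "0 < ?p" by (rule period_pos[OF bb])
    have z: "z $ j = y $ j - ?p * of_int \<lfloor>y $ j / ?p\<rfloor>"
      using j by (simp add: z_def n_def embed_basic_notin)
    have "of_int \<lfloor>y $ j / ?p\<rfloor> * ?p \<le> y $ j"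
      using of_int_floor_le[of "y $ j / ?p"] p by (simp only: pos_le_divide_eq)
    moreover have "y $ j < (of_int \<lfloor>y $ j / ?p\<rfloor> + 1) * ?p"
      using real_of_int_floor_add_one_gt[of "y $ j / ?p"] by (simp only: pos_divide_less_eq[OF p])
    moreover have "0 \<le> ?p * of_int \<lfloor>y $ j / ?p\<rfloor>"
      using y(2) j p by (intro mult_nonneg_nonneg) auto
    moreover have "?p \<in> \<int>" using period_Nat[OF bb] by auto
    ultimately show ?thesis using y(1) unfolding z by (auto simp: algebra_simps)
  qed
  have z_abs: "\<bar>z $ j\<bar> \<le> common_period" for j
    using z_in[of j] z_out[of j] common_period_ge[OF bb] common_period_pos
    by (cases "j \<in> range b") auto
  \<comment> \<open>The new basic variables differ from the old ones by
    \<open>\<bar>det B\<bar>\<close> times the basic coordinates of an integer vector, hence by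
    integers. This is why the reduction is modulo \<open>\<bar>det B\<bar>\<close>.\<close>
  have x_eq: "x = yB + ?p *\<^sub>R basic_coords W b (W *v n)"
  proof -
    have "W *v y - W *v z = basis_mat W b *v yB + ?p *\<^sub>R (W *v n)"
      by (simp add: z_def matrix_vector_mult_diff_distrib mult_embed_basic matrix_vector_mult_scaleR)
    then show ?thesis
      by (simp add: x_def basic_coords_add basic_coords_scale coords_basis_mult inv)
  qed
  have "int_vec n" by (simp add: int_vec_def n_def)
  then have x_Ints: "x $ i \<in> \<int>" if "b i \<in> I" for i
    unfolding x_eq using y(1) that period_coords_Ints[OF bb int_vec_mult[OF W_Ints]]
    by (auto simp: yB_def intro!: Ints_add)
  have x_nonneg: "0 \<le> x $ i" for i
  proof -
    have "\<bar>basic_coords W b (W *v z) $ i\<bar> \<le> coord_bound * norm (W *v z)" by (rule coord_bound)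
    also have "\<dots> \<le> depth"
      unfolding depth_def
      by (intro mult_left_mono coord_bound_nonneg order_trans[OF W_bound] W_bound_nonneg
          norm_le_card_mult z_abs)
    finally show ?thesis using deep[of i] by (simp add: x_def basic_coords_diff)
  qed
  have Wy: "W *v ?y = W *v y"
    by (simp add: matrix_vector_right_distrib mult_embed_basic x_def basis_mult_coords inv)
  show ?thesis
  proof (intro exI[of _ ?y] conjI ballI allI Wy)
    show "?y $ j \<in> \<int>" if "j \<in> I" for j
    proof -
      have "z $ j \<in> \<int>" using z_in[of j] z_out[of j] that by (cases "j \<in> range b") auto
      moreover have "embed_basic b x $ j \<in> \<int>" using that by (intro embed_basic_Ints x_Ints) simp
      ultimately show ?thesis by simp
    qed
    show "0 \<le> ?y $ j" for j
    proof -
      have "0 \<le> z $ j" using z_in[of j] z_out[of j] by (cases "j \<in> range b") auto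
      then show ?thesis using embed_basic_nonneg[OF x_nonneg, of b j] by simp
    qed
    have "reduced_cost W q b $ j * ?y $ j \<le> reduced_cost W q b $ j * y $ j" for j
    proof (cases "j \<in> range b")
      case True
      then show ?thesis using reduced_cost_basic[OF inv, of q] by auto
    next
      case False
      then show ?thesis
        using z_out[OF False] b by (intro mult_left_mono) (auto simp: embed_basic_notin dual_feasible_iff)
    qed
    then have "reduced_cost W q b \<bullet> ?y \<le> reduced_cost W q b \<bullet> y"
      unfolding inner_vec_def by (intro sum_mono) simp
    then show "q \<bullet> ?y \<le> q \<bullet> y"
      using cost_split[of q ?y W b] cost_split[of q y W b] by (simp only: Wy)
  qed
qed

text \<open>By \<open>gomory_reduce\<close> every solution of the relaxation is matched by a
  solution of the original problem at no larger cost, so relaxing the signs gains nothing this deep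
  inside the cone of \<open>b\<close>.\<close>

lemma value_eq_gomory:
  assumes b: "b \<in> dual_feasible W q" and deep: "\<And>i. depth \<le> basic_coords W b s $ i"
  shows "value_fun W I q s = gomory_value W I q b s"
proof (rule antisym)
  show "value_fun W I q s \<le> gomory_value W I q b s"
    unfolding gomory_value_def
  proof (rule milp_value_ge)
    fix y assume y: "W *v y = s" "\<forall>j\<in>I. y $ j \<in> \<int>" "\<forall>j\<in>- range b. 0 \<le> y $ j"
    then obtain y' where "W *v y' = s" "\<forall>j\<in>I. y' $ j \<in> \<int>" "\<forall>j. 0 \<le> y' $ j" and
      le: "q \<bullet> y' \<le> q \<bullet> y"
      using gomory_reduce[OF b, of y] deep by auto
    then have "value_fun W I q s \<le> ereal (q \<bullet> y')"
      unfolding value_fun_def by (intro milp_value_le) auto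
    then show "value_fun W I q s \<le> ereal (q \<bullet> y)" using le by (meson ereal_less_eq(3) order_trans)
  qed
qed (rule gomory_le_value)

text \<open>Moving \<open>c\<close> by a common period of both \<open>psi\<close> functions into the cone of negative basic
  coordinates makes the term \<open>(dual_mult W q k - dual_mult W q j) \<bullet> c\<close> nonpositive.\<close>

lemma psi_dominates:
  assumes j: "j \<in> dual_feasible W q" and k: "k \<in> dual_feasible W q"
    and deep: "\<And>i. depth + common_period \<le> basic_coords W k s $ i"
  shows "psi W I q j (s + c) + dual_mult W q j \<bullet> s \<le> psi W I q k (s + c) + dual_mult W q k \<bullet> s"
proof -
  have inv: "invertible (basis_mat W k)" using k by (simp add: dual_feasible_iff)
  let ?P = common_period
  define x where "x = basic_coords W k c"
  \<comment> \<open>Rounding up puts the shifted basic coordinates into the interval from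
    \<open>- common_period\<close> (excluded) to 0. They are nonpositive, and the loss of depth is
    at most one common period, which explains the summand \<open>common_period\<close> in
    \<open>deep\<close>.\<close>
  define l :: "real^'m" where "l = (\<chi> i. - of_int \<lceil>x $ i / ?P\<rceil>)"
  define c' where "c' = c + basis_mat W k *v (?P *\<^sub>R l)"
  have l: "int_vec l" by (simp add: int_vec_def l_def)
  have B_eq: "basis_mat W k *v l = W *v embed_basic k l" by (simp add: mult_embed_basic)
  have w: "int_vec (basis_mat W k *v l)"
    unfolding B_eq using l W_Ints
    by (intro int_vec_mult) (auto simp: int_vec_def intro!: embed_basic_Ints)
  have xc: "basic_coords W k c' = x + ?P *\<^sub>R l"
    by (simp add: c'_def basic_coords_add coords_basis_mult inv x_def)
  have x': "- ?P \<le> basic_coords W k c' $ i \<and> basic_coords W k c' $ i \<le> 0" for i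
  proof -
    have "x $ i \<le> of_int \<lceil>x $ i / ?P\<rceil> * ?P"
      using le_of_int_ceiling[of "x $ i / ?P"] common_period_pos by (simp only: pos_divide_le_eq)
    moreover have "(of_int \<lceil>x $ i / ?P\<rceil> - 1) * ?P < x $ i"
      using ceiling_correct[of "x $ i / ?P"] common_period_pos by (simp add: pos_less_divide_eq)
    ultimately show ?thesis unfolding xc by (simp add: l_def algebra_simps)
  qed
  have deep': "depth \<le> basic_coords W k (s + c') $ i" for i
    using deep[of i] x'[of i] by (simp add: basic_coords_add)
  have "psi W I q j (s + c') = psi W I q j (s + c)"
    using psi_common_period[OF j w, of "s + c"]
    by (simp add: c'_def matrix_vector_mult_scaleR add.assoc)
  moreover have "psi W I q k (s + c') = psi W I q k (s + c)"
    using psi_common_period[OF k w, of "s + c"]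
    by (simp add: c'_def matrix_vector_mult_scaleR add.assoc)
  \<comment> \<open>At \<open>s + c'\<close> the relaxation for \<open>k\<close> is exact, whereas
    the one for \<open>j\<close> is still a lower bound of the value function.\<close>
  moreover have "dual_mult W q j \<bullet> (s + c') + psi W I q j (s + c')
      \<le> dual_mult W q k \<bullet> (s + c') + psi W I q k (s + c')"
    using gomory_le_value[of q j "s + c'"] value_eq_gomory[OF k deep']
    by (simp add: gomory_eq[OF j] gomory_eq[OF k])
  \<comment> \<open>Writing \<open>c'\<close> through columns of \<open>k\<close> with nonpositive
    coefficients, \<open>k\<close> prices it at its true cost, and the nonnegative reduced costs of
    \<open>j\<close> can only raise the price.\<close>
  moreover have "dual_mult W q k \<bullet> c' \<le> dual_mult W q j \<bullet> c'"
  proof -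
    define x1 where "x1 = basic_coords W k c'"
    have c': "c' = W *v embed_basic k x1" by (simp add: mult_embed_basic x1_def basis_mult_coords inv)
    have "reduced_cost W q k \<bullet> embed_basic k x1 = 0"
      by (simp add: inner_embed_basic reduced_cost_basic inv) (simp add: inner_vec_def)
    moreover have "reduced_cost W q j \<bullet> embed_basic k x1 \<le> 0"
      using j x' unfolding inner_embed_basic
      by (auto simp: inner_vec_def dual_feasible_iff x1_def intro!: sum_nonpos mult_nonneg_nonpos)
    ultimately show ?thesis
      using cost_split[of q "embed_basic k x1" W k] cost_split[of q "embed_basic k x1" W j]
      by (simp add: c'[symmetric])
  qed
  ultimately show ?thesis by (simp add: inner_add_right)
qed

end

lemma borel_measurable_milp_value [measurable]:
  fixes W :: "real^'n^'m"
  shows "milp_value W I P q \<in> borel_measurable borel"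
proof (rule borel_measurableI_less)
  fix a :: ereal
  show "{s \<in> space borel. milp_value W I P q s < a} \<in> sets borel"
  proof -
    define Y where "Y = {y :: real^'n. (\<forall>j\<in>I. y $ j \<in> \<int>) \<and> (\<forall>j\<in>P. 0 \<le> y $ j)}"
    define K where "K r n = cball 0 (real n) \<inter> (Y \<inter> {y. q \<bullet> y \<le> r})" for r and n :: nat
    have "closed Y" unfolding Y_def by (rule closed_mixed_integer)
    then have "compact (K r n)" for r n
      unfolding K_def by (intro compact_Int_closed compact_cball closed_Int closed_Collect_le
          continuous_intros)
    then have comp: "compact ((*v) W ` K r n)" for r n
      by (intro compact_continuous_image continuous_intros) auto
    define R where "R = {r \<in> \<rat>. ereal r < a}"
    have "countable R" unfolding R_def by (rule countable_subset[OF _ countable_rat]) auto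
    have "{s \<in> space borel. milp_value W I P q s < a} = (\<Union>r\<in>R. \<Union>n. (*v) W ` K r n)"
    proof (intro set_eqI iffI)
      fix s assume "s \<in> {s \<in> space borel. milp_value W I P q s < a}"
      then obtain y where y: "W *v y = s" "y \<in> Y" "ereal (q \<bullet> y) < a"
        by (auto simp: milp_value_def INF_less_iff Y_def)
      obtain r where r: "ereal (q \<bullet> y) < ereal r" "ereal r < a" "r \<in> \<rat>"
      proof -
        obtain b where b: "ereal (q \<bullet> y) < b" "b < a" using y(3) dense by blast
        then obtain c where c: "b = ereal c" using y(3) by (cases b) auto
        obtain r where "q \<bullet> y < r" "r < c" "r \<in> \<rat>" using b c Rats_dense_in_real[of "q \<bullet> y" c] by auto
        then show ?thesis using that[of r] b c by (meson ereal_less_eq less_ereal.simps(1) less_trans)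
      qed
      then have "s \<in> (*v) W ` K r (nat \<lceil>norm y\<rceil>)"
        using y by (intro image_eqI[of _ _ y]) (auto simp: K_def of_nat_ceiling)
      then show "s \<in> (\<Union>r\<in>R. \<Union>n. (*v) W ` K r n)" using r by (auto simp: R_def)
    next
      fix s assume "s \<in> (\<Union>r\<in>R. \<Union>n. (*v) W ` K r n)"
      then obtain r y where y: "r \<in> R" "W *v y = s" "y \<in> Y" "q \<bullet> y \<le> r" by (auto simp: K_def)
      then have "milp_value W I P q s \<le> ereal (q \<bullet> y)"
        by (intro milp_value_le) (auto simp: Y_def)
      also have "\<dots> < a" using y by (auto simp: R_def intro: le_less_trans[of _ "ereal r"])
      finally show "s \<in> {s \<in> space borel. milp_value W I P q s < a}" by simp
    qed
    also have "\<dots> \<in> sets borel"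
      using \<open>countable R\<close> comp
      by (intro sets.countable_UN' sets.countable_UN) (auto intro: borel_compact)
    finally show ?thesis .
  qed
qed

lemma borel_measurable_psi [measurable]: "psi W I q b \<in> borel_measurable borel"
  unfolding psi_def gomory_value_def by measurable

lemma borel_measurable_value_fun [measurable]: "value_fun W I q \<in> borel_measurable borel"
  unfolding value_fun_def by measurable

section \<open>Periodic functions and variation along lines\<close>

lemma nn_integral_lborel_translate:
  fixes K :: "'a::euclidean_space \<Rightarrow> ennreal"
  assumes [measurable]: "K \<in> borel_measurable borel"
  shows "(\<integral>\<^sup>+ x. K (x + c) \<partial>lborel) = (\<integral>\<^sup>+ x. K x \<partial>lborel)"
proof -
  have "(\<integral>\<^sup>+ x. K x \<partial>lborel) = (\<integral>\<^sup>+ x. K x \<partial>distr lborel borel ((+) c))"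
    by (simp add: lborel_distr_plus)
  also have "\<dots> = (\<integral>\<^sup>+ x. K (x + c) \<partial>lborel)"
    by (subst nn_integral_distr) (auto simp: add.commute)
  finally show ?thesis ..
qed

text \<open>The hypothesis \<open>unique\<close> says that the translates of \<open>D\<close> by
  \<open>l k\<close> tile the space. Their indicators sum to 1; inserting this sum and exchanging it
  with the integral folds the whole integral onto the tile \<open>D\<close>.\<close>

lemma nn_integral_lattice:
  fixes K :: "'a::euclidean_space \<Rightarrow> ennreal" and l :: "'i \<Rightarrow> 'a"
  assumes [measurable]: "K \<in> borel_measurable borel" "D \<in> sets borel"
    and J: "countable J" and unique: "\<And>x. \<exists>!k. k \<in> J \<and> x - l k \<in> D"
  shows "(\<integral>\<^sup>+ x. K x \<partial>lborel) =
    (\<integral>\<^sup>+ x. indicator D x * (\<integral>\<^sup>+ k. K (x + l k) \<partial>count_space J) \<partial>lborel)"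
proof -
  interpret pair_sigma_finite "count_space J" "lborel :: 'a measure"
    by (intro pair_sigma_finite.intro sigma_finite_measure_count_space_countable J
        lborel.sigma_finite_measure_axioms)
  have count: "(\<integral>\<^sup>+ k. indicator D (x - l k) \<partial>count_space J) = (1 :: ennreal)" for x
  proof -
    obtain k where k: "k \<in> J" "x - l k \<in> D" "\<And>k'. k' \<in> J \<Longrightarrow> x - l k' \<in> D \<Longrightarrow> k' = k"
      using unique[of x] by blast
    have "(\<integral>\<^sup>+ k. indicator D (x - l k) \<partial>count_space J) =
        (\<integral>\<^sup>+ k'. indicator {k} k' \<partial>count_space J :: ennreal)"
      by (intro nn_integral_cong) (auto simp: indicator_def k)
    also have "\<dots> = 1" using k(1) by (simp add: nn_integral_indicator)
    finally show ?thesis .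
  qed
  have "(\<integral>\<^sup>+ x. K x \<partial>lborel) =
      (\<integral>\<^sup>+ x. (\<integral>\<^sup>+ k. K x * indicator D (x - l k) \<partial>count_space J) \<partial>lborel)"
    by (intro nn_integral_cong) (simp add: nn_integral_cmult count)
  also have "\<dots> = (\<integral>\<^sup>+ k. (\<integral>\<^sup>+ x. K x * indicator D (x - l k) \<partial>lborel) \<partial>count_space J)"
    by (rule Fubini') (intro measurable_pair_measure_countable1 J, simp)
  also have "\<dots> = (\<integral>\<^sup>+ k. (\<integral>\<^sup>+ x. K (x + l k) * indicator D x \<partial>lborel) \<partial>count_space J)"
  proof (rule nn_integral_cong)
    fix k
    show "(\<integral>\<^sup>+ x. K x * indicator D (x - l k) \<partial>lborel) =
        (\<integral>\<^sup>+ x. K (x + l k) * indicator D x \<partial>lborel)"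
      using nn_integral_lborel_translate[of "\<lambda>x. K x * indicator D (x - l k)" "l k"] by simp
  qed
  also have "\<dots> = (\<integral>\<^sup>+ x. (\<integral>\<^sup>+ k. K (x + l k) * indicator D x \<partial>count_space J) \<partial>lborel)"
    by (rule Fubini'[symmetric]) (intro measurable_pair_measure_countable1 J, simp)
  also have "\<dots> = (\<integral>\<^sup>+ x. indicator D x * (\<integral>\<^sup>+ k. K (x + l k) \<partial>count_space J) \<partial>lborel)"
    by (intro nn_integral_cong) (subst nn_integral_multc, auto simp: mult.commute)
  finally show ?thesis .
qed

text \<open>Fold the line onto an interval of length \<open>u\<close>. For each fixed
  \<open>x\<close> the folded integrand is the sum of increments of \<open>g\<close> along an
  arithmetic progression of step \<open>u\<close>, which the total variation dominates.\<close>

lemma nn_integral_diff_translate_le: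
  fixes g :: "real \<Rightarrow> real"
  assumes [measurable]: "g \<in> borel_measurable borel" and "0 \<le> u"
  shows "(\<integral>\<^sup>+ x. ennreal \<bar>g x - g (x - u)\<bar> \<partial>lborel) \<le> ennreal u * total_variation g"
proof (cases "u = 0")
  case True
  then show ?thesis by simp
next
  case False
  then have u: "0 < u" using assms by simp
  have unique: "\<exists>!k :: int. k \<in> UNIV \<and> x - of_int k * u \<in> {0..<u}" for x
  proof -
    have "x - of_int k * u \<in> {0..<u} \<longleftrightarrow> k = \<lfloor>x / u\<rfloor>" for k :: int
    proof -
      have "x - of_int k * u \<in> {0..<u} \<longleftrightarrow> of_int k \<le> x / u \<and> x / u < of_int k + 1"
        using u by (auto simp: field_simps)
      then show ?thesis by (auto simp: eq_commute[of k] floor_eq_iff)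
    qed
    then show ?thesis by auto
  qed
  have bound: "(\<integral>\<^sup>+ k. ennreal \<bar>g (x + of_int k * u) - g (x + of_int k * u - u)\<bar>
      \<partial>count_space (UNIV :: int set)) \<le> total_variation g" (is "?S \<le> _") for x
  proof -
    define a where "a k = ennreal \<bar>g (x + of_int k * u) - g (x + of_int k * u - u)\<bar>" for k :: int
    have "?S = (\<integral>\<^sup>+ n. a (int_decode n) \<partial>count_space UNIV)"
      unfolding a_def by (rule nn_integral_bij_count_space[symmetric]) (rule bij_int_decode)
    also have "\<dots> = (\<Sum>n. a (int_decode n))" by (rule nn_integral_count_space_nat)
    also have "\<dots> \<le> total_variation g"
    proof (rule suminf_le_const[OF summableI])
      fix N
      \<comment> \<open>Finitely many terms of the enumerated sum have indices between
        \<open>- M\<close> and \<open>M\<close>; enlarging the sum to all these indices makes the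
        increments consecutive.\<close>
      define M where "M = Max (insert 0 ((\<lambda>n. nat \<bar>int_decode n\<bar>) ` {..<N}))"
      have M: "\<bar>int_decode n\<bar> \<le> int M" if "n < N" for n
      proof -
        have "nat \<bar>int_decode n\<bar> \<le> M" unfolding M_def using that by (intro Max_ge) auto
        then show ?thesis by linarith
      qed
      \<comment> \<open>The offset \<open>- 1\<close> makes the increment from \<open>z i\<close> to
        \<open>z (Suc i)\<close> the one with index \<open>int i - int M\<close>.\<close>
      define z where "z i = x + (real i - real M - 1) * u" for i
      have "(\<Sum>n<N. a (int_decode n)) = sum a (int_decode ` {..<N})"
        by (simp add: sum.reindex inj_int_decode)
      also have "\<dots> \<le> sum a ((\<lambda>i. int i - int M) ` {..<2 * M + 1})"
      proof (rule sum_mono2)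
        show "int_decode ` {..<N} \<subseteq> (\<lambda>i. int i - int M) ` {..<2 * M + 1}"
        proof
          fix k assume "k \<in> int_decode ` {..<N}"
          then have "\<bar>k\<bar> \<le> int M" using M by auto
          then show "k \<in> (\<lambda>i. int i - int M) ` {..<2 * M + 1}"
            by (intro image_eqI[of _ _ "nat (k + int M)"]) auto
        qed
      qed auto
      also have "\<dots> = (\<Sum>i<2 * M + 1. a (int i - int M))"
        by (subst sum.reindex) (auto simp: inj_on_def)
      also have "\<dots> = (\<Sum>i<2 * M + 1. ennreal \<bar>g (z (Suc i)) - g (z i)\<bar>)"
        unfolding a_def z_def by (intro sum.cong refl) (simp add: algebra_simps)
      also have "\<dots> \<le> total_variation g"
      proof -
        have "strict_mono_on {..2 * M + 1} z"
          using u by (auto simp: strict_mono_on_def z_def)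
        then show ?thesis
          unfolding total_variation_def by (intro SUP_upper2[of "(2 * M + 1, z)"]) auto
      qed
      finally show "(\<Sum>n<N. a (int_decode n)) \<le> total_variation g" .
    qed
    finally show ?thesis .
  qed
  have "(\<integral>\<^sup>+ x. ennreal \<bar>g x - g (x - u)\<bar> \<partial>lborel) = (\<integral>\<^sup>+ x. indicator {0..<u} x *
      (\<integral>\<^sup>+ k. ennreal \<bar>g (x + of_int k * u) - g (x + of_int k * u - u)\<bar> \<partial>count_space (UNIV :: int set))
      \<partial>lborel)"
    by (rule nn_integral_lattice[OF _ _ _ unique]) auto
  also have "\<dots> \<le> (\<integral>\<^sup>+ x. indicator {0..<u} x * total_variation g \<partial>lborel)"
    by (intro nn_integral_mono mult_left_mono bound) auto
  also have "\<dots> = ennreal u * total_variation g"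
    using u by (simp add: nn_integral_multc)
  finally show ?thesis .
qed

text \<open>An integrable nonnegative function takes arbitrarily small values to the right of
  \<open>x\<close>, so a single increment already has size almost \<open>g x\<close>.\<close>

lemma le_total_variation:
  fixes g :: "real \<Rightarrow> real"
  assumes [measurable]: "g \<in> borel_measurable borel"
    and nonneg: "\<And>x. 0 \<le> g x" and fin: "(\<integral>\<^sup>+ x. ennreal (g x) \<partial>lborel) < \<infinity>"
  shows "ennreal (g x) \<le> total_variation g"
proof (rule ennreal_le_epsilon)
  fix e :: real assume e: "0 < e"
  have "\<exists>y>x. g y < e"
  proof (rule ccontr)
    assume "\<not> ?thesis"
    then have ge: "e \<le> g y" if "x < y" for y using that by force
    obtain r where r: "0 \<le> r" "(\<integral>\<^sup>+ x. ennreal (g x) \<partial>lborel) = ennreal r"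
      using fin by (cases "\<integral>\<^sup>+ x. ennreal (g x) \<partial>lborel") auto
    \<comment> \<open>An interval of this length on which \<open>g\<close> is at least
      \<open>e\<close> would contribute \<open>r + 1\<close>, more than the whole integral
      \<open>r\<close>.\<close>
    define c where "c = (r + 1) / e"
    have "(\<integral>\<^sup>+ y. ennreal e * indicator {x<..x + c} y \<partial>lborel) \<le> ennreal r"
      unfolding r(2)[symmetric] using ge nonneg
      by (intro nn_integral_mono) (auto simp: indicator_def intro!: ennreal_leI)
    moreover have "(\<integral>\<^sup>+ y. ennreal e * indicator {x<..x + c} y \<partial>lborel) = ennreal (r + 1)"
      using e r(1) by (simp add: nn_integral_cmult c_def ennreal_mult[symmetric])
    ultimately show False using r(1) by simp
  qed
  then obtain y where y: "x < y" "g y < e" by blast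
  define z where "z i = (if i = 0 then x else y)" for i :: nat
  have "strict_mono_on {..1} z" using y by (auto simp: strict_mono_on_def z_def)
  then have "ennreal \<bar>g y - g x\<bar> \<le> total_variation g"
    unfolding total_variation_def by (intro SUP_upper2[of "(1, z)"]) (auto simp: z_def)
  moreover have "ennreal (g x) \<le> ennreal \<bar>g y - g x\<bar> + ennreal e"
    using e y nonneg[of y] by (simp flip: ennreal_plus)
  ultimately show "ennreal (g x) \<le> total_variation g + ennreal e"
    by (meson add_right_mono order_trans)
qed

text \<open>Half-open cubes tile the space exactly, which \<open>nn_integral_lattice\<close>
  requires. The closed cube in \<open>Gamma_mean\<close> differs from such a cube by a null
  set.\<close>

definition half_open_cube :: "real^'m \<Rightarrow> real \<Rightarrow> (real^'m) set" where
  "half_open_cube a r = {x. \<forall>i. a $ i \<le> x $ i \<and> x $ i < a $ i + r}"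

lemma half_open_cube_measurable [measurable]: "half_open_cube a r \<in> sets borel"
proof -
  have "half_open_cube a r = (\<Inter>i. {x. a $ i \<le> x $ i} \<inter> {x. x $ i < a $ i + r})"
    by (auto simp: half_open_cube_def)
  also have "\<dots> \<in> sets borel"
    by (intro sets.countable_INT' sets.Int borel_closed borel_open closed_Collect_le
        open_Collect_less continuous_intros) auto
  finally show ?thesis .
qed

lemma card_vec_box:
  fixes A :: "'m::finite \<Rightarrow> int set"
  shows "card {k :: int^'m. \<forall>i. k $ i \<in> A i} = (\<Prod>i\<in>UNIV. card (A i))"
proof -
  have "bij_betw vec_nth {k :: int^'m. \<forall>i. k $ i \<in> A i} (PiE UNIV A)"
    by (rule bij_betwI[where g=vec_lambda]) (auto simp: PiE_def extensional_def)
  then show ?thesis by (simp add: bij_betw_same_card card_PiE)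
qed

text \<open>In each coordinate, a half-open interval of length \<open>real N * p\<close> meets every
  coset of the multiples of \<open>p\<close> in exactly \<open>N\<close> points.\<close>

lemma card_lattice_cube:
  fixes x a :: "real^'m"
  assumes p: "0 < p"
  shows "card {k :: int^'m. x - p *\<^sub>R (\<chi> i. of_int (k $ i)) \<in> half_open_cube a (real N * p)} = N ^ CARD('m)"
proof -
  have "{k :: int^'m. x - p *\<^sub>R (\<chi> i. of_int (k $ i)) \<in> half_open_cube a (real N * p)} =
      {k. \<forall>i. k $ i \<in> {\<lfloor>(x $ i - a $ i) / p\<rfloor> - int N <.. \<lfloor>(x $ i - a $ i) / p\<rfloor>}}"
  proof (rule Collect_cong)
    fix k :: "int^'m"
    have "a $ i \<le> x $ i - p * of_int (k $ i) \<longleftrightarrow> k $ i \<le> \<lfloor>(x $ i - a $ i) / p\<rfloor>" for i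
    proof -
      have "a $ i \<le> x $ i - p * of_int (k $ i) \<longleftrightarrow> of_int (k $ i) \<le> (x $ i - a $ i) / p"
        using p by (auto simp: field_simps)
      then show ?thesis by (simp add: le_floor_iff)
    qed
    moreover have "x $ i - p * of_int (k $ i) < a $ i + real N * p \<longleftrightarrow>
        \<lfloor>(x $ i - a $ i) / p\<rfloor> - int N < k $ i" for i
    proof -
      have "x $ i - p * of_int (k $ i) < a $ i + real N * p \<longleftrightarrow>
          (x $ i - a $ i) / p < of_int (k $ i + int N)"
        using p by (auto simp: field_simps)
      also have "\<dots> \<longleftrightarrow> \<lfloor>(x $ i - a $ i) / p\<rfloor> < k $ i + int N" by (simp only: floor_less_iff)
      finally show ?thesis by auto
    qed
    ultimately show "(x - p *\<^sub>R (\<chi> i. of_int (k $ i)) \<in> half_open_cube a (real N * p)) =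
        (\<forall>i. k $ i \<in> {\<lfloor>(x $ i - a $ i) / p\<rfloor> - int N <.. \<lfloor>(x $ i - a $ i) / p\<rfloor>})"
      by (auto simp: half_open_cube_def)
  qed
  then show ?thesis by (simp only: card_vec_box) simp
qed

text \<open>Fold the integral onto the basic cube of side \<open>p\<close>. Every point there has
  the same number of lattice translates in the large cube, wherever that cube sits, and
  \<open>F\<close> agrees on all of them.\<close>

lemma nn_integral_periodic_cube:
  fixes F :: "real^'m \<Rightarrow> ennreal"
  assumes [measurable]: "F \<in> borel_measurable borel"
    and p: "0 < p" and N: "0 < N"
    and per: "\<And>x w. (\<And>i. w $ i \<in> \<int>) \<Longrightarrow> F (x + p *\<^sub>R w) = F x"
  shows "(\<integral>\<^sup>+ x. indicator (half_open_cube a (real N * p)) x * F x \<partial>lborel) =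
    of_nat (N ^ CARD('m)) * (\<integral>\<^sup>+ x. indicator (half_open_cube 0 p) x * F x \<partial>lborel)"
proof -
  \<comment> \<open>The minus sign fits the folded integrand to \<open>card_lattice_cube\<close>;
    the tiling condition then holds with \<open>- k\<close> in place of \<open>k\<close>.\<close>
  let ?l = "\<lambda>k :: int^'m. - (p *\<^sub>R (\<chi> i. of_int (k $ i)))"
  let ?C = "half_open_cube a (real N * p)"
  have unique: "\<exists>!k :: int^'m. k \<in> UNIV \<and> x - ?l k \<in> half_open_cube 0 p" for x
  proof -
    have "card {k :: int^'m. x - p *\<^sub>R (\<chi> i. of_int (k $ i)) \<in> half_open_cube 0 (real 1 * p)} = 1"
      using card_lattice_cube[OF p, of x 0 1] by simp
    then obtain k where k: "{k :: int^'m. x - p *\<^sub>R (\<chi> i. of_int (k $ i)) \<in> half_open_cube 0 p} = {k}"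
      by (auto simp: card_1_singleton_iff)
    show ?thesis
    proof (rule ex1I[of _ "- k"])
      have eq: "x - ?l k' = x - p *\<^sub>R (\<chi> i. of_int ((- k') $ i))" for k' :: "int^'m"
        by (simp add: vec_eq_iff)
      show "- k \<in> UNIV \<and> x - ?l (- k) \<in> half_open_cube 0 p"
        unfolding eq using k by auto
      show "k' = - k" if "k' \<in> UNIV \<and> x - ?l k' \<in> half_open_cube 0 p" for k'
      proof -
        have "- k' \<in> {k. x - p *\<^sub>R (\<chi> i. of_int (k $ i)) \<in> half_open_cube 0 p}"
          using that unfolding eq by blast
        then have "- k' = k" unfolding k by simp
        then show ?thesis by auto
      qed
    qed
  qed
  have "(\<integral>\<^sup>+ x. indicator ?C x * F x \<partial>lborel) = (\<integral>\<^sup>+ x. indicator (half_open_cube 0 p) x *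
      (\<integral>\<^sup>+ k. indicator ?C (x + ?l k) * F (x + ?l k) \<partial>count_space UNIV) \<partial>lborel)"
    by (rule nn_integral_lattice[OF _ _ _ unique]) auto
  also have "\<dots> = (\<integral>\<^sup>+ x. of_nat (N ^ CARD('m)) * (indicator (half_open_cube 0 p) x * F x) \<partial>lborel)"
  proof (rule nn_integral_cong)
    fix x :: "real^'m"
    have F: "F (x - p *\<^sub>R (\<chi> i. of_int (k $ i))) = F x" for k :: "int^'m"
    proof -
      have eq: "x - p *\<^sub>R (\<chi> i. of_int (k $ i)) = x + p *\<^sub>R (\<chi> i. - of_int (k $ i))"
        by (simp add: vec_eq_iff)
      show ?thesis unfolding eq by (rule per) simp
    qed
    let ?K = "{k :: int^'m. x - p *\<^sub>R (\<chi> i. of_int (k $ i)) \<in> ?C}"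
    have "(\<integral>\<^sup>+ k. indicator ?C (x + ?l k) * F (x + ?l k) \<partial>count_space UNIV) =
        (\<integral>\<^sup>+ k. indicator ?K k * F x \<partial>count_space UNIV)"
      by (intro nn_integral_cong) (simp add: F indicator_def)
    also have "\<dots> = emeasure (count_space UNIV) ?K * F x"
      by (simp add: nn_integral_multc)
    also have "emeasure (count_space UNIV) ?K = of_nat (N ^ CARD('m))"
    proof -
      have "finite ?K"
        using card_lattice_cube[OF p, of x a N] N by (intro card_ge_0_finite) simp
      then show ?thesis by (simp add: emeasure_count_space card_lattice_cube[OF p])
    qed
    finally show "indicator (half_open_cube 0 p) x *
      (\<integral>\<^sup>+ k. indicator ?C (x + ?l k) * F (x + ?l k) \<partial>count_space UNIV) =
      of_nat (N ^ CARD('m)) * (indicator (half_open_cube 0 p) x * F x)"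
      by (simp add: mult_ac)
  qed
  also have "\<dots> = of_nat (N ^ CARD('m)) * (\<integral>\<^sup>+ x. indicator (half_open_cube 0 p) x * F x \<partial>lborel)"
    by (simp add: nn_integral_cmult)
  finally show ?thesis .
qed

section \<open>Disintegration of a density along coordinate lines\<close>

lemma subst_comp_eq: "subst_comp t i u = t + (u - t $ i) *\<^sub>R axis i 1"
  by (auto simp: vec_eq_iff subst_comp_def axis_def)

lemma subst_comp_twice [simp]: "subst_comp (subst_comp t i u) i v = subst_comp t i v"
  by (simp add: vec_eq_iff subst_comp_def)

lemma subst_comp_diff_axis:
  "subst_comp t i u - v *\<^sub>R axis i 1 = subst_comp t i (u - v)"
  by (auto simp: vec_eq_iff subst_comp_def axis_def)

lemma subst_comp_measurable [measurable (raw)]: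
  assumes [measurable]: "g \<in> borel_measurable M" "v \<in> borel_measurable M"
  shows "(\<lambda>x. subst_comp (g x) i (v x)) \<in> borel_measurable M"
  unfolding subst_comp_eq cart_eq_inner_axis by measurable

text \<open>Fubini's theorem along the \<open>i\<close>th axis without splitting the space: integrating a
  function of the line through \<open>t\<close> over the slab \<open>0 \<le> t $ i \<le> 1\<close> integrates it once over every line.\<close>

lemma nn_integral_lines:
  fixes K :: "real^'m \<Rightarrow> ennreal"
  assumes [measurable]: "K \<in> borel_measurable borel"
  shows "(\<integral>\<^sup>+ t. K t \<partial>lborel) =
    (\<integral>\<^sup>+ t. indicator {0..1} (t $ i) * (\<integral>\<^sup>+ u. K (subst_comp t i u) \<partial>lborel) \<partial>lborel)"
proof -
  let ?J = "indicator {0..1} :: real \<Rightarrow> ennreal"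
  have [measurable]: "(\<lambda>t :: real^'m. t $ i) \<in> borel_measurable borel"
    unfolding cart_eq_inner_axis by measurable
  have [measurable]: "(\<lambda>x. subst_comp (snd x) i (fst x)) \<in> borel_measurable (borel \<Otimes>\<^sub>M (borel :: (real^'m) measure))"
    by measurable
  have "(\<integral>\<^sup>+ t. ?J (t $ i) * (\<integral>\<^sup>+ u. K (subst_comp t i u) \<partial>lborel) \<partial>lborel) =
      (\<integral>\<^sup>+ t. (\<integral>\<^sup>+ u. ?J (t $ i) * K (t + u *\<^sub>R axis i 1) \<partial>lborel) \<partial>lborel)"
  proof (rule nn_integral_cong)
    fix t :: "real^'m"
    have "(\<integral>\<^sup>+ u. K (subst_comp t i u) \<partial>lborel) = (\<integral>\<^sup>+ u. K (subst_comp t i (u + t $ i)) \<partial>lborel)"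
      by (rule nn_integral_lborel_translate[symmetric]) measurable
    then show "?J (t $ i) * (\<integral>\<^sup>+ u. K (subst_comp t i u) \<partial>lborel) =
        (\<integral>\<^sup>+ u. ?J (t $ i) * K (t + u *\<^sub>R axis i 1) \<partial>lborel)"
      by (simp add: subst_comp_eq nn_integral_cmult)
  qed
  also have "\<dots> = (\<integral>\<^sup>+ u. (\<integral>\<^sup>+ t. ?J (t $ i) * K (t + u *\<^sub>R axis i 1) \<partial>lborel) \<partial>lborel)"
    by (rule lborel_pair.Fubini') measurable
  also have "\<dots> = (\<integral>\<^sup>+ u. (\<integral>\<^sup>+ t. ?J (t $ i - u) * K t \<partial>lborel) \<partial>lborel)"
  proof (rule nn_integral_cong)
    fix u :: real
    show "(\<integral>\<^sup>+ t. ?J (t $ i) * K (t + u *\<^sub>R axis i 1) \<partial>lborel) = (\<integral>\<^sup>+ t. ?J (t $ i - u) * K t \<partial>lborel)"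
      using nn_integral_lborel_translate[of "\<lambda>t. ?J (t $ i - u) * K t" "u *\<^sub>R axis i 1"]
      by (simp add: axis_def)
  qed
  also have "\<dots> = (\<integral>\<^sup>+ t. (\<integral>\<^sup>+ u. ?J (t $ i - u) * K t \<partial>lborel) \<partial>lborel)"
    by (rule lborel_pair.Fubini'[symmetric]) measurable
  also have "\<dots> = (\<integral>\<^sup>+ t. K t \<partial>lborel)"
  proof (rule nn_integral_cong)
    fix t :: "real^'m"
    have "(\<integral>\<^sup>+ u. ?J (t $ i - u) \<partial>lborel) = (\<integral>\<^sup>+ u. indicator {t $ i - 1..t $ i} u \<partial>lborel)"
      by (intro nn_integral_cong) (auto simp: indicator_def)
    then show "(\<integral>\<^sup>+ u. ?J (t $ i - u) * K t \<partial>lborel) = K t"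
      by (simp add: nn_integral_multc)
  qed
  finally show ?thesis ..
qed

lemma marginal_density_subst [simp]:
  "marginal_density f i (subst_comp t i u) = marginal_density f i t"
  by (simp add: marginal_density_def)

lemma marginal_density_measurable [measurable]:
  fixes f :: "real^'m \<Rightarrow> real"
  assumes [measurable]: "f \<in> borel_measurable borel"
  shows "marginal_density f i \<in> borel_measurable borel"
proof -
  have "(\<lambda>t. \<integral>\<^sup>+ u. ennreal (f (subst_comp t i u)) \<partial>lborel) \<in> borel_measurable borel"
    by measurable
  then show ?thesis unfolding marginal_density_def[abs_def] .
qed

text \<open>The total variation of the conditional density need not be a measurable function of the
  point. Its integral is bounded below through the measurable minorant \<open>L / marginal_density f i\<close>.\<close>

lemma nn_integral_le_expected_variation:
  fixes f :: "real^'m \<Rightarrow> real" and K :: "real^'m \<Rightarrow> ennreal"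
  assumes f: "f \<in> bv_densities" and h: "distributed M lborel h (\<lambda>t. ennreal (f t))"
    and K [measurable]: "K \<in> borel_measurable borel"
    and zero: "\<And>t. marginal_density f i t = 0 \<Longrightarrow> (\<integral>\<^sup>+ u. K (subst_comp t i u) \<partial>lborel) = 0"
    and le: "\<And>t. marginal_density f i t \<noteq> 0 \<Longrightarrow> marginal_density f i t \<noteq> \<infinity> \<Longrightarrow>
      (\<integral>\<^sup>+ u. K (subst_comp t i u) \<partial>lborel) \<le>
        total_variation (cond_density f i t) * marginal_density f i t"
  shows "(\<integral>\<^sup>+ t. K t \<partial>lborel) \<le> (\<integral>\<^sup>+ \<omega>. total_variation (cond_density f i (h \<omega>)) \<partial>M)"
proof -
  let ?m = "marginal_density f i"
  have [measurable]: "f \<in> borel_measurable borel" and f1: "(\<integral>\<^sup>+ t. ennreal (f t) \<partial>lborel) = 1"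
    using f by (auto simp: bv_densities_def)
  have [measurable]: "(\<lambda>t :: real^'m. t $ i) \<in> borel_measurable borel"
    unfolding cart_eq_inner_axis by measurable
  define L where "L t = (\<integral>\<^sup>+ u. K (subst_comp t i u) \<partial>lborel)" for t
  have [measurable]: "L \<in> borel_measurable borel" unfolding L_def[abs_def] by measurable
  have L_subst: "L (subst_comp t i u) = L t" for t u by (simp add: L_def)
  have minorant: "L t / ?m t \<le> total_variation (cond_density f i t)" for t
  proof -
    consider "?m t = 0" | "?m t = \<infinity>" | "?m t \<noteq> 0" "?m t \<noteq> \<infinity>" by blast
    then show ?thesis
    proof cases
      case 1
      then show ?thesis using zero[OF 1] by (simp add: L_def)
    next
      case 2
      then show ?thesis by (simp add: ennreal_divide_top)
    next
      case 3
      then show ?thesis using le[OF 3] unfolding L_def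
        by (intro divide_le_posI_ennreal) (auto simp: zero_less_iff_neq_zero mult.commute)
    qed
  qed
  have "(\<integral>\<^sup>+ t. indicator {0..1} (t $ i) * ?m t \<partial>lborel) = 1"
    unfolding f1[symmetric] marginal_density_def
    by (rule nn_integral_lines[symmetric]) measurable
  \<comment> \<open>The marginal integrates to 1 over the slab, so it is infinite there only on a
    null set. Lines with zero marginal contribute nothing by \<open>zero\<close>.\<close>
  then have "AE t in lborel. indicator {0..1} (t $ i) * ?m t \<noteq> \<infinity>"
    by (intro nn_integral_PInf_AE) auto
  then have AE: "AE t in lborel. indicator {0..1} (t $ i) * L t =
      indicator {0..1} (t $ i) * (L t / ?m t * ?m t)"
  proof eventually_elim
    case (elim t)
    show ?case
    proof (cases "t $ i \<in> {0..1}")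
      case True
      then have m: "?m t \<noteq> \<infinity>" using elim by simp
      show ?thesis
      proof (cases "?m t = 0")
        case True
        then show ?thesis using zero[OF True] by (simp add: L_def)
      next
        case False
        then show ?thesis using m
          by (simp add: ennreal_divide_times ennreal_divide_self less_top)
      qed
    qed simp
  qed
  have "(\<integral>\<^sup>+ t. K t \<partial>lborel) = (\<integral>\<^sup>+ t. indicator {0..1} (t $ i) * L t \<partial>lborel)"
    unfolding L_def by (rule nn_integral_lines) measurable
  also have "\<dots> = (\<integral>\<^sup>+ t. indicator {0..1} (t $ i) * (L t / ?m t * ?m t) \<partial>lborel)"
    by (rule nn_integral_cong_AE[OF AE])
  \<comment> \<open>The quotient is constant along each line and the marginal is the integral of
    \<open>f\<close> over that line. Hence the product is again an integral over the line, and the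
    formula can be read backwards.\<close>
  also have "\<dots> = (\<integral>\<^sup>+ t. indicator {0..1} (t $ i) *
      (\<integral>\<^sup>+ u. ennreal (f (subst_comp t i u)) * (L (subst_comp t i u) / ?m (subst_comp t i u)) \<partial>lborel) \<partial>lborel)"
    by (intro nn_integral_cong)
       (simp add: L_subst nn_integral_multc marginal_density_def[symmetric] mult.commute)
  also have "\<dots> = (\<integral>\<^sup>+ t. ennreal (f t) * (L t / ?m t) \<partial>lborel)"
    by (rule nn_integral_lines[symmetric]) measurable
  also have "\<dots> = (\<integral>\<^sup>+ \<omega>. L (h \<omega>) / ?m (h \<omega>) \<partial>M)"
    by (rule distributed_nn_integral[OF h]) measurable
  \<comment> \<open>The nonnegative integral is a supremum over simple functions below the
    integrand, so it stays monotone even when the larger function is not measurable.\<close>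
  also have "\<dots> \<le> (\<integral>\<^sup>+ \<omega>. total_variation (cond_density f i (h \<omega>)) \<partial>M)"
    by (intro nn_integral_mono minorant)
  finally show ?thesis .
qed

lemma nn_integral_le_cmult_expected_variation:
  fixes f :: "real^'m \<Rightarrow> real" and K :: "real^'m \<Rightarrow> ennreal"
  assumes f: "f \<in> bv_densities" and h: "distributed M lborel h (\<lambda>t. ennreal (f t))"
    and K [measurable]: "K \<in> borel_measurable borel" and c: "0 < c"
    and zero: "\<And>t. marginal_density f i t = 0 \<Longrightarrow> (\<integral>\<^sup>+ u. K (subst_comp t i u) \<partial>lborel) = 0"
    and le: "\<And>t. marginal_density f i t \<noteq> 0 \<Longrightarrow> marginal_density f i t \<noteq> \<infinity> \<Longrightarrow>
      (\<integral>\<^sup>+ u. K (subst_comp t i u) \<partial>lborel) \<le>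
        ennreal c * (total_variation (cond_density f i t) * marginal_density f i t)"
  shows "(\<integral>\<^sup>+ t. K t \<partial>lborel) \<le>
    ennreal c * (\<integral>\<^sup>+ \<omega>. total_variation (cond_density f i (h \<omega>)) \<partial>M)"
proof -
  have cancel: "ennreal c * (ennreal (1 / c) * x) = x" and cancel': "ennreal (1 / c) * (ennreal c * x) = x" for x
    using c by (simp_all add: mult.assoc[symmetric] ennreal_mult[symmetric])
  have "(\<integral>\<^sup>+ t. ennreal (1 / c) * K t \<partial>lborel) \<le> (\<integral>\<^sup>+ \<omega>. total_variation (cond_density f i (h \<omega>)) \<partial>M)"
  proof (rule nn_integral_le_expected_variation[OF f h])
    fix t assume "marginal_density f i t \<noteq> 0" "marginal_density f i t \<noteq> \<infinity>"
    from mult_left_mono[OF le[OF this], of "ennreal (1 / c)"]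
    show "(\<integral>\<^sup>+ u. ennreal (1 / c) * K (subst_comp t i u) \<partial>lborel) \<le>
        total_variation (cond_density f i t) * marginal_density f i t"
      by (simp add: nn_integral_cmult cancel')
  qed (auto simp: nn_integral_cmult zero)
  from mult_left_mono[OF this, of "ennreal c"] show ?thesis
    by (simp add: nn_integral_cmult cancel)
qed

definition expected_variation :: "'w measure \<Rightarrow> ('w \<Rightarrow> real^'m) \<Rightarrow> (real^'m \<Rightarrow> real) \<Rightarrow> ennreal" where
  "expected_variation M h f =
    (\<Sum>i\<in>UNIV. \<integral>\<^sup>+ \<omega>. total_variation (cond_density f i (h \<omega>)) \<partial>M)"

lemma cond_density_scaled:
  assumes "f \<in> bv_densities" "marginal_density f i t \<noteq> 0" "marginal_density f i t \<noteq> \<infinity>"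
  shows "f (subst_comp t i u) = cond_density f i t u * enn2real (marginal_density f i t)"
    and "0 \<le> cond_density f i t u" and "0 < enn2real (marginal_density f i t)"
proof -
  show pos: "0 < enn2real (marginal_density f i t)"
    using assms(2,3) by (simp add: enn2real_positive_iff less_top zero_less_iff_neq_zero)
  then show "f (subst_comp t i u) = cond_density f i t u * enn2real (marginal_density f i t)"
    using assms(2,3) by (simp add: cond_density_def)
  show "0 \<le> cond_density f i t u"
    using assms pos by (simp add: cond_density_def bv_densities_def)
qed

lemma cond_density_measurable [measurable]:
  fixes f :: "real^'m \<Rightarrow> real"
  assumes [measurable]: "f \<in> borel_measurable borel"
  shows "cond_density f i t \<in> borel_measurable borel"
  unfolding cond_density_def[abs_def] by measurable

text \<open>On every line with a positive finite marginal, \<open>f\<close> is that marginal times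
  the conditional density, so the one-dimensional bound for translates applies line by line.\<close>

lemma nn_integral_diff_axis_le:
  fixes f :: "real^'m \<Rightarrow> real"
  assumes f: "f \<in> bv_densities" and h: "distributed M lborel h (\<lambda>t. ennreal (f t))"
    and v: "0 \<le> v" "v \<le> P" "0 < P"
  shows "(\<integral>\<^sup>+ t. ennreal \<bar>f t - f (t - v *\<^sub>R axis i 1)\<bar> \<partial>lborel) \<le>
    ennreal P * (\<integral>\<^sup>+ \<omega>. total_variation (cond_density f i (h \<omega>)) \<partial>M)"
proof (rule nn_integral_le_cmult_expected_variation[OF f h _ v(3)])
  have [measurable]: "f \<in> borel_measurable borel" and f0: "\<And>t. 0 \<le> f t"
    using f by (auto simp: bv_densities_def)
  show "(\<lambda>t. ennreal \<bar>f t - f (t - v *\<^sub>R axis i 1)\<bar>) \<in> borel_measurable borel" by measurable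
  fix t
  show "(\<integral>\<^sup>+ u. ennreal \<bar>f (subst_comp t i u) - f (subst_comp t i u - v *\<^sub>R axis i 1)\<bar> \<partial>lborel) = 0"
    if m: "marginal_density f i t = 0"
  proof -
    let ?g = "\<lambda>u. ennreal (f (subst_comp t i u))"
    have "(\<integral>\<^sup>+ u. ennreal \<bar>f (subst_comp t i u) - f (subst_comp t i u - v *\<^sub>R axis i 1)\<bar> \<partial>lborel)
        \<le> (\<integral>\<^sup>+ u. ?g u + ?g (u - v) \<partial>lborel)"
      unfolding subst_comp_diff_axis using f0
      by (intro nn_integral_mono) (auto simp: abs_le_iff simp flip: ennreal_plus intro!: ennreal_leI)
    also have "\<dots> = (\<integral>\<^sup>+ u. ?g u \<partial>lborel) + (\<integral>\<^sup>+ u. ?g (u - v) \<partial>lborel)"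
      by (rule nn_integral_add) measurable
    also have "(\<integral>\<^sup>+ u. ?g (u - v) \<partial>lborel) = (\<integral>\<^sup>+ u. ?g u \<partial>lborel)"
      using nn_integral_lborel_translate[of ?g "- v"] by simp
    finally show ?thesis using m by (simp add: marginal_density_def)
  qed
  assume m: "marginal_density f i t \<noteq> 0" "marginal_density f i t \<noteq> \<infinity>"
  let ?r = "enn2real (marginal_density f i t)"
  note c = cond_density_scaled[OF f m]
  have r: "ennreal ?r = marginal_density f i t" using m by (simp add: less_top)
  have "(\<integral>\<^sup>+ u. ennreal \<bar>f (subst_comp t i u) - f (subst_comp t i u - v *\<^sub>R axis i 1)\<bar> \<partial>lborel) =
      (\<integral>\<^sup>+ u. ennreal \<bar>cond_density f i t u - cond_density f i t (u - v)\<bar> * ennreal ?r \<partial>lborel)"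
    unfolding subst_comp_diff_axis
  proof (rule nn_integral_cong)
    fix u
    have "\<bar>f (subst_comp t i u) - f (subst_comp t i (u - v))\<bar> =
        \<bar>cond_density f i t u - cond_density f i t (u - v)\<bar> * ?r"
      unfolding c(1) left_diff_distrib[symmetric] abs_mult using c(3) by simp
    then show "ennreal \<bar>f (subst_comp t i u) - f (subst_comp t i (u - v))\<bar> =
        ennreal \<bar>cond_density f i t u - cond_density f i t (u - v)\<bar> * ennreal ?r"
      by (simp add: ennreal_mult)
  qed
  also have "\<dots> = (\<integral>\<^sup>+ u. ennreal \<bar>cond_density f i t u - cond_density f i t (u - v)\<bar> \<partial>lborel) * ennreal ?r"
    by (rule nn_integral_multc) measurable
  also have "\<dots> \<le> (ennreal v * total_variation (cond_density f i t)) * ennreal ?r"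
    using v by (intro mult_right_mono nn_integral_diff_translate_le) auto
  also have "\<dots> \<le> (ennreal P * total_variation (cond_density f i t)) * ennreal ?r"
    using v by (intro mult_right_mono ennreal_leI) auto
  finally show "(\<integral>\<^sup>+ u. ennreal \<bar>f (subst_comp t i u) - f (subst_comp t i u - v *\<^sub>R axis i 1)\<bar> \<partial>lborel)
      \<le> ennreal P * (total_variation (cond_density f i t) * marginal_density f i t)"
    by (simp add: r mult.assoc)
qed

text \<open>The shift is decomposed into shifts along the axes. By the triangle inequality and
  translation invariance each axis contributes its own bound.\<close>

lemma nn_integral_diff_translate_vec_le:
  fixes f :: "real^'m \<Rightarrow> real"
  assumes f: "f \<in> bv_densities" and h: "distributed M lborel h (\<lambda>t. ennreal (f t))"
    and P: "0 < P" and v: "\<And>i. 0 \<le> v $ i \<and> v $ i \<le> P"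
  shows "(\<integral>\<^sup>+ t. ennreal \<bar>f t - f (t - v)\<bar> \<partial>lborel) \<le> ennreal P * expected_variation M h f"
proof -
  have [measurable]: "f \<in> borel_measurable borel" using f by (auto simp: bv_densities_def)
  let ?V = "\<lambda>i. \<integral>\<^sup>+ \<omega>. total_variation (cond_density f i (h \<omega>)) \<partial>M"
  have "(\<integral>\<^sup>+ t. ennreal \<bar>f t - f (t - (\<Sum>i\<in>S. v $ i *\<^sub>R axis i 1))\<bar> \<partial>lborel) \<le> ennreal P * (\<Sum>i\<in>S. ?V i)"
    if "finite S" for S
    using that
  proof (induction S)
    case (insert i S)
    let ?w = "\<Sum>i\<in>S. v $ i *\<^sub>R axis i 1"
    let ?a = "v $ i *\<^sub>R axis i 1"
    have "(\<integral>\<^sup>+ t. ennreal \<bar>f t - f (t - (\<Sum>i\<in>insert i S. v $ i *\<^sub>R axis i 1))\<bar> \<partial>lborel) \<le>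
        (\<integral>\<^sup>+ t. ennreal \<bar>f t - f (t - ?w)\<bar> + ennreal \<bar>f (t - ?w) - f (t - ?w - ?a)\<bar> \<partial>lborel)"
      using insert.hyps
      by (intro nn_integral_mono) (auto simp: algebra_simps simp flip: ennreal_plus intro!: ennreal_leI)
    also have "\<dots> = (\<integral>\<^sup>+ t. ennreal \<bar>f t - f (t - ?w)\<bar> \<partial>lborel) +
        (\<integral>\<^sup>+ t. ennreal \<bar>f (t - ?w) - f (t - ?w - ?a)\<bar> \<partial>lborel)"
      by (rule nn_integral_add) measurable
    also have "(\<integral>\<^sup>+ t. ennreal \<bar>f (t - ?w) - f (t - ?w - ?a)\<bar> \<partial>lborel) =
        (\<integral>\<^sup>+ t. ennreal \<bar>f t - f (t - ?a)\<bar> \<partial>lborel)"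
      using nn_integral_lborel_translate[of "\<lambda>t. ennreal \<bar>f t - f (t - ?a)\<bar>" "- ?w"] by simp
    also have "(\<integral>\<^sup>+ t. ennreal \<bar>f t - f (t - ?w)\<bar> \<partial>lborel) + \<dots> \<le>
        ennreal P * (\<Sum>i\<in>S. ?V i) + ennreal P * ?V i"
      using v[of i] P by (intro add_mono insert.IH nn_integral_diff_axis_le[OF f h]) auto
    also have "\<dots> = ennreal P * (\<Sum>i\<in>insert i S. ?V i)"
      using insert.hyps by (simp add: distrib_left add.commute)
    finally show ?case .
  qed simp
  from this[of UNIV] show ?thesis
    using basis_expansion[of v] by (simp add: expected_variation_def scalar_mult_eq_scaleR)
qed

text \<open>An integrable density is at most its variation on every line, and a line not parallel to the
  slab meets it in an interval of fixed length.\<close>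

lemma nn_integral_slab_le:
  fixes f :: "real^'m \<Rightarrow> real" and a :: "real^'m"
  assumes f: "f \<in> bv_densities" and h: "distributed M lborel h (\<lambda>t. ennreal (f t))"
    and i: "a $ i \<noteq> 0" and d: "0 < d"
  shows "(\<integral>\<^sup>+ t. indicator {t. \<bar>a \<bullet> (t - z)\<bar> \<le> d} t * ennreal (f t) \<partial>lborel) \<le>
    ennreal (2 * d / \<bar>a $ i\<bar>) * expected_variation M h f"
proof -
  have [measurable]: "f \<in> borel_measurable borel" using f by (auto simp: bv_densities_def)
  define C where "C = 2 * d / \<bar>a $ i\<bar>"
  have C: "0 < C" using i d by (simp add: C_def)
  let ?S = "{t. \<bar>a \<bullet> (t - z)\<bar> \<le> d}"
  let ?V = "\<lambda>i. \<integral>\<^sup>+ \<omega>. total_variation (cond_density f i (h \<omega>)) \<partial>M"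
  have [measurable]: "?S \<in> sets borel"
    by (intro borel_closed closed_Collect_le continuous_intros)
  have len: "(\<integral>\<^sup>+ u. indicator ?S (subst_comp t i u) \<partial>lborel) = ennreal C" for t
  proof -
    \<comment> \<open>Along the line through \<open>t\<close> the slab functional equals
      \<open>a $ i * (u + c)\<close>. The slab thus cuts out an interval centred at
      \<open>- c\<close>, of length independent of \<open>t\<close> and \<open>z\<close>.\<close>
    define c where "c = (a \<bullet> (t - z) - t $ i * a $ i) / a $ i"
    have "indicator ?S (subst_comp t i u) = (indicator {- c - d / \<bar>a $ i\<bar> .. - c + d / \<bar>a $ i\<bar>} u :: ennreal)" for u
    proof -
      have "a $ i * c = a \<bullet> (t - z) - t $ i * a $ i" using i by (simp add: c_def)
      then have "a \<bullet> (subst_comp t i u - z) = a $ i * (u + c)"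
        by (simp add: subst_comp_eq inner_diff_right inner_add_right inner_axis algebra_simps)
      then have "subst_comp t i u \<in> ?S \<longleftrightarrow> \<bar>u + c\<bar> \<le> d / \<bar>a $ i\<bar>"
        using i by (simp add: abs_mult pos_le_divide_eq mult.commute)
      also have "\<dots> \<longleftrightarrow> u \<in> {- c - d / \<bar>a $ i\<bar> .. - c + d / \<bar>a $ i\<bar>}" by auto
      finally show ?thesis by (simp add: indicator_def)
    qed
    then show ?thesis using d by (simp add: C_def)
  qed
  have "(\<integral>\<^sup>+ t. indicator ?S t * ennreal (f t) \<partial>lborel) \<le> ennreal C * ?V i"
  proof (rule nn_integral_le_cmult_expected_variation[OF f h _ C])
    show "(\<lambda>t. indicator ?S t * ennreal (f t)) \<in> borel_measurable borel" by measurable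
    fix t
    show "(\<integral>\<^sup>+ u. indicator ?S (subst_comp t i u) * ennreal (f (subst_comp t i u)) \<partial>lborel) = 0"
      if m: "marginal_density f i t = 0"
    proof -
      have "(\<integral>\<^sup>+ u. indicator ?S (subst_comp t i u) * ennreal (f (subst_comp t i u)) \<partial>lborel) \<le>
          marginal_density f i t"
        unfolding marginal_density_def by (intro nn_integral_mono) (auto simp: indicator_def)
      then show ?thesis using m by simp
    qed
    assume m: "marginal_density f i t \<noteq> 0" "marginal_density f i t \<noteq> \<infinity>"
    let ?r = "enn2real (marginal_density f i t)"
    note c = cond_density_scaled[OF f m]
    have r: "ennreal ?r = marginal_density f i t" using m by (simp add: less_top)
    have bound: "ennreal (cond_density f i t u) \<le> total_variation (cond_density f i t)" for u
    proof (rule le_total_variation)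
      have "ennreal ?r * (\<integral>\<^sup>+ u. ennreal (cond_density f i t u) \<partial>lborel) =
          (\<integral>\<^sup>+ u. ennreal ?r * ennreal (cond_density f i t u) \<partial>lborel)"
        by (rule nn_integral_cmult[symmetric]) measurable
      also have "\<dots> = marginal_density f i t"
      proof -
        have "ennreal ?r * ennreal (cond_density f i t u) = ennreal (f (subst_comp t i u))" for u
          unfolding c(1) using c(2,3) by (simp add: ennreal_mult mult.commute)
        then show ?thesis by (simp add: marginal_density_def)
      qed
      finally have "ennreal ?r * (\<integral>\<^sup>+ u. ennreal (cond_density f i t u) \<partial>lborel) < \<infinity>"
        using m by (simp add: less_top)
      then show "(\<integral>\<^sup>+ u. ennreal (cond_density f i t u) \<partial>lborel) < \<infinity>"
        using c(3) by (auto simp: ennreal_mult_less_top)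
    qed (use c in auto)
    have "(\<integral>\<^sup>+ u. indicator ?S (subst_comp t i u) * ennreal (f (subst_comp t i u)) \<partial>lborel) \<le>
        (\<integral>\<^sup>+ u. indicator ?S (subst_comp t i u) * (total_variation (cond_density f i t) * ennreal ?r) \<partial>lborel)"
    proof (rule nn_integral_mono)
      fix u
      have "ennreal (f (subst_comp t i u)) = ennreal (cond_density f i t u) * ennreal ?r"
        unfolding c(1) using c(2,3) by (simp add: ennreal_mult)
      also have "\<dots> \<le> total_variation (cond_density f i t) * ennreal ?r"
        by (intro mult_right_mono bound) auto
      finally show "indicator ?S (subst_comp t i u) * ennreal (f (subst_comp t i u)) \<le>
          indicator ?S (subst_comp t i u) * (total_variation (cond_density f i t) * ennreal ?r)"
        by (rule mult_left_mono) simp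
    qed
    also have "\<dots> = ennreal C * (total_variation (cond_density f i t) * marginal_density f i t)"
      by (subst nn_integral_multc) (auto simp: len r)
    finally show "(\<integral>\<^sup>+ u. indicator ?S (subst_comp t i u) * ennreal (f (subst_comp t i u)) \<partial>lborel) \<le>
        ennreal C * (total_variation (cond_density f i t) * marginal_density f i t)" .
  qed
  also have "\<dots> \<le> ennreal C * expected_variation M h f"
    unfolding expected_variation_def by (intro mult_left_mono member_le_sum) auto
  finally show ?thesis by (simp add: C_def)
qed

section \<open>Volumes of cubes and averaging over translates\<close>

lemma emeasure_cbox_vec:
  assumes "0 \<le> r"
  shows "emeasure lborel (cbox 0 (\<chi> i. r) :: (real^'m) set) = ennreal (r ^ CARD('m))"
    and "emeasure lborel (box 0 (\<chi> i. r) :: (real^'m) set) = ennreal (r ^ CARD('m))"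
proof -
  have *: "(\<Prod>b\<in>(Basis :: (real^'m) set). (\<chi> i. r) \<bullet> b) = r ^ CARD('m)"
  proof -
    have "(\<Prod>b\<in>(Basis :: (real^'m) set). (\<chi> i. r) \<bullet> b) = (\<Prod>b\<in>(Basis :: (real^'m) set). r)"
      by (rule prod.cong) (auto simp: Basis_vec_def inner_axis)
    then show ?thesis by simp
  qed
  have ge: "\<And>b. b \<in> (Basis :: (real^'m) set) \<Longrightarrow> 0 \<bullet> b \<le> (\<chi> i. r) \<bullet> b"
    using assms by (auto simp: Basis_vec_def inner_axis)
  show "emeasure lborel (cbox 0 (\<chi> i. r) :: (real^'m) set) = ennreal (r ^ CARD('m))"
    using emeasure_lborel_cbox[OF ge] * by simp
  show "emeasure lborel (box 0 (\<chi> i. r) :: (real^'m) set) = ennreal (r ^ CARD('m))"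
    using emeasure_lborel_box[OF ge] * by simp
qed

lemma half_open_cube_between:
  "box 0 (\<chi> i. r) \<subseteq> half_open_cube 0 r" "half_open_cube 0 r \<subseteq> cbox 0 (\<chi> i. r)"
  by (auto simp: half_open_cube_def mem_box_cart less_imp_le)

lemma AE_half_open_cube:
  assumes "0 \<le> r"
  shows "AE x in lborel. x \<in> half_open_cube 0 r \<longleftrightarrow> x \<in> cbox 0 (\<chi> i. r)"
proof -
  have "emeasure lborel (cbox 0 (\<chi> i. r) - box 0 (\<chi> i. r) :: (real^'m) set) = 0"
    using emeasure_cbox_vec[OF assms, where 'm='m] box_subset_cbox
    by (subst emeasure_Diff) auto
  then have "AE x in lborel. x \<notin> cbox 0 (\<chi> i. r) - (box 0 (\<chi> i. r) :: (real^'m) set)"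
    by (intro AE_not_in null_setsI) auto
  then show ?thesis
    by eventually_elim (use half_open_cube_between in blast)
qed

lemma emeasure_half_open_cube:
  assumes "0 \<le> r"
  shows "emeasure lborel (half_open_cube 0 r :: (real^'m) set) = ennreal (r ^ CARD('m))"
proof -
  have "emeasure lborel (half_open_cube 0 r :: (real^'m) set) = emeasure lborel (cbox 0 (\<chi> i. r) :: (real^'m) set)"
    by (rule emeasure_eq_AE[OF AE_half_open_cube[OF assms]]) auto
  then show ?thesis using emeasure_cbox_vec[OF assms, where 'm='m] by simp
qed

lemma integral_lborel_translate:
  fixes K :: "'a::euclidean_space \<Rightarrow> real"
  assumes [measurable]: "K \<in> borel_measurable borel"
  shows "(LINT x|lborel. K (x + c)) = (LINT x|lborel. K x)"
proof -
  have "(LINT x|lborel. K x) = (LINT x|distr lborel borel ((+) c). K x)"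
    by (simp add: lborel_distr_plus)
  also have "\<dots> = (LINT x|lborel. K (x + c))"
    by (subst integral_distr) (auto simp: add.commute)
  finally show ?thesis ..
qed

lemma integrable_density_mult:
  fixes f g :: "'a::euclidean_space \<Rightarrow> real"
  assumes [measurable]: "f \<in> borel_measurable borel" "g \<in> borel_measurable borel"
    and f: "\<And>t. 0 \<le> f t" "(\<integral>\<^sup>+ t. ennreal (f t) \<partial>lborel) < \<infinity>" and g: "\<And>t. \<bar>g t\<bar> \<le> B"
  shows "integrable lborel (\<lambda>t. f t * g t)"
proof (rule Bochner_Integration.integrable_bound)
  have "integrable lborel f" using f by (intro integrableI_nonneg) auto
  then show "integrable lborel (\<lambda>t. f t * B)" by simp
  have "\<bar>f t * g t\<bar> \<le> \<bar>f t * B\<bar>" for t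
    using g[of t] f(1)[of t] by (auto simp: abs_mult intro!: mult_left_mono)
  then show "AE t in lborel. norm (f t * g t) \<le> norm (f t * B)" by simp
qed measurable

text \<open>Averaging \<open>g\<close> over translates moves the translation to the density.\<close>

lemma integral_mean_zero_le:
  fixes f g :: "real^'m \<Rightarrow> real"
  assumes [measurable]: "f \<in> borel_measurable borel" "g \<in> borel_measurable borel" "H \<in> sets borel"
    and f: "\<And>t. 0 \<le> f t" "(\<integral>\<^sup>+ t. ennreal (f t) \<partial>lborel) = 1"
    and g: "\<And>t. \<bar>g t\<bar> \<le> B" and P: "0 < P"
    and zero: "\<And>s. s \<notin> H \<Longrightarrow> (LINT u|lborel. indicator (half_open_cube 0 P) u * g (s + u)) = 0"
    and \<delta>: "\<And>u. u \<in> half_open_cube 0 P \<Longrightarrow> (\<integral>\<^sup>+ t. ennreal \<bar>f t - f (t - u)\<bar> \<partial>lborel) \<le> \<delta>"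
  shows "ennreal \<bar>LINT t|lborel. f t * g t\<bar> \<le>
    ennreal B * (\<delta> + (\<integral>\<^sup>+ t. indicator H t * ennreal (f t) \<partial>lborel))"
proof -
  let ?C = "half_open_cube 0 P :: (real^'m) set"
  define A where "A = (LINT t|lborel. f t * g t)"
  \<comment> \<open>\<open>\<Phi> u\<close> is the integral after translating \<open>g\<close> by
    \<open>u\<close>, and \<open>A\<close> is the case of no translation. Each
    \<open>\<Phi> u\<close> is close to \<open>A\<close> because the translation can be moved to
    \<open>f\<close>, while the average of \<open>\<Phi>\<close> over the cube sees \<open>g\<close>
    only through its cube means, which vanish off \<open>H\<close>.\<close>
  define \<Phi> where "\<Phi> u = (LINT t|lborel. f t * g (t + u))" for u
  define vol where "vol = P ^ CARD('m)"
  have vol: "0 < vol" "emeasure lborel ?C = ennreal vol"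
    using P by (auto simp: vol_def emeasure_half_open_cube)
  have B: "0 \<le> B" using g[of 0] by linarith
  have fg: "integrable lborel (\<lambda>t. f t * g (t + u))" for u
    by (rule integrable_density_mult) (use f g in auto)
  have f': "(\<integral>\<^sup>+ t. ennreal (f (t - u)) \<partial>lborel) = 1" for u
    using nn_integral_lborel_translate[of "\<lambda>t. ennreal (f t)" "- u"] f(2) by simp
  have fug: "integrable lborel (\<lambda>t. f (t - u) * g t)" for u
    by (rule integrable_density_mult) (use f f' g in auto)
  have diff: "ennreal \<bar>A - \<Phi> u\<bar> \<le> ennreal B * \<delta>" if u: "u \<in> ?C" for u
  proof -
    have "\<Phi> u = (LINT t|lborel. f (t - u) * g t)"
      unfolding \<Phi>_def using integral_lborel_translate[of "\<lambda>t. f (t - u) * g t" u] by simp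
    then have "A - \<Phi> u = (LINT t|lborel. f t * g t - f (t - u) * g t)"
      unfolding A_def using fg[of 0] fug[of u] by simp
    then have "ennreal \<bar>A - \<Phi> u\<bar> \<le> (\<integral>\<^sup>+ t. ennreal \<bar>f t * g t - f (t - u) * g t\<bar> \<partial>lborel)"
      using integral_norm_bound_ennreal[of lborel "\<lambda>t. f t * g t - f (t - u) * g t"] fg[of 0] fug[of u]
      by simp
    also have "\<dots> \<le> (\<integral>\<^sup>+ t. ennreal B * ennreal \<bar>f t - f (t - u)\<bar> \<partial>lborel)"
    proof (rule nn_integral_mono)
      fix t
      have "\<bar>f t * g t - f (t - u) * g t\<bar> = \<bar>g t\<bar> * \<bar>f t - f (t - u)\<bar>"
        by (simp add: left_diff_distrib[symmetric] abs_mult)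
      also have "\<dots> \<le> B * \<bar>f t - f (t - u)\<bar>" using g by (intro mult_right_mono) auto
      finally show "ennreal \<bar>f t * g t - f (t - u) * g t\<bar> \<le> ennreal B * ennreal \<bar>f t - f (t - u)\<bar>"
        using B by (simp add: ennreal_mult[symmetric] ennreal_leI)
    qed
    also have "\<dots> \<le> ennreal B * \<delta>"
      by (subst nn_integral_cmult) (auto intro!: mult_left_mono \<delta> u)
    finally show ?thesis .
  qed
  have prod: "integrable (lborel \<Otimes>\<^sub>M lborel) (\<lambda>(u, t). indicator ?C u * (f t * g (t + u)))"
  proof (rule integrableI_bounded)
    have "(\<integral>\<^sup>+ x. ennreal (norm (case x of (u, t) \<Rightarrow> indicator ?C u * (f t * g (t + u))))
        \<partial>(lborel \<Otimes>\<^sub>M lborel)) =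
        (\<integral>\<^sup>+ u. \<integral>\<^sup>+ t. ennreal (norm (indicator ?C u * (f t * g (t + u)))) \<partial>lborel \<partial>lborel)"
      by (subst lborel.nn_integral_fst[symmetric]) auto
    also have "\<dots> \<le> (\<integral>\<^sup>+ u. \<integral>\<^sup>+ t. (ennreal B * indicator ?C u) * ennreal (f t) \<partial>lborel \<partial>lborel)"
    proof (intro nn_integral_mono)
      fix u t
      have "norm (indicator ?C u * (f t * g (t + u))) \<le> B * indicator ?C u * f t"
        using g[of "t + u"] f(1)[of t] mult_left_mono[OF g[of "t + u"] f(1)[of t]]
        by (auto simp: indicator_def abs_mult mult.commute)
      then have "ennreal (norm (indicator ?C u * (f t * g (t + u)))) \<le> ennreal (B * indicator ?C u * f t)"
        by (rule ennreal_leI)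
      then show "ennreal (norm (indicator ?C u * (f t * g (t + u)))) \<le> (ennreal B * indicator ?C u) * ennreal (f t)"
        using B f(1)[of t] by (simp add: ennreal_mult ennreal_indicator)
    qed
    also have "\<dots> = ennreal B * ennreal vol"
      by (simp add: nn_integral_cmult f(2) vol(2))
    finally show "(\<integral>\<^sup>+ x. ennreal (norm (case x of (u, t) \<Rightarrow> indicator ?C u * (f t * g (t + u))))
        \<partial>(lborel \<Otimes>\<^sub>M lborel)) < \<infinity>"
      by (simp add: ennreal_mult_less_top le_less_trans)
  qed measurable
  have \<Phi>_int: "integrable lborel (\<lambda>u. indicator ?C u * \<Phi> u)"
    using lborel_pair.integrable_fst[OF prod] by (simp add: \<Phi>_def)
  have "(LINT u|lborel. indicator ?C u * \<Phi> u) =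
      (LINT t|lborel. LINT u|lborel. indicator ?C u * (f t * g (t + u)))"
    using lborel_pair.Fubini_integral[of "\<lambda>u t. indicator ?C u * (f t * g (t + u))"] prod
    by (simp add: \<Phi>_def)
  also have "\<dots> = (LINT t|lborel. f t * (LINT u|lborel. indicator ?C u * g (t + u)))"
    by (intro Bochner_Integration.integral_cong refl) (simp add: mult.left_commute)
  finally have \<Phi>_eq: "(LINT u|lborel. indicator ?C u * \<Phi> u) =
      (LINT t|lborel. f t * (LINT u|lborel. indicator ?C u * g (t + u)))" .
  have mean: "\<bar>LINT u|lborel. indicator ?C u * g (t + u)\<bar> \<le> B * vol * indicator H t" for t
  proof (cases "t \<in> H")
    case True
    have "integrable lborel (\<lambda>u. indicator ?C u * B)"
      using vol by (intro integrable_mult_left) (simp add: integrable_indicator_iff)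
    then have "\<bar>LINT u|lborel. indicator ?C u * g (t + u)\<bar> \<le> (LINT u|lborel. indicator ?C u * B)"
    proof -
      assume int: "integrable lborel (\<lambda>u. indicator ?C u * B)"
      have "integrable lborel (\<lambda>u. indicator ?C u * g (t + u))"
        by (rule Bochner_Integration.integrable_bound[OF int]) (use g B in \<open>auto simp: indicator_def\<close>)
      from Bochner_Integration.integral_norm_bound_integral[OF this int]
      show ?thesis using g B by (auto simp: indicator_def)
    qed
    also have "\<dots> = B * vol" using vol by (simp add: measure_def)
    finally show ?thesis using True by simp
  qed (simp add: zero)
  \<comment> \<open>A nonzero Bochner integral can only belong to an integrable function. The case
    distinction that follows thereby provides the integrability behind the norm bound.\<close>
  have mean_int: "(LINT t|lborel. f t * (LINT u|lborel. indicator ?C u * g (t + u))) \<noteq> 0 \<Longrightarrow>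
      integrable lborel (\<lambda>t. f t * (LINT u|lborel. indicator ?C u * g (t + u)))"
    using not_integrable_integral_eq by blast
  have \<Phi>_le: "ennreal \<bar>LINT u|lborel. indicator ?C u * \<Phi> u\<bar> \<le>
      ennreal vol * (ennreal B * (\<integral>\<^sup>+ t. indicator H t * ennreal (f t) \<partial>lborel))"
  proof (cases "(LINT t|lborel. f t * (LINT u|lborel. indicator ?C u * g (t + u))) = 0")
    case False
    have "ennreal \<bar>LINT u|lborel. indicator ?C u * \<Phi> u\<bar> \<le>
        (\<integral>\<^sup>+ t. ennreal \<bar>f t * (LINT u|lborel. indicator ?C u * g (t + u))\<bar> \<partial>lborel)"
      unfolding \<Phi>_eq using integral_norm_bound_ennreal[OF mean_int[OF False]] by simp
    also have "\<dots> \<le> (\<integral>\<^sup>+ t. ennreal (vol * B) * (indicator H t * ennreal (f t)) \<partial>lborel)"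
    proof (rule nn_integral_mono)
      fix t
      have "\<bar>f t * (LINT u|lborel. indicator ?C u * g (t + u))\<bar> \<le> vol * B * (indicator H t * f t)"
        using mult_left_mono[OF mean[of t] f(1)[of t]] f(1)[of t] by (simp add: abs_mult mult_ac)
      then show "ennreal \<bar>f t * (LINT u|lborel. indicator ?C u * g (t + u))\<bar> \<le>
          ennreal (vol * B) * (indicator H t * ennreal (f t))"
        using vol(1) B f(1)[of t]
        by (simp add: ennreal_mult[symmetric] ennreal_indicator[symmetric] ennreal_leI del: ennreal_indicator)
    qed
    also have "\<dots> = ennreal vol * (ennreal B * (\<integral>\<^sup>+ t. indicator H t * ennreal (f t) \<partial>lborel))"
      using vol(1) B by (simp add: nn_integral_cmult ennreal_mult mult.assoc)
    finally show ?thesis .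
  qed (simp add: \<Phi>_eq)
  have "vol * A = (LINT u|lborel. indicator ?C u * (A - \<Phi> u)) + (LINT u|lborel. indicator ?C u * \<Phi> u)"
  proof -
    have "integrable lborel (\<lambda>u. indicator ?C u * A)"
      using vol by (intro integrable_mult_left) (simp add: integrable_indicator_iff)
    moreover have "(LINT u|lborel. indicator ?C u * A) = vol * A" using vol by (simp add: measure_def)
    ultimately show ?thesis using \<Phi>_int by (auto simp: right_diff_distrib)
  qed
  then have "ennreal (vol * \<bar>A\<bar>) \<le> ennreal \<bar>LINT u|lborel. indicator ?C u * (A - \<Phi> u)\<bar> +
      ennreal \<bar>LINT u|lborel. indicator ?C u * \<Phi> u\<bar>"
    using vol(1) abs_mult[of vol A] by (simp flip: ennreal_plus add: ennreal_leI abs_triangle_ineq)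
  also have "\<dots> \<le> ennreal vol * (ennreal B * \<delta>) +
      ennreal vol * (ennreal B * (\<integral>\<^sup>+ t. indicator H t * ennreal (f t) \<partial>lborel))"
  proof (rule add_mono[OF _ \<Phi>_le])
    have "integrable lborel (\<lambda>u. indicator ?C u * (A - \<Phi> u))"
      using \<Phi>_int vol by (simp add: right_diff_distrib integrable_indicator_iff)
    from integral_norm_bound_ennreal[OF this]
    have "ennreal \<bar>LINT u|lborel. indicator ?C u * (A - \<Phi> u)\<bar> \<le>
        (\<integral>\<^sup>+ u. ennreal \<bar>indicator ?C u * (A - \<Phi> u)\<bar> \<partial>lborel)" by simp
    also have "\<dots> \<le> (\<integral>\<^sup>+ u. indicator ?C u * (ennreal B * \<delta>) \<partial>lborel)"
      by (intro nn_integral_mono) (auto simp: indicator_def diff)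
    also have "\<dots> = ennreal vol * (ennreal B * \<delta>)"
      by (simp add: nn_integral_multc vol(2))
    finally show "ennreal \<bar>LINT u|lborel. indicator ?C u * (A - \<Phi> u)\<bar> \<le> ennreal vol * (ennreal B * \<delta>)" .
  qed
  also have "\<dots> = ennreal vol * (ennreal B * (\<delta> + (\<integral>\<^sup>+ t. indicator H t * ennreal (f t) \<partial>lborel)))"
    by (simp add: distrib_left)
  finally show ?thesis
    unfolding A_def[symmetric] using vol(1)
    by (simp add: ennreal_mult ennreal_mult_le_mult_iff)
qed

section \<open>Error bounds\<close>

context integral_recourse
begin

text \<open>The common period is a multiple of the period of \<open>b\<close>, so a cube of this
  side at any position reproduces the mean over the basic cube. As \<open>psi\<close> is
  nonnegative, the calculation can be done with nonnegative integrals.\<close>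

lemma psi_cube_integral:
  assumes b: "b \<in> dual_feasible W q"
  shows "(LINT u|lborel. indicator (half_open_cube 0 common_period) u * psi W I q b (s + u)) =
    common_period ^ CARD('m) * Gamma_mean W I q b"
proof -
  note bb = dual_feasible_bases[OF b]
  note psi0 = psi_bounds(1)[OF b]
  let ?p = "period W b" and ?P = common_period
  have p: "0 < ?p" by (rule period_pos[OF bb])
  obtain n :: nat where n: "0 < n" "?P = real n * ?p" using common_period_multiple[OF bb] by blast
  let ?F = "\<lambda>x. ennreal (psi W I q b x)"
  have ind: "ennreal (indicator A x * psi W I q b y) = indicator A x * ?F y" for A and x y :: "real^'m"
    by (simp add: indicator_def)
  have "(\<integral>\<^sup>+ u. indicator (half_open_cube 0 ?P) u * ?F (s + u) \<partial>lborel) =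
      (\<integral>\<^sup>+ u. indicator (half_open_cube s ?P) (u + s) * ?F (u + s) \<partial>lborel)"
    by (intro nn_integral_cong) (auto simp: half_open_cube_def indicator_def add.commute)
  also have "\<dots> = (\<integral>\<^sup>+ u. indicator (half_open_cube s ?P) u * ?F u \<partial>lborel)"
    by (rule nn_integral_lborel_translate) measurable
  also have "\<dots> = of_nat (n ^ CARD('m)) * (\<integral>\<^sup>+ u. indicator (half_open_cube 0 ?p) u * ?F u \<partial>lborel)"
    unfolding n(2) using psi_period[OF b]
    by (intro nn_integral_periodic_cube p n) (auto simp: int_vec_def)
  also have "(\<integral>\<^sup>+ u. indicator (half_open_cube 0 ?p) u * ?F u \<partial>lborel) =
      (\<integral>\<^sup>+ u. indicator (cbox 0 (\<chi> i. ?p)) u * ?F u \<partial>lborel)"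
  proof (rule nn_integral_cong_AE)
    have "AE x :: real^'m in lborel. x \<in> half_open_cube 0 ?p \<longleftrightarrow> x \<in> cbox 0 (\<chi> i. ?p)"
      using p by (intro AE_half_open_cube) simp
    then show "AE u :: real^'m in lborel. indicator (half_open_cube 0 ?p) u * ?F u =
        indicator (cbox 0 (\<chi> i. ?p)) u * ?F u"
      by eventually_elim (simp add: indicator_def)
  qed
  finally have nn: "(\<integral>\<^sup>+ u. indicator (half_open_cube 0 ?P) u * ?F (s + u) \<partial>lborel) =
      of_nat (n ^ CARD('m)) * (\<integral>\<^sup>+ u. indicator (cbox 0 (\<chi> i. ?p)) u * ?F u \<partial>lborel)" .
  have "(LINT u|lborel. indicator (half_open_cube 0 ?P) u * psi W I q b (s + u)) =
      enn2real (\<integral>\<^sup>+ u. indicator (half_open_cube 0 ?P) u * ?F (s + u) \<partial>lborel)"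
    by (subst integral_eq_nn_integral) (auto simp: ind psi0)
  also have "\<dots> = real n ^ CARD('m) *
      enn2real (\<integral>\<^sup>+ u. indicator (cbox 0 (\<chi> i. ?p)) u * ?F u \<partial>lborel)"
    unfolding nn enn2real_mult by (simp add: ennreal_of_nat_eq_real_of_nat)
  also have "enn2real (\<integral>\<^sup>+ u. indicator (cbox 0 (\<chi> i. ?p)) u * ?F u \<partial>lborel) =
      (LINT s : cbox 0 (\<chi> i. ?p) | lborel. psi W I q b s)"
    unfolding set_lebesgue_integral_def real_scaleR_def
    by (subst integral_eq_nn_integral) (auto simp: ind psi0)
  also have "\<dots> = ?p ^ CARD('m) * Gamma_mean W I q b"
    using p by (simp add: Gamma_mean_def)
  finally show ?thesis by (simp add: n(2) power_mult_distrib)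
qed

lemma common_cube_measure: "measure lborel (half_open_cube 0 common_period :: (real^'m) set) = common_period ^ CARD('m)"
  "emeasure lborel (half_open_cube 0 common_period :: (real^'m) set) < \<infinity>"
  using emeasure_half_open_cube[of common_period, where 'm='m] common_period_pos
  by (auto simp: measure_def less_imp_le)

lemma cube_integrable:
  fixes F :: "real^'m \<Rightarrow> real"
  assumes [measurable]: "F \<in> borel_measurable borel" and "\<And>s. 0 \<le> F s \<and> F s \<le> B"
  shows "integrable lborel (\<lambda>u. indicator (half_open_cube 0 common_period) u * F u)"
proof (rule Bochner_Integration.integrable_bound)
  show "integrable lborel (\<lambda>u :: real^'m. indicator (half_open_cube 0 common_period) u * B)"
    using common_cube_measure by (intro integrable_mult_left) (simp add: integrable_indicator_iff)
  show "AE u in lborel. norm (indicator (half_open_cube 0 common_period) u * F u) \<le>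
      norm (indicator (half_open_cube 0 common_period) u * B)"
    using assms(2) order_trans by (intro AE_I2) (fastforce simp: indicator_def)
qed measurable

lemma cube_integral_mono:
  fixes F G :: "real^'m \<Rightarrow> real"
  assumes [measurable]: "F \<in> borel_measurable borel" "G \<in> borel_measurable borel"
    and "\<And>s. 0 \<le> F s \<and> F s \<le> G s \<and> G s \<le> B"
  shows "(LINT u|lborel. indicator (half_open_cube 0 common_period) u * F u) \<le>
    (LINT u|lborel. indicator (half_open_cube 0 common_period) u * G u)"
  using assms(3) order_trans
  by (intro integral_mono cube_integrable[where B=B]) (auto simp: indicator_def intro: order_trans)

lemma cube_integral_const:
  "(LINT u|lborel. indicator (half_open_cube 0 common_period :: (real^'m) set) u * c) =
    common_period ^ CARD('m) * c"
  using common_cube_measure by simp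

lemma Gamma_bounds:
  assumes b: "b \<in> dual_feasible W q"
  shows "0 \<le> Gamma_mean W I q b" "Gamma_mean W I q b \<le> gap_bound * norm_1 q"
proof -
  let ?R = "gap_bound * norm_1 q"
  have P: "0 < common_period ^ CARD('m)" using common_period_pos by simp
  have "0 \<le> common_period ^ CARD('m) * Gamma_mean W I q b"
    unfolding psi_cube_integral[OF b, of 0, symmetric] using psi_bounds[OF b]
    by (intro Bochner_Integration.integral_nonneg) auto
  then show "0 \<le> Gamma_mean W I q b" using P by (simp add: zero_le_mult_iff)
  have "(LINT u|lborel. indicator (half_open_cube 0 common_period) u * psi W I q b (0 + u)) \<le>
      (LINT u|lborel. indicator (half_open_cube 0 common_period :: (real^'m) set) u * ?R)"
    using psi_bounds[OF b] by (intro cube_integral_mono[where B="?R"]) auto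
  then have "common_period ^ CARD('m) * Gamma_mean W I q b \<le> common_period ^ CARD('m) * ?R"
    unfolding psi_cube_integral[OF b] cube_integral_const .
  then show "Gamma_mean W I q b \<le> ?R" using P by (simp add: mult_le_cancel_left)
qed

text \<open>The shift \<open>c\<close> in \<open>psi_dominates\<close> is arbitrary while
  \<open>s\<close> stays fixed. Averaging that inequality over shifts in a period cube replaces both
  \<open>psi\<close> terms by their means.\<close>

lemma Gamma_dominates:
  assumes j: "j \<in> dual_feasible W q" and k: "k \<in> dual_feasible W q"
    and deep: "\<And>i. depth + common_period \<le> basic_coords W k s $ i"
  shows "Gamma_mean W I q j + dual_mult W q j \<bullet> s \<le> Gamma_mean W I q k + dual_mult W q k \<bullet> s"
proof -
  let ?C = "half_open_cube 0 common_period :: (real^'m) set"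
  let ?d = "dual_mult W q k \<bullet> s - dual_mult W q j \<bullet> s"
  have P: "0 < common_period ^ CARD('m)" using common_period_pos by simp
  have int: "integrable lborel (\<lambda>u. indicator ?C u * psi W I q b (s + u))" if "b \<in> dual_feasible W q" for b
    using psi_bounds[OF that] by (intro cube_integrable[where B="gap_bound * norm_1 q"]) auto
  have int': "integrable lborel (\<lambda>u. indicator ?C u * ?d)"
    using common_cube_measure by (intro integrable_mult_left) (simp add: integrable_indicator_iff)
  have "(LINT u|lborel. indicator ?C u * psi W I q j (s + u)) \<le>
      (LINT u|lborel. indicator ?C u * psi W I q k (s + u) + indicator ?C u * ?d)"
    using psi_dominates[OF j k deep]
    by (intro integral_mono int j k Bochner_Integration.integrable_add int')
       (auto simp: indicator_def algebra_simps)
  also have "\<dots> = (LINT u|lborel. indicator ?C u * psi W I q k (s + u)) + (LINT u|lborel. indicator ?C u * ?d)"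
    by (intro Bochner_Integration.integral_add int k int')
  finally have "common_period ^ CARD('m) * Gamma_mean W I q j \<le>
      common_period ^ CARD('m) * (Gamma_mean W I q k + ?d)"
    unfolding psi_cube_integral[OF j] psi_cube_integral[OF k] cube_integral_const
    by (simp add: distrib_left)
  then show ?thesis using P by (simp add: mult_le_cancel_left)
qed

text \<open>The first two summands are the depth at which one basis dominates all others. The last
  absorbs the change of basic coordinates inside a period cube, so that the depth is kept on the
  whole cube \<open>s + u\<close>.\<close>

definition slab_width :: real where
  "slab_width = depth + common_period + coord_bound * (real CARD('m) * common_period)"

definition coord_row :: "('m \<Rightarrow> 'n) \<times> 'm \<Rightarrow> real^'m" where
  "coord_row k = row (snd k) (matrix_inv (basis_mat W (fst k)))"

definition slabs :: "(real^'m) set" where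
  "slabs = (\<Union>k\<in>bases \<times> UNIV. {s. \<bar>coord_row k \<bullet> s\<bar> \<le> slab_width})"

text \<open>The choice picks an axis not parallel to the slab; each quotient is the length of the
  interval in which a line along that axis meets it.\<close>

definition slab_const :: real where
  "slab_const = (\<Sum>k\<in>bases \<times> UNIV. 2 * slab_width / \<bar>coord_row k $ (SOME j. coord_row k $ j \<noteq> 0)\<bar>)"

text \<open>The factor \<open>gap_bound\<close> comes from the supremum of the error. In the
  bracket, \<open>common_period\<close> accounts for the translations of the density and
  \<open>slab_const\<close> for the mass on the slabs.\<close>

definition error_const :: real where
  "error_const = gap_bound * (common_period + slab_const)"

lemma slab_width_pos: "0 < slab_width"
  unfolding slab_width_def
  using depth_nonneg common_period_pos coord_bound_nonneg
  by (intro add_pos_nonneg add_nonneg_pos mult_nonneg_nonneg) auto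

lemma slab_const_nonneg: "0 \<le> slab_const"
  unfolding slab_const_def using slab_width_pos by (intro sum_nonneg) auto

lemma error_const_pos: "0 < error_const"
  unfolding error_const_def using gap_bound_pos common_period_pos slab_const_nonneg
  by (intro mult_pos_pos) auto

lemma slabs_measurable [measurable]: "slabs \<in> sets borel"
  unfolding slabs_def
  by (intro sets.finite_UN borel_closed closed_Collect_le continuous_intros) auto

lemma nn_integral_slabs_le:
  assumes f: "f \<in> bv_densities" and h: "distributed M lborel h (\<lambda>t. ennreal (f t))"
  shows "(\<integral>\<^sup>+ t. indicator {t. t - z \<in> slabs} t * ennreal (f t) \<partial>lborel) \<le>
    ennreal slab_const * expected_variation M h f"
proof -
  have [measurable]: "f \<in> borel_measurable borel" using f by (auto simp: bv_densities_def)
  let ?S = "\<lambda>k. {t. \<bar>coord_row k \<bullet> (t - z)\<bar> \<le> slab_width}"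
  let ?K = "bases \<times> (UNIV :: 'm set)"
  let ?c = "\<lambda>k. 2 * slab_width / \<bar>coord_row k $ (SOME j. coord_row k $ j \<noteq> 0)\<bar>"
  have [measurable]: "?S k \<in> sets borel" for k
    by (intro borel_closed closed_Collect_le continuous_intros)
  have "(\<integral>\<^sup>+ t. indicator {t. t - z \<in> slabs} t * ennreal (f t) \<partial>lborel) \<le>
      (\<integral>\<^sup>+ t. (\<Sum>k\<in>?K. indicator (?S k) t * ennreal (f t)) \<partial>lborel)"
  proof (rule nn_integral_mono)
    fix t
    show "indicator {t. t - z \<in> slabs} t * ennreal (f t) \<le> (\<Sum>k\<in>?K. indicator (?S k) t * ennreal (f t))"
    proof (cases "t - z \<in> slabs")
      case True
      then obtain k where k: "k \<in> ?K" "t \<in> ?S k" by (auto simp: slabs_def)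
      have "indicator (?S k) t * ennreal (f t) \<le> (\<Sum>k\<in>?K. indicator (?S k) t * ennreal (f t))"
        by (rule member_le_sum[OF k(1)]) auto
      then show ?thesis using True k(2) by simp
    qed simp
  qed
  also have "\<dots> = (\<Sum>k\<in>?K. \<integral>\<^sup>+ t. indicator (?S k) t * ennreal (f t) \<partial>lborel)"
    by (rule nn_integral_sum) measurable
  also have "\<dots> \<le> (\<Sum>k\<in>?K. ennreal (?c k) * expected_variation M h f)"
  proof (rule sum_mono)
    fix k assume k: "k \<in> ?K"
    then have "coord_row k \<noteq> 0"
      using row_inverse_nonzero[of W "fst k" "snd k"] by (auto simp: coord_row_def bases_def)
    then have "\<exists>j. coord_row k $ j \<noteq> 0" by (auto simp: vec_eq_iff)
    then have "coord_row k $ (SOME j. coord_row k $ j \<noteq> 0) \<noteq> 0" by (rule someI_ex)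
    then show "(\<integral>\<^sup>+ t. indicator (?S k) t * ennreal (f t) \<partial>lborel) \<le> ennreal (?c k) * expected_variation M h f"
      by (rule nn_integral_slab_le[OF f h _ slab_width_pos])
  qed
  also have "\<dots> = ennreal slab_const * expected_variation M h f"
    unfolding slab_const_def using slab_width_pos
    by (simp add: sum_distrib_right[symmetric] sum_ennreal)
  finally show ?thesis .
qed

text \<open>The three hypotheses on \<open>\<phi>\<close> are what the two approximations share: the
  bounds of \<open>psi\<close>, the same mean over period cubes, and domination by the basis in
  whose cone \<open>s\<close> lies deep. The shift \<open>z\<close> only translates the slabs, so
  the final bound does not depend on it.\<close>

lemma max_approximation_error:
  fixes \<phi> :: "('m \<Rightarrow> 'n) \<Rightarrow> real^'m \<Rightarrow> real"
  assumes fin: "\<And>s. - \<infinity> < value_fun W I q s \<and> value_fun W I q s < \<infinity>"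
    and [measurable]: "\<And>b. \<phi> b \<in> borel_measurable borel"
    and \<phi>: "\<And>b s. b \<in> dual_feasible W q \<Longrightarrow> 0 \<le> \<phi> b s \<and> \<phi> b s \<le> gap_bound * norm_1 q"
    and mean: "\<And>b s. b \<in> dual_feasible W q \<Longrightarrow>
      (LINT u|lborel. indicator (half_open_cube 0 common_period) u * \<phi> b (s + u)) =
        common_period ^ CARD('m) * Gamma_mean W I q b"
    and dom: "\<And>j k s. j \<in> dual_feasible W q \<Longrightarrow> k \<in> dual_feasible W q \<Longrightarrow>
      (\<And>i. depth + common_period \<le> basic_coords W k s $ i) \<Longrightarrow>
      \<phi> j s + dual_mult W q j \<bullet> s \<le> \<phi> k s + dual_mult W q k \<bullet> s"
    and f: "f \<in> bv_densities" and h: "distributed M lborel h (\<lambda>t. ennreal (f t))"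
  defines "g s \<equiv> real_of_ereal (value_fun W I q s) -
      Max ((\<lambda>b. dual_mult W q b \<bullet> s + \<phi> b s) ` dual_feasible W q)"
  shows "\<bar>g s\<bar> \<le> gap_bound * norm_1 q"
    and "ennreal \<bar>LINT t|lborel. f t * g (t - z)\<bar> \<le>
      ennreal error_const * ennreal (norm_1 q) * expected_variation M h f"
proof -
  let ?D = "dual_feasible W q" and ?R = "gap_bound * norm_1 q"
  let ?C = "half_open_cube 0 common_period :: (real^'m) set"
  have [measurable]: "f \<in> borel_measurable borel" and f0: "\<And>t. 0 \<le> f t"
    and f1: "(\<integral>\<^sup>+ t. ennreal (f t) \<partial>lborel) = 1"
    using f by (auto simp: bv_densities_def)
  note finD = finite_dual_feasible[of W q]
  have opt: "\<exists>b\<in>?D. \<forall>i. 0 \<le> basic_coords W b s $ i" for s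
    using fin by (intro optimal_basis W_onto no_improving_ray) auto
  then have D_ne: "?D \<noteq> {}" by blast
  have val: "value_fun W I q s = ereal (real_of_ereal (value_fun W I q s))" for s
    using fin[of s] by (cases "value_fun W I q s") auto
  have lower: "dual_mult W q b \<bullet> s \<le> real_of_ereal (value_fun W I q s)" if "b \<in> ?D" for b s
    using order_trans[OF gomory_ge[OF that] gomory_le_value, of s] val[of s] by (metis ereal_less_eq(3))
  have upper: "real_of_ereal (value_fun W I q s) \<le> dual_mult W q b \<bullet> s + ?R"
    if b: "b \<in> ?D" and nn: "\<forall>i. 0 \<le> basic_coords W b s $ i" for b s
  proof -
    obtain y where y: "W *v y = s" "\<forall>j\<in>I. y $ j \<in> \<int>" "\<forall>j. 0 \<le> y $ j"
      "q \<bullet> y \<le> dual_mult W q b \<bullet> s + ?R"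
      using rounded_solution[OF dual_feasible_bases[OF b], of s q] nn by blast
    have "value_fun W I q s \<le> ereal (q \<bullet> y)"
      unfolding value_fun_def using y by (intro milp_value_le) auto
    then show ?thesis using y(4) val[of s] by (metis ereal_less_eq(3) order_trans)
  qed
  \<comment> \<open>A basis attaining the maximum gives a lower bound of the value that falls short
    of the maximum by at most \<open>?R\<close>. An optimal basis at \<open>s\<close> gives an upper
    bound of the value that exceeds the maximum by at most \<open>?R\<close>.\<close>
  have bound: "\<bar>g s\<bar> \<le> ?R" for s
  proof -
    let ?A = "(\<lambda>b. dual_mult W q b \<bullet> s + \<phi> b s) ` ?D"
    have "Max ?A \<in> ?A" using finD D_ne by (intro Max_in) auto
    then obtain b where b: "b \<in> ?D" "Max ?A = dual_mult W q b \<bullet> s + \<phi> b s" by auto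
    obtain k where k: "k \<in> ?D" "\<forall>i. 0 \<le> basic_coords W k s $ i" using opt by blast
    have "dual_mult W q k \<bullet> s + \<phi> k s \<le> Max ?A" using finD k by (intro Max_ge) auto
    then show ?thesis
      using b lower[OF b(1), of s] \<phi>[OF b(1), of s] \<phi>[OF k(1), of s] upper[OF k]
      unfolding g_def by linarith
  qed
  then show "\<bar>g s\<bar> \<le> ?R" .
  have [measurable]: "g \<in> borel_measurable borel"
    unfolding g_def[abs_def] using finD by measurable
  have zero: "(LINT u|lborel. indicator ?C u * g (s + u)) = 0" if s: "s \<notin> slabs" for s
  proof -
    obtain k where k: "k \<in> ?D" "\<forall>i. 0 \<le> basic_coords W k s $ i" using opt by blast
    note kb = dual_feasible_bases[OF k(1)]
    \<comment> \<open>Outside the slabs no basic coordinate has small modulus; nonnegative ones are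
      therefore large.\<close>
    have far: "slab_width \<le> basic_coords W k s $ i" for i
    proof -
      have "\<not> \<bar>coord_row (k, i) \<bullet> s\<bar> \<le> slab_width" using s kb by (auto simp: slabs_def)
      then show ?thesis using k(2) by (simp add: coord_row_def basic_coords_component)
    qed
    have near: "depth + common_period \<le> basic_coords W k (s + u) $ i" if u: "u \<in> ?C" for u i
    proof -
      have "norm u \<le> real CARD('m) * common_period"
        using u common_period_pos by (intro norm_le_card_mult) (auto simp: half_open_cube_def less_imp_le)
      then have "coord_bound * norm u \<le> coord_bound * (real CARD('m) * common_period)"
        by (intro mult_left_mono coord_bound_nonneg)
      then show ?thesis
        using far[of i] coord_bound[of k u i] by (simp add: slab_width_def basic_coords_add)
    qed
    \<comment> \<open>The same basis \<open>k\<close> determines the value and attains the maximum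
      throughout the cube, so the linear terms cancel and only a difference of functions with equal
      means is left.\<close>
    have eq: "g (s + u) = psi W I q k (s + u) - \<phi> k (s + u)" if u: "u \<in> ?C" for u
    proof -
      have "Max ((\<lambda>b. dual_mult W q b \<bullet> (s + u) + \<phi> b (s + u)) ` ?D) =
          dual_mult W q k \<bullet> (s + u) + \<phi> k (s + u)"
        using finD k(1) dom[OF _ k(1) near[OF u]] by (intro Max_eqI) (auto simp: add.commute)
      moreover have "value_fun W I q (s + u) = gomory_value W I q k (s + u)"
        using near[OF u] common_period_pos by (intro value_eq_gomory k(1)) (smt (verit))
      ultimately show ?thesis unfolding g_def by (simp add: gomory_eq[OF k(1)])
    qed
    have "(LINT u|lborel. indicator ?C u * g (s + u)) =
        (LINT u|lborel. indicator ?C u * psi W I q k (s + u) - indicator ?C u * \<phi> k (s + u))"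
      by (intro Bochner_Integration.integral_cong refl) (simp add: indicator_def eq)
    also have "\<dots> = (LINT u|lborel. indicator ?C u * psi W I q k (s + u)) -
        (LINT u|lborel. indicator ?C u * \<phi> k (s + u))"
      using psi_bounds[OF k(1)] \<phi>[OF k(1)]
      by (intro Bochner_Integration.integral_diff cube_integrable[where B="?R"]) auto
    also have "\<dots> = 0" by (simp add: psi_cube_integral[OF k(1)] mean[OF k(1)])
    finally show ?thesis .
  qed
  have "ennreal \<bar>LINT t|lborel. f t * g (t - z)\<bar> \<le> ennreal ?R *
      (ennreal common_period * expected_variation M h f +
        (\<integral>\<^sup>+ t. indicator {t. t - z \<in> slabs} t * ennreal (f t) \<partial>lborel))"
  proof (rule integral_mean_zero_le[OF _ _ _ f0 f1 bound common_period_pos])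
    fix s assume "s \<notin> {t. t - z \<in> slabs}"
    then show "(LINT u|lborel. indicator ?C u * g (s + u - z)) = 0"
      using zero[of "s - z"] by (simp add: algebra_simps)
  next
    fix u assume u: "u \<in> ?C"
    then show "(\<integral>\<^sup>+ t. ennreal \<bar>f t - f (t - u)\<bar> \<partial>lborel) \<le> ennreal common_period * expected_variation M h f"
      by (intro nn_integral_diff_translate_vec_le[OF f h common_period_pos])
         (auto simp: half_open_cube_def less_imp_le)
  qed measurable
  also have "\<dots> \<le> ennreal ?R *
      (ennreal common_period * expected_variation M h f + ennreal slab_const * expected_variation M h f)"
    by (intro mult_left_mono add_left_mono nn_integral_slabs_le[OF f h]) auto
  also have "\<dots> = ennreal error_const * ennreal (norm_1 q) * expected_variation M h f"
    using gap_bound_pos common_period_pos slab_const_nonneg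
    by (simp add: error_const_def ennreal_mult ennreal_plus distrib_left distrib_right mult_ac)
  finally show "ennreal \<bar>LINT t|lborel. f t * g (t - z)\<bar> \<le>
      ennreal error_const * ennreal (norm_1 q) * expected_variation M h f" .
qed

end

section \<open>Independence and passage to expected costs\<close>

lemma indep_rvs_distr_pair:
  fixes X :: "'w \<Rightarrow> 'a::second_countable_topology" and Y :: "'w \<Rightarrow> 'b::second_countable_topology"
  assumes "prob_space M" and ind: "indep_rvs M X Y"
    and [measurable]: "X \<in> borel_measurable M" "Y \<in> borel_measurable M"
  shows "distr M borel X \<Otimes>\<^sub>M distr M borel Y = distr M (borel \<Otimes>\<^sub>M borel) (\<lambda>\<omega>. (X \<omega>, Y \<omega>))"
proof (rule pair_measure_eqI)
  interpret prob_space M by fact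
  show "sigma_finite_measure (distr M borel X)" "sigma_finite_measure (distr M borel Y)"
    by (simp_all add: prob_space_distr prob_space_imp_sigma_finite)
  show "sets (distr M borel X \<Otimes>\<^sub>M distr M borel Y) =
      sets (distr M (borel \<Otimes>\<^sub>M borel) (\<lambda>\<omega>. (X \<omega>, Y \<omega>)))"
    by (simp cong: sets_pair_measure_cong)
  fix A B assume "A \<in> sets (distr M borel X)" "B \<in> sets (distr M borel Y)"
  then have [measurable]: "A \<in> sets borel" "B \<in> sets borel" by auto
  have "prob ((X -` A \<inter> space M) \<inter> (Y -` B \<inter> space M)) =
      prob (X -` A \<inter> space M) * prob (Y -` B \<inter> space M)"
    using ind unfolding indep_rvs_def by (rule indep_setD) auto
  moreover have "(\<lambda>\<omega>. (X \<omega>, Y \<omega>)) -` (A \<times> B) \<inter> space M =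
      (X -` A \<inter> space M) \<inter> (Y -` B \<inter> space M)" by auto
  ultimately show "emeasure (distr M borel X) A * emeasure (distr M borel Y) B =
      emeasure (distr M (borel \<Otimes>\<^sub>M borel) (\<lambda>\<omega>. (X \<omega>, Y \<omega>))) (A \<times> B)"
    by (simp add: emeasure_distr emeasure_eq_measure ennreal_mult[symmetric])
qed

text \<open>By independence the expectation is an iterated integral. The inner one, against the
  density of \<open>h\<close>, is bounded uniformly in the value of \<open>X\<close>, and averaging
  with a probability measure keeps the bound.\<close>

lemma integral_indep_le:
  fixes X :: "'w \<Rightarrow> 'a::second_countable_topology" and h :: "'w \<Rightarrow> real^'m"
  assumes M: "prob_space M" and ind: "indep_rvs M X h"
    and X [measurable]: "X \<in> borel_measurable M"
    and h: "distributed M lborel h (\<lambda>t. ennreal (f t))"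
    and f: "f \<in> borel_measurable borel" "\<And>t. 0 \<le> f t"
    and G [measurable]: "case_prod G \<in> borel_measurable (borel \<Otimes>\<^sub>M borel)"
    and bounded: "\<And>x t. \<bar>G x t\<bar> \<le> B"
    and le: "\<And>x. ennreal \<bar>LINT t|lborel. f t * G x t\<bar> \<le> C"
  shows "ennreal \<bar>LINT \<omega>|M. G (X \<omega>) (h \<omega>)\<bar> \<le> C"
proof -
  interpret prob_space M by fact
  have [measurable]: "h \<in> borel_measurable M" using distributed_measurable[OF h] by simp
  let ?X = "distr M borel X" and ?h = "distr M borel h"
  interpret X: prob_space ?X by (rule prob_space_distr) measurable
  interpret h: prob_space ?h by (rule prob_space_distr) measurable
  interpret Xh: pair_prob_space ?X ?h ..
  have [measurable]: "G x \<in> borel_measurable borel" for x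
    using measurable_Pair2[OF G, of x] by simp
  have G' [measurable]: "case_prod G \<in> borel_measurable (?X \<Otimes>\<^sub>M ?h)"
    using G by (simp cong: measurable_cong_sets sets_pair_measure_cong)
  have int: "integrable (?X \<Otimes>\<^sub>M ?h) (case_prod G)"
    by (rule Xh.integrable_const_bound[of _ B]) (auto simp: bounded)
  have inner: "(LINT t|?h. G x t) = (LINT t|lborel. f t * G x t)" for x
    using distributed_integral[OF h, of "G x"] f by (simp add: integral_distr)
  have "(LINT \<omega>|M. G (X \<omega>) (h \<omega>)) =
      (LINT z|distr M (borel \<Otimes>\<^sub>M borel) (\<lambda>\<omega>. (X \<omega>, h \<omega>)). case_prod G z)"
    by (subst integral_distr) auto
  also have "\<dots> = (LINT z|(?X \<Otimes>\<^sub>M ?h). case_prod G z)"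
    by (simp add: indep_rvs_distr_pair[OF M ind])
  also have "\<dots> = (LINT x|?X. LINT t|?h. G x t)"
    using Xh.integral_fst'[OF int] by simp
  also have "\<dots> = (LINT x|?X. LINT t|lborel. f t * G x t)" by (simp add: inner)
  finally have eq: "(LINT \<omega>|M. G (X \<omega>) (h \<omega>)) = (LINT x|?X. LINT t|lborel. f t * G x t)" .
  have "integrable ?X (\<lambda>x. LINT t|lborel. f t * G x t)"
    using Xh.integrable_fst'[OF int] by (simp add: inner)
  from integral_norm_bound_ennreal[OF this]
  have "ennreal \<bar>LINT \<omega>|M. G (X \<omega>) (h \<omega>)\<bar> \<le> (\<integral>\<^sup>+ x. ennreal \<bar>LINT t|lborel. f t * G x t\<bar> \<partial>?X)"
    by (simp add: eq)
  also have "\<dots> \<le> (\<integral>\<^sup>+ x. C \<partial>?X)" by (intro nn_integral_mono le)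
  also have "\<dots> = C" using X.emeasure_space_1 by simp
  finally show ?thesis .
qed

lemma matrix_vector_mult_measurable [measurable]:
  fixes x :: "real^'k"
  shows "(\<lambda>A :: real^'k^'m. A *v x) \<in> borel_measurable borel"
  unfolding matrix_vector_mult_def
  by (intro borel_measurable_continuous_onI continuous_on_vec_lambda continuous_intros)

text \<open>For fixed \<open>x\<close> the tender depends on \<open>T\<close> alone, so a bound on
  the integral over \<open>h\<close> that is uniform in the tender \<open>z\<close> carries over to
  the expected costs, uniformly in \<open>x\<close>.\<close>

lemma expected_cost_diff_le:
  fixes T :: "'w \<Rightarrow> real^'k^'m" and h :: "'w \<Rightarrow> real^'m"
  assumes M: "prob_space M" and ind: "indep_rvs M T h" and T: "T \<in> borel_measurable M"
    and h: "distributed M lborel h (\<lambda>t. ennreal (f t))"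
    and f: "f \<in> borel_measurable borel" "\<And>t. 0 \<le> f t"
    and u: "finite_expected_cost M T h u" and u': "finite_expected_cost M T h u'"
    and meas: "(\<lambda>(z, t). u t z - u' t z) \<in> borel_measurable (borel \<Otimes>\<^sub>M borel)"
    and bounded: "\<And>z t. \<bar>u t z - u' t z\<bar> \<le> B"
    and le: "\<And>z. ennreal \<bar>LINT t|lborel. f t * (u t z - u' t z)\<bar> \<le> C"
  shows "sup_dist (expected_cost M T h u) (expected_cost M T h u') \<le> C"
  unfolding sup_dist_def
proof (rule SUP_least)
  fix x :: "real^'k"
  let ?G = "\<lambda>A t. u t (A *v x) - u' t (A *v x)"
  have "(\<lambda>(A, t). (A *v x, t)) \<in> (borel \<Otimes>\<^sub>M borel) \<rightarrow>\<^sub>M ((borel :: (real^'m) measure) \<Otimes>\<^sub>M (borel :: (real^'m) measure))"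
    by measurable
  from measurable_compose[OF this meas]
  have "case_prod ?G \<in> borel_measurable (borel \<Otimes>\<^sub>M borel)" by (simp add: case_prod_beta')
  then have "ennreal \<bar>LINT \<omega>|M. ?G (T \<omega>) (h \<omega>)\<bar> \<le> C"
    by (rule integral_indep_le[OF M ind T h f]) (use bounded le in auto)
  then show "ennreal \<bar>expected_cost M T h u x - expected_cost M T h u' x\<bar> \<le> C"
    using u u' by (simp add: expected_cost_def finite_expected_cost_def)
qed

context integral_recourse
begin

lemma value_hat_error:
  fixes T :: "'w \<Rightarrow> real^'k^'m" and h :: "'w \<Rightarrow> real^'m"
  assumes M: "prob_space M" and ind: "indep_rvs M T h" and T: "T \<in> borel_measurable M"
    and f: "f \<in> bv_densities" and h: "distributed M lborel h (\<lambda>t. ennreal (f t))"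
    and fin: "\<And>s. - \<infinity> < value_fun W I q s \<and> value_fun W I q s < \<infinity>"
    and u: "finite_expected_cost M T h (recourse W I q)" "finite_expected_cost M T h (recourse_hat W I q)"
  shows "sup_dist (expected_cost M T h (recourse W I q)) (expected_cost M T h (recourse_hat W I q))
    \<le> ennreal error_const * ennreal (norm_1 q) * expected_variation M h f"
proof -
  have f': "f \<in> borel_measurable borel" "\<And>t. 0 \<le> f t" using f by (auto simp: bv_densities_def)
  have mean: "(LINT u|lborel. indicator (half_open_cube 0 common_period :: (real^'m) set) u * Gamma_mean W I q b) =
      common_period ^ CARD('m) * Gamma_mean W I q b" for b
    by (rule cube_integral_const)
  have dom: "Gamma_mean W I q j + dual_mult W q j \<bullet> s \<le> Gamma_mean W I q k + dual_mult W q k \<bullet> s"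
    if "j \<in> dual_feasible W q" "k \<in> dual_feasible W q"
      "\<And>i. depth + common_period \<le> basic_coords W k s $ i" for j k s
    by (rule Gamma_dominates[OF that])
  note err = max_approximation_error[of q "\<lambda>b s. Gamma_mean W I q b", OF fin _ _ mean dom f h]
  have [measurable]: "value_hat W I q \<in> borel_measurable borel"
    unfolding value_hat_def[abs_def] using finite_dual_feasible by measurable
  show ?thesis
  proof (rule expected_cost_diff_le[OF M ind T h f' u])
    show "(\<lambda>(z, t). recourse W I q t z - recourse_hat W I q t z) \<in> borel_measurable (borel \<Otimes>\<^sub>M borel)"
      unfolding recourse_def recourse_hat_def by measurable
    show "\<bar>recourse W I q t z - recourse_hat W I q t z\<bar> \<le> gap_bound * norm_1 q" for z t
      unfolding recourse_def recourse_hat_def value_hat_def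
      using Gamma_bounds by (intro err(1)) auto
    show "ennreal \<bar>LINT t|lborel. f t * (recourse W I q t z - recourse_hat W I q t z)\<bar> \<le>
        ennreal error_const * ennreal (norm_1 q) * expected_variation M h f" for z
      unfolding recourse_def recourse_hat_def value_hat_def
      using Gamma_bounds by (intro err(2)) auto
  qed
qed

text \<open>For a fixed tender \<open>z\<close> the term \<open>psi\<close> at
  \<open>h - \<alpha>\<close> is a function of \<open>s = h - z\<close>, namely \<open>psi\<close>
  at \<open>s + (z - \<alpha>)\<close>. Cube means over a full period do not notice this shift, and
  \<open>psi_dominates\<close> allows it as its \<open>c\<close>.\<close>

lemma value_alpha_error:
  fixes T :: "'w \<Rightarrow> real^'k^'m" and h :: "'w \<Rightarrow> real^'m"
  assumes M: "prob_space M" and ind: "indep_rvs M T h" and T: "T \<in> borel_measurable M"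
    and f: "f \<in> bv_densities" and h: "distributed M lborel h (\<lambda>t. ennreal (f t))"
    and fin: "\<And>s. - \<infinity> < value_fun W I q s \<and> value_fun W I q s < \<infinity>"
    and u: "finite_expected_cost M T h (recourse W I q)" "finite_expected_cost M T h (value_alpha W I q \<alpha>)"
  shows "sup_dist (expected_cost M T h (recourse W I q)) (expected_cost M T h (value_alpha W I q \<alpha>))
    \<le> ennreal error_const * ennreal (norm_1 q) * expected_variation M h f"
proof -
  have f': "f \<in> borel_measurable borel" "\<And>t. 0 \<le> f t" using f by (auto simp: bv_densities_def)
  have mean: "(LINT u|lborel. indicator (half_open_cube 0 common_period) u * psi W I q b ((s + u) + (z - \<alpha>))) =
      common_period ^ CARD('m) * Gamma_mean W I q b" if "b \<in> dual_feasible W q" for b s z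
    using psi_cube_integral[OF that, of "s + (z - \<alpha>)"] by (simp add: add_ac)
  have dom: "psi W I q j (s + (z - \<alpha>)) + dual_mult W q j \<bullet> s \<le> psi W I q k (s + (z - \<alpha>)) + dual_mult W q k \<bullet> s"
    if "j \<in> dual_feasible W q" "k \<in> dual_feasible W q"
      "\<And>i. depth + common_period \<le> basic_coords W k s $ i" for j k s z
    by (rule psi_dominates[OF that])
  note err = max_approximation_error[of q "\<lambda>b s. psi W I q b (s + (z - \<alpha>))" for z, OF fin _ _ mean dom f h]
  have eq: "recourse W I q t z - value_alpha W I q \<alpha> t z = real_of_ereal (value_fun W I q (t - z)) -
      Max ((\<lambda>b. dual_mult W q b \<bullet> (t - z) + psi W I q b (t - z + (z - \<alpha>))) ` dual_feasible W q)" for t z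
    by (simp add: recourse_def value_alpha_def)
  show ?thesis
  proof (rule expected_cost_diff_le[OF M ind T h f' u])
    show "(\<lambda>(z, t). recourse W I q t z - value_alpha W I q \<alpha> t z) \<in> borel_measurable (borel \<Otimes>\<^sub>M borel)"
      unfolding recourse_def value_alpha_def using finite_dual_feasible by measurable
    show "\<bar>recourse W I q t z - value_alpha W I q \<alpha> t z\<bar> \<le> gap_bound * norm_1 q" for z t
      unfolding eq using psi_bounds by (intro err(1)) auto
    show "ennreal \<bar>LINT t|lborel. f t * (recourse W I q t z - value_alpha W I q \<alpha> t z)\<bar> \<le>
        ennreal error_const * ennreal (norm_1 q) * expected_variation M h f" for z
      unfolding eq using psi_bounds by (intro err(2)) auto
  qed
qed

end

lemma value_fun_finite_feasible:
  assumes "value_fun W I q s < \<infinity>"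
  shows "\<exists>y. W *v y = s \<and> (\<forall>j\<in>I. y $ j \<in> \<int>) \<and> (\<forall>j. 0 \<le> y $ j)"
  using assms unfolding value_fun_def milp_value_def INF_less_iff by auto

theorem theorem1:
  fixes M :: "'w measure"
    and W :: "real^'n^'m" and I :: "'n set"
    and \<Xi> :: "(real^'n) set"
    and T :: "'w \<Rightarrow> real^'k^'m"
    and \<alpha> :: "real^'m"
  assumes "prob_space M"
    and "\<forall>i j. W $ i $ j \<in> \<int>"
    and "\<forall>q\<in>\<Xi>. \<forall>s. - \<infinity> < value_fun W I q s \<and> value_fun W I q s < \<infinity>"
    and "T \<in> borel_measurable M"
  shows "\<exists>C1 > 0. \<exists>C2 > 0. \<forall>q\<in>\<Xi>. \<forall>f\<in>bv_densities. \<forall>h :: 'w \<Rightarrow> real^'m.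
    distributed M lborel h (\<lambda>t. ennreal (f t)) \<longrightarrow>
    indep_rvs M T h \<longrightarrow>
    integrable M (\<lambda>\<omega>. norm_1 (h \<omega>)) \<longrightarrow>
    finite_expected_cost M T h (recourse W I q) \<longrightarrow>
    finite_expected_cost M T h (recourse_hat W I q) \<longrightarrow>
    finite_expected_cost M T h (value_alpha W I q \<alpha>) \<longrightarrow>
    sup_dist (expected_cost M T h (recourse W I q)) (expected_cost M T h (recourse_hat W I q))
      \<le> ennreal C1 * ennreal (norm_1 q) *
          (\<Sum>i\<in>UNIV. \<integral>\<^sup>+ \<omega>. total_variation (cond_density f i (h \<omega>)) \<partial>M) \<and>
    sup_dist (expected_cost M T h (recourse W I q)) (expected_cost M T h (value_alpha W I q \<alpha>))
      \<le> ennreal C2 * ennreal (norm_1 q) *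
          (\<Sum>i\<in>UNIV. \<integral>\<^sup>+ \<omega>. total_variation (cond_density f i (h \<omega>)) \<partial>M)"
proof (cases "\<Xi> = {}")
  case True
  then show ?thesis by (auto intro!: exI[of _ 1])
next
  case False
  then obtain q0 where "q0 \<in> \<Xi>" by blast
  \<comment> \<open>Feasibility for every right-hand side is read off from finiteness of the value
    function for a single member of \<open>\<Xi>\<close>; the resulting constants then serve all
    members.\<close>
  interpret integral_recourse W I
    using assms(2) value_fun_finite_feasible assms(3) \<open>q0 \<in> \<Xi>\<close> by unfold_locales blast+
  show ?thesis
    using value_hat_error[OF assms(1) _ assms(4)] value_alpha_error[OF assms(1) _ assms(4)] assms(3)
    unfolding expected_variation_def
    by (intro exI[of _ error_const] conjI ballI allI impI error_const_pos) blast+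
qed

end
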